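(* For $i=1,\dots,n$ let $(\mathcal P^{(i)}_t)_{t\ge0}$ be a primitive QMS on $\mathcal B(\mathcal H_i)$ with generator $\mathcal L_i$ and invariant state $\sigma_i$, satisfying $\mathrm{LSI}_{q,\mathrm{CB}}(c_i,d_i)$. Then the QMS on $\mathcal B(\bigotimes_{i=1}^n\mathcal H_i)$ generated by $\mathcal L=\sum_{i=1}^n\bigotimes_{k<i}\mathrm{id}_{\mathcal H_k}\otimes\mathcal L_i\otimes\bigotimes_{k>i}\mathrm{id}_{\mathcal H_k}$, with invariant state $\bigotimes_i\sigma_i$, satisfies $\mathrm{LSI}_{q,\mathrm{CB}}(c,d)$ with $c=\max_ic_i$ and $d=\sum_id_i$.
   Context: All Hilbert spaces are finite-dimensional. A QMS $e^{t\mathcal L}$ (unital completely positive maps) on $\mathcal B(\mathcal K)$ is primitive if it has a unique invariant state $\sigma$, full rank, to which all states converge. For such a QMS and $k\ge1$ set, on $\mathcal B(\mathbb C^k\otimes\mathcal K)$: $\tau_k=\frac{\mathbb I_k}{k}\otimes\sigma$, $\mathcal L_k=\mathrm{id}_k\otimes\mathcal L$, $E_k[X]=\mathrm{Tr}_{\mathcal K}[(\mathbb I_k\otimes\sigma)X]\otimes\mathbb I_{\mathcal K}$, $\Gamma^s(X)=\tau_k^{s/2}X\tau_k^{s/2}$, $\|X\|_{p,\tau_k}=\|\Gamma^{1/p}(X)\|_p$ (Schatten norm), $\langle X,Y\rangle_{\tau_k}=\mathrm{Tr}[\tau_k^{1/2}X^*\tau_k^{1/2}Y]$, $I_{q,p}(X)=\Gamma^{-1/q}(|\Gamma^{1/p}(X)|^{p/q})$;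 Dirichlet form $\mathcal E_p(X)=-\frac{p}{2(p-1)}\langle I_{p',p}(X),\mathcal L_k(X)\rangle_{\tau_k}$ for $p>1$ ($p'$ conjugate), $\mathcal E_1(X)=-\frac12\mathrm{Tr}[\Gamma^1(\mathcal L_k X)(\ln\Gamma^1(X)-\ln\tau_k)]$; entropy for $X>0$, $Z=\Gamma^{1/p}(X)$: $\mathrm{Ent}_p(X)=\frac1p\mathrm{Tr}[Z^p(\ln Z^p-\ln\tau_k-\ln E_k[\tau_k^{-1/2}Z^p\tau_k^{-1/2}])]$. The QMS satisfies $\mathrm{LSI}_{q,\mathrm{CB}}(c,d)$ if for all $k\ge1$ and positive definite $X$, $\mathrm{Ent}_q(X)\le c\,\mathcal E_q(X)+\frac{2d}{q}\|X\|^q_{q,\tau_k}$. *)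

theory Defs
  imports Complex_Main "Jordan_Normal_Form.Matrix"
begin

(* B(C^m) is represented by carrier_mat m m.                              *)

definition mtrace :: "complex mat \<Rightarrow> complex" where
  "mtrace A = (\<Sum>i<dim_row A. A $$ (i,i))"

definition adj :: "complex mat \<Rightarrow> complex mat" where
  "adj A = mat (dim_col A) (dim_row A) (\<lambda>(i,j). cnj (A $$ (j,i)))"

definition unitary_mat :: "nat \<Rightarrow> complex mat \<Rightarrow> bool" where
  "unitary_mat n U \<longleftrightarrow> U \<in> carrier_mat n n \<and> U * adj U = 1\<^sub>m n \<and> adj U * U = 1\<^sub>m n"

definition hermitian :: "complex mat \<Rightarrow> bool" where
  "hermitian A \<longleftrightarrow> dim_row A = dim_col A \<and> adj A = A"

definition qform :: "complex mat \<Rightarrow> complex vec \<Rightarrow> complex" where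
  "qform A v = (\<Sum>i<dim_row A. \<Sum>j<dim_row A. cnj (v $ i) * A $$ (i,j) * v $ j)"

definition psd :: "complex mat \<Rightarrow> bool" where
  "psd A \<longleftrightarrow> hermitian A \<and>
     (\<forall>v \<in> carrier_vec (dim_row A). Re (qform A v) \<ge> 0)"

definition pos_def :: "complex mat \<Rightarrow> bool" where
  "pos_def A \<longleftrightarrow> hermitian A \<and>
     (\<forall>v \<in> carrier_vec (dim_row A). v \<noteq> 0\<^sub>v (dim_row A) \<longrightarrow> Re (qform A v) > 0)"

definition density_state :: "nat \<Rightarrow> complex mat \<Rightarrow> bool" where
  "density_state m \<rho> \<longleftrightarrow> \<rho> \<in> carrier_mat m m \<and> psd \<rho> \<and> mtrace \<rho> = 1"

(* functional calculus of a Hermitian matrix via a spectral decomposition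
   A = U diag(d) U^*  (the value does not depend on the chosen decomposition) *)
definition mat_fun :: "(real \<Rightarrow> real) \<Rightarrow> complex mat \<Rightarrow> complex mat" where
  "mat_fun f A = (SOME B. \<exists>U (d :: nat \<Rightarrow> real).
      unitary_mat (dim_row A) U \<and>
      A = U * mat_diag (dim_row A) (\<lambda>i. complex_of_real (d i)) * adj U \<and>
      B = U * mat_diag (dim_row A) (\<lambda>i. complex_of_real (f (d i))) * adj U)"

definition mpow :: "complex mat \<Rightarrow> real \<Rightarrow> complex mat" where
  "mpow A s = mat_fun (\<lambda>x. x powr s) A"

definition mlog :: "complex mat \<Rightarrow> complex mat" where
  "mlog A = mat_fun ln A"

definition abs_pow :: "complex mat \<Rightarrow> real \<Rightarrow> complex mat" where
  "abs_pow Y r = mpow (adj Y * Y) (r / 2)"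

definition schatten :: "real \<Rightarrow> complex mat \<Rightarrow> real" where
  "schatten p Y = (Re (mtrace (abs_pow Y p))) powr (1 / p)"

(* Kronecker product, row index of A\<otimes>B is  i_A * dim_row B + i_B *)
definition kron :: "complex mat \<Rightarrow> complex mat \<Rightarrow> complex mat" where
  "kron A B = mat (dim_row A * dim_row B) (dim_col A * dim_col B)
     (\<lambda>(i,j). A $$ (i div dim_row B, j div dim_col B) * B $$ (i mod dim_row B, j mod dim_col B))"

definition superop :: "nat \<Rightarrow> (complex mat \<Rightarrow> complex mat) \<Rightarrow> bool" where
  "superop m L \<longleftrightarrow>
     (\<forall>X \<in> carrier_mat m m. L X \<in> carrier_mat m m) \<and>
     (\<forall>X \<in> carrier_mat m m. \<forall>Y \<in> carrier_mat m m. L (X + Y) = L X + L Y) \<and>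
     (\<forall>X \<in> carrier_mat m m. \<forall>a. L (a \<cdot>\<^sub>m X) = a \<cdot>\<^sub>m L X)"

definition sexp :: "nat \<Rightarrow> real \<Rightarrow> (complex mat \<Rightarrow> complex mat) \<Rightarrow> complex mat \<Rightarrow> complex mat" where
  "sexp m t L X = mat m m (\<lambda>(i,j).
      (\<Sum>n. complex_of_real (t ^ n / fact n) * ((L ^^ n) X) $$ (i,j)))"

(* (a,b) block of size m x m of a (k m) x (k m) matrix, i.e. B(C^k \<otimes> C^m) *)
definition blk :: "nat \<Rightarrow> complex mat \<Rightarrow> nat \<Rightarrow> nat \<Rightarrow> complex mat" where
  "blk m X a b = mat m m (\<lambda>(r,s). X $$ (a * m + r, b * m + s))"

(* id_k \<otimes> \<Phi> on B(C^k \<otimes> C^m) *)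
definition ampl :: "nat \<Rightarrow> nat \<Rightarrow> (complex mat \<Rightarrow> complex mat) \<Rightarrow> complex mat \<Rightarrow> complex mat" where
  "ampl k m \<Phi> X = mat (k * m) (k * m)
     (\<lambda>(i,j). (\<Phi> (blk m X (i div m) (j div m))) $$ (i mod m, j mod m))"

(* id_a \<otimes> \<Phi> \<otimes> id_b on B(C^a \<otimes> C^m \<otimes> C^b), index (x,y,z) \<mapsto> (x*m+y)*b+z *)
definition ampl_mid :: "nat \<Rightarrow> nat \<Rightarrow> nat \<Rightarrow> (complex mat \<Rightarrow> complex mat) \<Rightarrow> complex mat \<Rightarrow> complex mat" where
  "ampl_mid a m b \<Phi> X = mat (a * m * b) (a * m * b)
     (\<lambda>(I,J). (\<Phi> (mat m m (\<lambda>(r,s). X $$ (((I div b) div m * m + r) * b + I mod b,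
                                                  ((J div b) div m * m + s) * b + J mod b))))
               $$ ((I div b) mod m, (J div b) mod m))"

definition completely_positive :: "nat \<Rightarrow> (complex mat \<Rightarrow> complex mat) \<Rightarrow> bool" where
  "completely_positive m \<Phi> \<longleftrightarrow>
     (\<forall>k \<ge> 1. \<forall>X \<in> carrier_mat (k * m) (k * m). psd X \<longrightarrow> psd (ampl k m \<Phi> X))"

(* L generates a quantum Markov semigroup (Heisenberg picture):
   every e^{tL}, t \<ge> 0, is unital and completely positive *)
definition is_QMS :: "nat \<Rightarrow> (complex mat \<Rightarrow> complex mat) \<Rightarrow> bool" where
  "is_QMS m L \<longleftrightarrow> m \<ge> 1 \<and> superop m L \<and>
     (\<forall>t \<ge> 0. completely_positive m (sexp m t L) \<and> sexp m t L (1\<^sub>m m) = 1\<^sub>m m)"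

definition invariant_state :: "nat \<Rightarrow> (complex mat \<Rightarrow> complex mat) \<Rightarrow> complex mat \<Rightarrow> bool" where
  "invariant_state m L \<sigma> \<longleftrightarrow> density_state m \<sigma> \<and>
     (\<forall>t \<ge> 0. \<forall>X \<in> carrier_mat m m. mtrace (\<sigma> * sexp m t L X) = mtrace (\<sigma> * X))"

(* primitive QMS with invariant state \<sigma>: unique invariant state, full rank,
   and every state \<rho> converges to \<sigma> (\<rho>_t = (e^{tL})_*(\<rho>), tested weakly
   against all observables) *)
definition primitive_QMS :: "nat \<Rightarrow> (complex mat \<Rightarrow> complex mat) \<Rightarrow> complex mat \<Rightarrow> bool" where
  "primitive_QMS m L \<sigma> \<longleftrightarrow> is_QMS m L \<and> invariant_state m L \<sigma> \<and> pos_def \<sigma> \<and>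
     (\<forall>\<rho>. invariant_state m L \<rho> \<longrightarrow> \<rho> = \<sigma>) \<and>
     (\<forall>\<rho> X. density_state m \<rho> \<longrightarrow> X \<in> carrier_mat m m \<longrightarrow>
        ((\<lambda>t. mtrace (\<rho> * sexp m t L X)) \<longlongrightarrow> mtrace (\<sigma> * X)) at_top)"

definition tau :: "nat \<Rightarrow> complex mat \<Rightarrow> complex mat" where
  "tau k \<sigma> = kron (complex_of_real (1 / real k) \<cdot>\<^sub>m 1\<^sub>m k) \<sigma>"

(* E_k[X] = Tr_K[(I_k \<otimes> \<sigma>) X] \<otimes> I_K *)
definition cond_exp :: "nat \<Rightarrow> nat \<Rightarrow> complex mat \<Rightarrow> complex mat \<Rightarrow> complex mat" where
  "cond_exp k m \<sigma> X = kron (mat k k (\<lambda>(a,b). mtrace (\<sigma> * blk m X a b))) (1\<^sub>m m)"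

definition Gam :: "complex mat \<Rightarrow> real \<Rightarrow> complex mat \<Rightarrow> complex mat" where
  "Gam \<tau> s X = mpow \<tau> (s / 2) * X * mpow \<tau> (s / 2)"

definition wnorm :: "complex mat \<Rightarrow> real \<Rightarrow> complex mat \<Rightarrow> real" where
  "wnorm \<tau> p X = schatten p (Gam \<tau> (1 / p) X)"

definition winner :: "complex mat \<Rightarrow> complex mat \<Rightarrow> complex mat \<Rightarrow> complex" where
  "winner \<tau> X Y = mtrace (mpow \<tau> (1/2) * adj X * mpow \<tau> (1/2) * Y)"

definition Iqp :: "complex mat \<Rightarrow> real \<Rightarrow> real \<Rightarrow> complex mat \<Rightarrow> complex mat" where
  "Iqp \<tau> q p X = Gam \<tau> (- 1 / q) (abs_pow (Gam \<tau> (1 / p) X) (p / q))"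

(* Dirichlet form E_p on level k (the value is real; Re only fixes the type) *)
definition dirichlet :: "nat \<Rightarrow> nat \<Rightarrow> (complex mat \<Rightarrow> complex mat) \<Rightarrow> complex mat \<Rightarrow> real \<Rightarrow> complex mat \<Rightarrow> real" where
  "dirichlet k m L \<sigma> p X =
     (let \<tau> = tau k \<sigma>; Lk = ampl k m L in
      if p = 1 then
        - 1 / 2 * Re (mtrace (Gam \<tau> 1 (Lk X) * (mlog (Gam \<tau> 1 X) - mlog \<tau>)))
      else
        - (p / (2 * (p - 1))) * Re (winner \<tau> (Iqp \<tau> (p / (p - 1)) p X) (Lk X)))"

definition entropy :: "nat \<Rightarrow> nat \<Rightarrow> complex mat \<Rightarrow> real \<Rightarrow> complex mat \<Rightarrow> real" where
  "entropy k m \<sigma> p X =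
     (let \<tau> = tau k \<sigma>; Z = Gam \<tau> (1 / p) X; W = mpow Z p in
      1 / p * Re (mtrace (W * (mlog W - mlog \<tau>
                     - mlog (cond_exp k m \<sigma> (mpow \<tau> (- 1 / 2) * W * mpow \<tau> (- 1 / 2)))))))"

definition LSI_CB :: "real \<Rightarrow> real \<Rightarrow> real \<Rightarrow> nat \<Rightarrow> (complex mat \<Rightarrow> complex mat) \<Rightarrow> complex mat \<Rightarrow> bool" where
  "LSI_CB q c d m L \<sigma> \<longleftrightarrow>
     (\<forall>k \<ge> 1. \<forall>X \<in> carrier_mat (k * m) (k * m). pos_def X \<longrightarrow>
        entropy k m \<sigma> q X \<le> c * dirichlet k m L \<sigma> q X + 2 * d / q * (wnorm (tau k \<sigma>) q X) powr q)"

definition kron_list :: "complex mat list \<Rightarrow> complex mat" where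
  "kron_list As = foldl kron (1\<^sub>m 1) As"

definition tensor_generator :: "nat \<Rightarrow> (nat \<Rightarrow> nat) \<Rightarrow> (nat \<Rightarrow> complex mat \<Rightarrow> complex mat)
     \<Rightarrow> complex mat \<Rightarrow> complex mat" where
  "tensor_generator n dms Ls X =
     foldr (\<lambda>i Y. ampl_mid (\<Prod>k<i. dms k) (dms i) (\<Prod>k\<in>{Suc i..<n}. dms k) (Ls i) X + Y)
       [0..<n] (0\<^sub>m (\<Prod>k<n. dms k) (\<Prod>k<n. dms k))"

end

theory Submission
  imports Defs "HOL-Complex_Analysis.Conformal_Mappings" "Jordan_Normal_Form.Spectral_Radius"
begin

text \<open>Write \<open>W = Z^q\<close> with \<open>Z = \<Gamma>^(1/q)(X)\<close>, and let \<open>W_A\<close> be its partial trace over \<open>K\<close>. Then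
  \<open>q Ent_q(X) = Tr W ln W - Tr W (1 \<otimes> ln \<sigma>) - Tr W_A ln W_A\<close>, so that for \<open>K = K1 \<otimes> K2\<close> strong subadditivity
  bounds the entropy by the sum of the entropies of the two factors, each taken with the other factor absorbed into the
  ancilla. The Dirichlet form of the product is the sum of the Dirichlet forms of the factors, since replacing the
  reference \<open>\<gamma> \<otimes> \<sigma>\<close> by \<open>1 \<otimes> \<sigma>\<close> does not change the form of \<open>id \<otimes> L\<close>. Passing from
  \<open>c_i\<close> to \<open>max c_i\<close> needs Dirichlet forms to be nonnegative. Both analytic inputs come from Hadamard's three lines
  theorem applied to traces of complex matrix powers: strong subadditivity from the function
  \<open>Tr (\<rho>^(1-s) R1^(s/2) RA^(-s/2) R2^s RA^(-s/2) R1^(s/2))\<close>, and nonnegativity from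
  \<open>Tr (\<tau>^(s/2) R^(1-s) \<tau>^(s/2) P(\<tau>^(-s/2) R^s \<tau>^(-s/2)))\<close> for a unital completely positive \<open>\<tau>\<close>-preserving \<open>P\<close>;
  for \<open>q = 1\<close> one differentiates the latter at \<open>s = 1\<close>.\<close>

unbundle no vec_syntax
hide_const (open) Finite_Cartesian_Product.mat Finite_Cartesian_Product.vec
hide_type (open) Finite_Cartesian_Product.vec

section \<open>Matrix algebra\<close>

text \<open>No detailed balance is assumed, so a Dirichlet form is not the form of a symmetric
  generator and its sign cannot be read off directly. It comes from the semigroup: Tr(B e^(tL) X),
  with B built from powers or logarithms of Z and \<tau>, is largest at t = 0, and its derivative
  there is a negative multiple of the Dirichlet form. Complex powers fit this task because on each
  edge of the strip some of the powers become unitary, so that Cauchy-Schwarz bounds the trace; for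
  the inequalities with logarithms the same bound is attained at an endpoint of [0,1], hence the
  derivative there has a sign, and differentiating a power produces a logarithm. The arbitrary
  ancilla in the hypothesis is what makes an induction over factors possible, but an absorbed factor
  brings its own weight \<sigma>_j where the hypothesis has a normalised identity; this mismatch is
  why the reference must be changed. Primitivity is carried through the induction together with the
  inequality, since the step for two factors uses it for both of them.\<close>

lemma mult_entry:
  "i < dim_row A \<Longrightarrow> j < dim_col B \<Longrightarrow> dim_col A = dim_row B \<Longrightarrow>
    (A * B) $$ (i,j) = (\<Sum>k<dim_row B. A $$ (i,k) * B $$ (k,j))"
  by (simp add: scalar_prod_def lessThan_atLeast0)

lemma mat_assoc:
  "dim_col A = dim_row B \<Longrightarrow> dim_col B = dim_row C \<Longrightarrow> A * B * C = A * (B * (C :: complex mat))"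
  by (rule assoc_mult_mat[of A "dim_row A" "dim_row B" B "dim_row C" C "dim_col C"]) auto

lemma mat_one_left: "dim_row A = n \<Longrightarrow> 1\<^sub>m n * A = (A :: complex mat)"
  by (rule left_mult_one_mat[of A n "dim_col A"]) auto

lemma mat_one_right: "dim_col A = n \<Longrightarrow> A * 1\<^sub>m n = (A :: complex mat)"
  by (rule right_mult_one_mat[of A "dim_row A" n]) auto

lemma mat_distrib_left:
  "dim_col A = dim_row B \<Longrightarrow> dim_row B = dim_row C \<Longrightarrow> dim_col B = dim_col C \<Longrightarrow>
    A * (B + C) = A * B + A * (C :: complex mat)"
  by (rule mult_add_distrib_mat[of A "dim_row A" "dim_row B" B "dim_col B" C]) auto

lemma mat_distrib_right:
  "dim_row A = dim_row B \<Longrightarrow> dim_col A = dim_col B \<Longrightarrow> dim_col B = dim_row C \<Longrightarrow>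
    (A + B) * C = A * C + B * (C :: complex mat)"
  by (rule add_mult_distrib_mat[of A "dim_row A" "dim_col A" B C "dim_col C"]) auto

lemma mat_smult_left: "dim_col A = dim_row B \<Longrightarrow> (a \<cdot>\<^sub>m A) * B = a \<cdot>\<^sub>m (A * (B :: complex mat))"
  by (rule mult_smult_assoc_mat[of A "dim_row A" "dim_row B" B "dim_col B"]) auto

lemma mat_smult_right: "dim_col A = dim_row B \<Longrightarrow> A * (a \<cdot>\<^sub>m B) = a \<cdot>\<^sub>m (A * (B :: complex mat))"
  by (rule mult_smult_distrib[of A "dim_row A" "dim_row B" B "dim_col B"]) auto

lemma smult_smult_mat: "a \<cdot>\<^sub>m (b \<cdot>\<^sub>m A) = (a * b) \<cdot>\<^sub>m (A :: complex mat)"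
  by (rule eq_matI) auto

section \<open>Adjoints, traces and unitary matrices\<close>

lemma adj_dim [simp]: "dim_row (adj A) = dim_col A" "dim_col (adj A) = dim_row A"
  by (auto simp: adj_def)

lemma adj_entry [simp]: "i < dim_col A \<Longrightarrow> j < dim_row A \<Longrightarrow> adj A $$ (i,j) = cnj (A $$ (j,i))"
  by (auto simp: adj_def)

lemma adj_adj [simp]: "adj (adj A) = A"
  by (rule eq_matI) auto

lemma adj_mult: "dim_col A = dim_row B \<Longrightarrow> adj (A * B) = adj B * adj A"
  by (rule eq_matI) (auto simp: mult_entry mult.commute simp del: index_mult_mat(1))

lemma adj_one [simp]: "adj (1\<^sub>m n) = 1\<^sub>m n"
  by (rule eq_matI) auto

lemma mtrace_cyc:
  assumes "dim_col A = dim_row B" "dim_col B = dim_row A"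
  shows "mtrace (A * B) = mtrace (B * A)"
proof -
  have "mtrace (A * B) = (\<Sum>i<dim_row A. \<Sum>k<dim_row B. A $$ (i,k) * B $$ (k,i))"
    using assms by (auto simp: mtrace_def mult_entry simp del: index_mult_mat(1) intro!: sum.cong)
  also have "\<dots> = (\<Sum>k<dim_row B. \<Sum>i<dim_row A. B $$ (k,i) * A $$ (i,k))"
    by (subst sum.swap) (simp add: mult.commute)
  also have "\<dots> = mtrace (B * A)"
    using assms by (auto simp: mtrace_def mult_entry simp del: index_mult_mat(1) intro!: sum.cong)
  finally show ?thesis .
qed

lemma mtrace_add: "dim_row A = dim_row B \<Longrightarrow> dim_col B = dim_row B \<Longrightarrow> mtrace (A + B) = mtrace A + mtrace B"
  by (auto simp: mtrace_def sum.distrib)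

lemma mtrace_minus: "dim_row A = dim_row B \<Longrightarrow> dim_col B = dim_row B \<Longrightarrow> mtrace (A - B) = mtrace A - mtrace B"
  by (auto simp: mtrace_def sum_subtractf)

lemma mtrace_smult: "dim_col A = dim_row A \<Longrightarrow> mtrace (a \<cdot>\<^sub>m A) = a * mtrace A"
  by (auto simp: mtrace_def sum_distrib_left)

lemma mtrace_mult_sum:
  "dim_row A = n \<Longrightarrow> dim_col A = n \<Longrightarrow> dim_row B = n \<Longrightarrow> dim_col B = n \<Longrightarrow>
    mtrace (A * B) = (\<Sum>i<n. \<Sum>j<n. A $$ (i,j) * B $$ (j,i))"
  by (auto simp: mtrace_def mult_entry simp del: index_mult_mat(1) intro!: sum.cong)

lemma mtrace_adj_mult_nonneg: "Re (mtrace (adj A * A)) \<ge> 0"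
proof -
  have "mtrace (adj A * A) = (\<Sum>i<dim_col A. \<Sum>k<dim_row A. complex_of_real ((cmod (A $$ (k,i)))\<^sup>2))"
    by (auto simp: mtrace_def mult_entry mult.commute simp flip: complex_norm_square simp del: index_mult_mat(1) intro!: sum.cong)
  thus ?thesis by (auto intro!: sum_nonneg)
qed

lemma mat_diag_dims [simp]: "dim_row (mat_diag n f) = n" "dim_col (mat_diag n f) = n"
  by (auto simp: mat_diag_def)

lemma adj_mat_diag: "adj (mat_diag n f) = mat_diag n (\<lambda>i. cnj (f i))"
  by (rule eq_matI) (auto simp: mat_diag_def)

lemma unitary_dims: "unitary_mat n U \<Longrightarrow> dim_row U = n" "unitary_mat n U \<Longrightarrow> dim_col U = n"
  by (auto simp: unitary_mat_def)

lemma unitary_mult: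
  assumes "unitary_mat n U" "unitary_mat n V"
  shows "unitary_mat n (U * V)"
proof -
  note d = unitary_dims[OF assms(1)] unitary_dims[OF assms(2)]
  have 1: "U * adj U = 1\<^sub>m n" "adj U * U = 1\<^sub>m n" "V * adj V = 1\<^sub>m n" "adj V * V = 1\<^sub>m n"
    using assms by (auto simp: unitary_mat_def)
  have "U * V * adj (U * V) = U * (V * adj V) * adj U"
    using d by (simp add: adj_mult mat_assoc)
  moreover have "adj (U * V) * (U * V) = adj V * (adj U * U) * V"
    using d by (simp add: adj_mult mat_assoc)
  ultimately show ?thesis using d 1 by (auto simp: unitary_mat_def mat_one_left mat_one_right)
qed

section \<open>The spectral theorem\<close>

text \<open>The reflection along \<open>w = v - al e_0\<close>, with normalisation
  \<open>c = |w|^2 / 2\<close>, sends \<open>e_0\<close> to a multiple of the unit vector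
  \<open>v\<close>. This completes an eigenvector to a unitary in one stroke.\<close>

lemma householder:
  fixes v :: "nat \<Rightarrow> complex"
  assumes n: "n > 0" and v: "(\<Sum>i<n. (cmod (v i))\<^sup>2) = 1"
  obtains H a where "unitary_mat n H" "a \<noteq> 0" "\<And>i. i < n \<Longrightarrow> H $$ (i,0) = a * v i"
proof -
  \<comment> \<open>The phase opposite to that of \<open>v 0\<close> gives \<open>v 0 - al\<close>
    the modulus \<open>1 + |v 0|\<close>, so \<open>w\<close> never vanishes.\<close>
  define al where "al = (if v 0 = 0 then -1 else - (v 0 / cmod (v 0)))"
  define c where "c = 1 + cmod (v 0)"
  have c: "c > 0" "complex_of_real c \<noteq> 0" proof -
    show "c > 0" by (simp add: c_def add_pos_nonneg)
    thus "complex_of_real c \<noteq> 0" by simp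
  qed
  have al1: "al * cnj al = 1"
    by (auto simp: al_def complex_norm_square[symmetric] norm_divide divide_simps power2_eq_square)
  hence al2: "cmod al = 1" by (auto simp: al_def norm_divide)
  have v0: "v 0 = - al * cmod (v 0)" by (auto simp: al_def)
  define w where "w i = v i - (if i = 0 then al else 0)" for i
  have w0: "w 0 = - al * c" using v0 by (simp add: w_def c_def algebra_simps)
  have sw: "(\<Sum>k<n. w k * cnj (w k)) = 2 * c"
  proof -
    obtain n' where n': "n = Suc n'" using n by (cases n) auto
    have "(\<Sum>k<n. w k * cnj (w k)) = (\<Sum>k<n. complex_of_real ((cmod (w k))\<^sup>2))"
      by (intro sum.cong refl) (simp flip: complex_norm_square)
    also have "\<dots> = of_real ((cmod (w 0))\<^sup>2 + (\<Sum>k<n'. (cmod (v (Suc k)))\<^sup>2))"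
      unfolding n' sum.lessThan_Suc_shift by (simp add: w_def)
    also have "(\<Sum>k<n'. (cmod (v (Suc k)))\<^sup>2) = 1 - (cmod (v 0))\<^sup>2"
      using v unfolding n' sum.lessThan_Suc_shift by simp
    also have "(cmod (w 0))\<^sup>2 = c\<^sup>2" unfolding w0 using c by (simp add: norm_mult al2)
    finally show ?thesis by (simp add: c_def power2_eq_square algebra_simps)
  qed
  define H where "H = mat n n (\<lambda>(i,j). (if i = j then 1 else 0) - w i * cnj (w j) / c)"
  have dH [simp]: "dim_row H = n" "dim_col H = n" by (auto simp: H_def)
  have aH: "adj H = H"
    by (rule eq_matI) (auto simp: H_def)
  have HH: "H * H = 1\<^sub>m n"
  proof (rule eq_matI)
    fix i j assume ij: "i < dim_row (1\<^sub>m n :: complex mat)" "j < dim_col (1\<^sub>m n :: complex mat)"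
    hence ij: "i < n" "j < n" by auto
    have "(H * H) $$ (i,j) = (\<Sum>k<n. H $$ (i,k) * H $$ (k,j))"
      using ij by (simp add: mult_entry del: index_mult_mat(1))
    also have "\<dots> = (\<Sum>k<n. (if i = k then (if k = j then 1 else 0) - w k * cnj (w j) / c else 0)
        - (if k = j then w i * cnj (w k) / c else 0) + (w k * cnj (w k)) * (w i * cnj (w j) / c / c))"
      using ij by (intro sum.cong) (auto simp: H_def algebra_simps)
    also have "\<dots> = (if i = j then 1 else 0) - w i * cnj (w j) / c - w i * cnj (w j) / c
        + 2 * c * (w i * cnj (w j) / c / c)"
      using ij unfolding sum.distrib sum_subtractf sum_distrib_right[symmetric] sw by simp
    also have "\<dots> = (if i = j then 1 else 0)" using c by simp
    finally show "(H * H) $$ (i,j) = 1\<^sub>m n $$ (i,j)" using ij by simp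
  qed auto
  show ?thesis
  proof (rule that[of H "cnj al"])
    show "unitary_mat n H" using HH aH by (auto simp: unitary_mat_def carrier_matI)
    show "cnj al \<noteq> 0" using al2 by auto
    fix i assume i: "i < n"
    have "H $$ (i,0) = (if i = 0 then 1 else 0) - w i * cnj (w 0) / c"
      using i n by (simp add: H_def)
    also have "\<dots> = (if i = 0 then 1 else 0) + w i * cnj al"
      unfolding w0 using c by simp
    also have "\<dots> = cnj al * v i"
      using al1 by (simp add: w_def algebra_simps)
    finally show "H $$ (i,0) = cnj al * v i" .
  qed
qed

lemma hermitian_entry:
  "hermitian A \<Longrightarrow> i < dim_row A \<Longrightarrow> j < dim_row A \<Longrightarrow> A $$ (i,j) = cnj (A $$ (j,i))"
  unfolding hermitian_def by (metis adj_entry)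

lemma hermitian_conj:
  "hermitian A \<Longrightarrow> dim_col M = dim_row A \<Longrightarrow> hermitian (M * A * adj M)"
  by (auto simp: hermitian_def adj_mult mat_assoc)

text \<open>Induction on the dimension: a unitary whose first column is an eigenvector splits off a
  1 x 1 block, because Hermiticity turns the vanishing rest of the first column into a vanishing
  rest of the first row.\<close>

theorem spectral_hermitian:
  assumes "hermitian A" "dim_row A = n"
  shows "\<exists>U (d :: nat \<Rightarrow> real). unitary_mat n U \<and>
    A = U * mat_diag n (\<lambda>i. complex_of_real (d i)) * adj U"
  using assms
proof (induction n arbitrary: A)
  case 0
  thus ?case by (intro exI[of _ "1\<^sub>m 0"] exI[of _ "\<lambda>_. 0"]) (auto simp: unitary_mat_def hermitian_def)
next
  case (Suc n)
  let ?N = "Suc n"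
  have dA [simp]: "dim_row A = ?N" "dim_col A = ?N" using Suc.prems by (auto simp: hermitian_def)
  have "spectrum A \<noteq> {}" by (rule spectrum_non_empty[of A ?N]) auto
  then obtain l v where lv: "v \<in> carrier_vec ?N" "v \<noteq> 0\<^sub>v ?N" "A *\<^sub>v v = l \<cdot>\<^sub>v v"
    by (auto simp: spectrum_def eigenvalue_def eigenvector_def)
  define s where "s = (\<Sum>i<?N. (cmod (v $ i))\<^sup>2)"
  have s: "s > 0"
  proof -
    obtain i where "i < ?N" "v $ i \<noteq> 0" using lv by (metis carrier_vecD eq_vecI index_zero_vec)
    thus ?thesis unfolding s_def by (intro sum_pos2[of _ i]) auto
  qed
  have Av: "(\<Sum>j<?N. A $$ (i,j) * v $ j) = l * v $ i" if "i < ?N" for i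
  proof -
    have "(A *\<^sub>v v) $ i = (l \<cdot>\<^sub>v v) $ i" using lv by simp
    thus ?thesis using that lv(1) by (simp add: scalar_prod_def lessThan_atLeast0)
  qed
  have "(\<Sum>i<?N. (cmod (v $ i / sqrt s))\<^sup>2) = 1"
    using s by (simp add: norm_divide power_divide s_def[symmetric] del: sum.lessThan_Suc flip: sum_divide_distrib)
  then obtain H a where H: "unitary_mat ?N H" "a \<noteq> 0" "\<And>i. i < ?N \<Longrightarrow> H $$ (i,0) = a * (v $ i / sqrt s)"
    using householder[of ?N "\<lambda>i. v $ i / sqrt s"] by blast
  have dH [simp]: "dim_row H = ?N" "dim_col H = ?N" using unitary_dims[OF H(1)] by auto
  have HH: "H * adj H = 1\<^sub>m ?N" "adj H * H = 1\<^sub>m ?N" using H by (auto simp: unitary_mat_def)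
  define B where "B = adj H * A * H"
  have dB [simp]: "dim_row B = ?N" "dim_col B = ?N" by (auto simp: B_def)
  have hB: "hermitian B" unfolding B_def using hermitian_conj[of A "adj H"] Suc.prems by simp
  have AH: "(A * H) $$ (k,0) = l * H $$ (k,0)" if "k < ?N" for k
  proof -
    have "(A * H) $$ (k,0) = (\<Sum>j<?N. A $$ (k,j) * v $ j) * (a / sqrt s)"
      using that H(3) by (simp add: mult_entry sum_distrib_left sum_distrib_right sum_divide_distrib algebra_simps del: index_mult_mat(1) sum.lessThan_Suc)
    thus ?thesis using Av[OF that] H(3)[OF that] by simp
  qed
  have B0: "B $$ (i,0) = (if i = 0 then l else 0)" if i: "i < ?N" for i
  proof -
    have "B $$ (i,0) = (adj H * (A * H)) $$ (i,0)" by (simp add: B_def mat_assoc)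
    also have "\<dots> = (\<Sum>k<?N. adj H $$ (i,k) * (A * H) $$ (k,0))"
      using i by (subst mult_entry) auto
    also have "\<dots> = l * (\<Sum>k<?N. adj H $$ (i,k) * H $$ (k,0))"
      unfolding sum_distrib_left by (intro sum.cong refl) (use AH in auto)
    also have "(\<Sum>k<?N. adj H $$ (i,k) * H $$ (k,0)) = (adj H * H) $$ (i,0)"
      using i by (subst mult_entry) auto
    finally show ?thesis using HH i by simp
  qed
  have B0': "B $$ (0,i) = (if i = 0 then l else 0)" if i: "i < ?N" for i
    using hermitian_entry[OF hB, of 0 i] hermitian_entry[OF hB, of 0 0] B0[OF i] B0[of 0] i by (auto split: if_splits)
  have lr: "l = of_real (Re l)"
    using hermitian_entry[OF hB, of 0 0] B0[of 0] by (auto simp: complex_eq_iff)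
  define B' where "B' = mat n n (\<lambda>(i,j). B $$ (Suc i, Suc j))"
  have "hermitian B'"
    unfolding hermitian_def
    by (auto simp: B'_def adj_def intro!: eq_matI hermitian_entry[OF hB, symmetric])
  from Suc.IH[OF this] obtain V d where V: "unitary_mat n V" "B' = V * mat_diag n (\<lambda>i. complex_of_real (d i)) * adj V"
    by (auto simp: B'_def)
  have dV [simp]: "dim_row V = n" "dim_col V = n" using unitary_dims[OF V(1)] by auto
  \<comment> \<open>The unitary that diagonalises the smaller block, bordered by 1.\<close>
  define V' where "V' = mat ?N ?N (\<lambda>(i,j). if i = 0 \<or> j = 0 then (if i = j then 1 else 0) else V $$ (i-1,j-1))"
  have dV' [simp]: "dim_row V' = ?N" "dim_col V' = ?N" by (auto simp: V'_def)
  have V'e: "V' $$ (0,0) = 1" "i < n \<Longrightarrow> V' $$ (Suc i, 0) = 0" "i < n \<Longrightarrow> V' $$ (0, Suc i) = 0"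
    "i < n \<Longrightarrow> j < n \<Longrightarrow> V' $$ (Suc i, Suc j) = V $$ (i,j)" for i j by (auto simp: V'_def)
  define d' where "d' i = (case i of 0 \<Rightarrow> Re l | Suc i \<Rightarrow> d i)" for i
  let ?D = "mat_diag ?N (\<lambda>i. complex_of_real (d' i))"
  have VV: "V * adj V = 1\<^sub>m n" "adj V * V = 1\<^sub>m n" using V by (auto simp: unitary_mat_def)
  have VVe: "(\<Sum>k<n. V $$ (i,k) * cnj (V $$ (j,k))) = (if i = j then 1 else 0)"
       "(\<Sum>k<n. cnj (V $$ (k,i)) * V $$ (k,j)) = (if i = j then 1 else 0)" if "i < n" "j < n" for i j
    using VV[THEN arg_cong[where f="\<lambda>M. M $$ (i,j)"]] that
    by (auto simp: mult_entry simp del: index_mult_mat(1))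
  have uV: "unitary_mat ?N V'"
  proof -
    have "V' * adj V' = 1\<^sub>m ?N"
    proof (rule eq_matI)
      fix i j assume "i < dim_row (1\<^sub>m ?N :: complex mat)" "j < dim_col (1\<^sub>m ?N :: complex mat)"
      thus "(V' * adj V') $$ (i,j) = 1\<^sub>m ?N $$ (i,j)"
        by (cases i; cases j) (auto simp: mult_entry sum.lessThan_Suc_shift V'e VVe simp del: index_mult_mat(1) sum.lessThan_Suc)
    qed auto
    moreover have "adj V' * V' = 1\<^sub>m ?N"
    proof (rule eq_matI)
      fix i j assume "i < dim_row (1\<^sub>m ?N :: complex mat)" "j < dim_col (1\<^sub>m ?N :: complex mat)"
      thus "(adj V' * V') $$ (i,j) = 1\<^sub>m ?N $$ (i,j)"
        by (cases i; cases j) (auto simp: mult_entry sum.lessThan_Suc_shift V'e VVe simp del: index_mult_mat(1) sum.lessThan_Suc)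
    qed auto
    ultimately show ?thesis by (auto simp: unitary_mat_def carrier_matI)
  qed
  have BV: "B = V' * ?D * adj V'"
  proof (rule eq_matI)
    fix i j assume "i < dim_row (V' * ?D * adj V')" "j < dim_col (V' * ?D * adj V')"
    hence ij: "i < ?N" "j < ?N" by auto
    have B'e: "B $$ (Suc a, Suc b) = (\<Sum>k<n. V $$ (a,k) * d k * cnj (V $$ (b,k)))" if "a < n" "b < n" for a b
    proof -
      have "B $$ (Suc a, Suc b) = B' $$ (a,b)" using that by (simp add: B'_def)
      thus ?thesis unfolding V(2) using that
        by (simp add: mat_diag_mult_right[of V n n] mult_entry carrier_matI del: index_mult_mat(1))
    qed
    have "(V' * ?D * adj V') $$ (i,j) = (\<Sum>k<?N. V' $$ (i,k) * d' k * cnj (V' $$ (j,k)))"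
      using ij by (simp add: mat_diag_mult_right[of V' ?N ?N] mult_entry carrier_matI del: index_mult_mat(1) sum.lessThan_Suc)
    also have "\<dots> = B $$ (i,j)"
      using ij lr by (cases i; cases j)
        (auto simp: sum.lessThan_Suc_shift V'e d'_def B0 B0' B'e simp del: sum.lessThan_Suc)
    finally show "B $$ (i,j) = (V' * ?D * adj V') $$ (i,j)" ..
  qed auto
  have "A = (H * adj H) * A * (H * adj H)" by (simp add: HH mat_one_left mat_one_right)
  also have "\<dots> = H * B * adj H" by (simp add: B_def mat_assoc)
  also have "\<dots> = (H * V') * ?D * adj (H * V')" by (simp add: BV mat_assoc adj_mult)
  finally show ?case using unitary_mult[OF H(1) uV] by blast
qed

section \<open>Functional calculus\<close>

text \<open>The selection used by \<open>mat_fun\<close>, but with complex values, so that imaginary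
  powers obey the same calculus as real powers and logarithms.\<close>

definition cfun :: "(real \<Rightarrow> complex) \<Rightarrow> complex mat \<Rightarrow> complex mat" where
  "cfun f A = (SOME B. \<exists>U (d :: nat \<Rightarrow> real).
      unitary_mat (dim_row A) U \<and>
      A = U * mat_diag (dim_row A) (\<lambda>i. complex_of_real (d i)) * adj U \<and>
      B = U * mat_diag (dim_row A) (\<lambda>i. f (d i)) * adj U)"

lemma mat_fun_eq_cfun: "mat_fun f A = cfun (\<lambda>x. complex_of_real (f x)) A"
  by (simp add: mat_fun_def cfun_def)

text \<open>\<open>W = adj V * U\<close> intertwines the two diagonal matrices, so its entry at
  \<open>(i,j)\<close> is nonzero only where \<open>d j = e i\<close>. There \<open>f\<close> takes
  equal values as well, so \<open>W\<close> also intertwines the diagonals after \<open>f\<close>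
  has been applied.\<close>

lemma cfun_unique:
  assumes U: "unitary_mat n U" and V: "unitary_mat n V"
    and eq: "U * mat_diag n (\<lambda>i. complex_of_real (d i)) * adj U = V * mat_diag n (\<lambda>i. complex_of_real (e i)) * adj V"
  shows "U * mat_diag n (\<lambda>i. f (d i)) * adj U = V * mat_diag n (\<lambda>i. f (e i)) * adj V"
proof -
  note [simp] = unitary_dims[OF U] unitary_dims[OF V]
  have UU: "U * adj U = 1\<^sub>m n" "adj U * U = 1\<^sub>m n" and VV: "V * adj V = 1\<^sub>m n" "adj V * V = 1\<^sub>m n"
    using U V by (auto simp: unitary_mat_def)
  define W where "W = adj V * U"
  have dW [simp]: "dim_row W = n" "dim_col W = n" by (auto simp: W_def)
  let ?D = "\<lambda>g. mat_diag n g"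
  have "W * ?D (\<lambda>i. of_real (d i)) = adj V * (U * ?D (\<lambda>i. of_real (d i)) * adj U) * U"
    by (simp add: W_def mat_assoc UU mat_one_right)
  also have "\<dots> = (adj V * V) * ?D (\<lambda>i. of_real (e i)) * W" unfolding eq by (simp add: W_def mat_assoc)
  finally have 1: "W * ?D (\<lambda>i. of_real (d i)) = ?D (\<lambda>i. of_real (e i)) * W" by (simp add: VV mat_one_left)
  have "W * ?D (\<lambda>i. f (d i)) = ?D (\<lambda>i. f (e i)) * W"
  proof (rule eq_matI)
    fix i j assume "i < dim_row (?D (\<lambda>i. f (e i)) * W)" "j < dim_col (?D (\<lambda>i. f (e i)) * W)"
    hence ij: "i < n" "j < n" by auto
    have "W $$ (i,j) * of_real (d j) = of_real (e i) * W $$ (i,j)"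
      using arg_cong[OF 1, where f="\<lambda>M. M $$ (i,j)"] ij
      by (simp add: mat_diag_mult_left[of W n n] mat_diag_mult_right[of W n n] carrier_matI)
    hence "W $$ (i,j) = 0 \<or> d j = e i" by (simp add: mult.commute)
    thus "(W * ?D (\<lambda>i. f (d i))) $$ (i,j) = (?D (\<lambda>i. f (e i)) * W) $$ (i,j)"
      using ij by (auto simp: mat_diag_mult_left[of W n n] mat_diag_mult_right[of W n n] carrier_matI)
  qed auto
  hence 2: "adj V * U * ?D (\<lambda>i. f (d i)) = ?D (\<lambda>i. f (e i)) * (adj V * U)" by (simp add: W_def)
  have "U * ?D (\<lambda>i. f (d i)) * adj U = V * (adj V * U * ?D (\<lambda>i. f (d i))) * adj U"
    by (simp add: mat_assoc[symmetric] VV mat_one_left)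
  also have "\<dots> = V * ?D (\<lambda>i. f (e i)) * adj V * (U * adj U)" unfolding 2 by (simp add: mat_assoc)
  finally show ?thesis by (simp add: UU mat_one_right)
qed

lemma cfun_eq:
  assumes "unitary_mat n U"
  shows "cfun f (U * mat_diag n (\<lambda>i. complex_of_real (d i)) * adj U) = U * mat_diag n (\<lambda>i. f (d i)) * adj U"
proof -
  let ?A = "U * mat_diag n (\<lambda>i. complex_of_real (d i)) * adj U"
  let ?P = "\<lambda>B. \<exists>V (e :: nat \<Rightarrow> real). unitary_mat (dim_row ?A) V \<and>
      ?A = V * mat_diag (dim_row ?A) (\<lambda>i. complex_of_real (e i)) * adj V \<and>
      B = V * mat_diag (dim_row ?A) (\<lambda>i. f (e i)) * adj V"
  have dA: "dim_row ?A = n" using unitary_dims[OF assms] by simp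
  have "?P (U * mat_diag n (\<lambda>i. f (d i)) * adj U)" using assms unfolding dA by blast
  hence "?P (SOME B. ?P B)" by (rule someI[of ?P])
  hence "?P (cfun f ?A)" unfolding cfun_def .
  then obtain V e where "unitary_mat n V" "?A = V * mat_diag n (\<lambda>i. complex_of_real (e i)) * adj V"
      "cfun f ?A = V * mat_diag n (\<lambda>i. f (e i)) * adj V" unfolding dA by blast
  thus ?thesis using cfun_unique[OF assms] by metis
qed

text \<open>Quadratic forms are evaluated on functions instead of vectors, which avoids carrier conditions.\<close>

definition qf :: "complex mat \<Rightarrow> (nat \<Rightarrow> complex) \<Rightarrow> complex" where
  "qf A f = (\<Sum>i<dim_row A. \<Sum>j<dim_row A. cnj (f i) * A $$ (i,j) * f j)"

lemma qform_qf: "qform A v = qf A (\<lambda>i. v $ i)"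
  by (simp add: qform_def qf_def)

lemma qf_qform: "qf A f = qform A (vec (dim_row A) f)"
  by (simp add: qform_def qf_def)

section \<open>Positive definite matrices and their functional calculus\<close>

lemma psd_iff: "psd A \<longleftrightarrow> hermitian A \<and> (\<forall>f. Re (qf A f) \<ge> 0)"
  unfolding psd_def qform_qf by (metis (no_types, lifting) qf_qform qform_qf vec_carrier)

lemma pos_def_iff:
  "pos_def A \<longleftrightarrow> hermitian A \<and> (\<forall>f. (\<exists>i<dim_row A. f i \<noteq> 0) \<longrightarrow> Re (qf A f) > 0)"
proof -
  have "(\<forall>v \<in> carrier_vec n. v \<noteq> 0\<^sub>v n \<longrightarrow> P (\<lambda>i. v $ i)) \<longleftrightarrow> (\<forall>f. (\<exists>i<n. f i \<noteq> 0) \<longrightarrow> P f)"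
    if P: "\<And>f g. (\<And>i. i < n \<Longrightarrow> f i = g i) \<Longrightarrow> P f = P g" for n and P :: "(nat \<Rightarrow> complex) \<Rightarrow> bool"
  proof (intro iffI allI ballI impI)
    fix f :: "nat \<Rightarrow> complex" assume *: "\<forall>v \<in> carrier_vec n. v \<noteq> 0\<^sub>v n \<longrightarrow> P (\<lambda>i. v $ i)" "\<exists>i<n. f i \<noteq> 0"
    hence "vec n f \<noteq> 0\<^sub>v n" by (metis index_vec index_zero_vec(1))
    hence "P (\<lambda>i. vec n f $ i)" using * by simp
    thus "P f" using P[of "\<lambda>i. vec n f $ i" f] by simp
  next
    fix v :: "complex vec" assume *: "\<forall>f. (\<exists>i<n. f i \<noteq> 0) \<longrightarrow> P f" "v \<in> carrier_vec n" "v \<noteq> 0\<^sub>v n"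
    hence "\<exists>i<n. v $ i \<noteq> 0" by (metis carrier_vecD eq_vecI index_zero_vec)
    thus "P (\<lambda>i. v $ i)" using * by simp
  qed
  from this[of "dim_row A" "\<lambda>f. Re (qf A f) > 0"] show ?thesis
    unfolding pos_def_def qform_qf by (simp add: qf_def)
qed

lemma pos_def_psd: "pos_def A \<Longrightarrow> psd A"
  unfolding psd_iff pos_def_iff
proof (intro conjI allI, goal_cases)
  case (2 f)
  show ?case
  proof (cases "\<exists>i<dim_row A. f i \<noteq> 0")
    case True thus ?thesis using 2 less_imp_le by blast
  next
    case False thus ?thesis by (simp add: qf_def)
  qed
qed auto

lemma pos_def_dim: "pos_def A \<Longrightarrow> dim_col A = dim_row A"
  by (simp add: pos_def_def hermitian_def)

lemma psd_dim: "psd A \<Longrightarrow> dim_col A = dim_row A"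
  by (simp add: psd_def hermitian_def)

lemma qf_conj:
  assumes "dim_row M = dim_row A" "dim_col A = dim_row A"
  shows "qf (adj M * A * M) f = qf A (\<lambda>i. \<Sum>j<dim_col M. M $$ (i,j) * f j)"
proof -
  let ?n = "dim_row A" and ?m = "dim_col M"
  have "qf (adj M * A * M) f =
    (\<Sum>i<?m. \<Sum>j<?m. \<Sum>l<?n. \<Sum>k<?n. cnj (f i) * cnj (M $$ (k,i)) * A $$ (k,l) * M $$ (l,j) * f j)"
    using assms by (auto simp: qf_def mult_entry sum_distrib_left sum_distrib_right algebra_simps
        simp del: index_mult_mat(1) intro!: sum.cong)
  also have "\<dots> = (\<Sum>i<?m. \<Sum>l<?n. \<Sum>j<?m. \<Sum>k<?n. cnj (f i) * cnj (M $$ (k,i)) * A $$ (k,l) * M $$ (l,j) * f j)"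
    by (intro sum.cong refl sum.swap)
  also have "\<dots> = (\<Sum>i<?m. \<Sum>l<?n. \<Sum>k<?n. \<Sum>j<?m. cnj (f i) * cnj (M $$ (k,i)) * A $$ (k,l) * M $$ (l,j) * f j)"
    by (intro sum.cong refl sum.swap)
  also have "\<dots> = (\<Sum>l<?n. \<Sum>i<?m. \<Sum>k<?n. \<Sum>j<?m. cnj (f i) * cnj (M $$ (k,i)) * A $$ (k,l) * M $$ (l,j) * f j)"
    by (rule sum.swap)
  also have "\<dots> = (\<Sum>l<?n. \<Sum>k<?n. \<Sum>i<?m. \<Sum>j<?m. cnj (f i) * cnj (M $$ (k,i)) * A $$ (k,l) * M $$ (l,j) * f j)"
    by (intro sum.cong refl sum.swap)
  also have "\<dots> = (\<Sum>k<?n. \<Sum>l<?n. \<Sum>i<?m. \<Sum>j<?m. cnj (f i) * cnj (M $$ (k,i)) * A $$ (k,l) * M $$ (l,j) * f j)"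
    by (rule sum.swap)
  also have "\<dots> = qf A (\<lambda>i. \<Sum>j<?m. M $$ (i,j) * f j)"
    by (auto simp: qf_def sum_distrib_left sum_distrib_right algebra_simps intro!: sum.cong)
  finally show ?thesis .
qed

text \<open>The left inverse \<open>M'\<close> makes \<open>M\<close> injective, so a nonzero
  argument of the new form becomes a nonzero argument of the form of \<open>X\<close>.
  \<open>M\<close> may be rectangular.\<close>

lemma pos_def_conj:
  assumes X: "pos_def X" and M: "dim_row M = dim_row X" and inv: "M' * M = 1\<^sub>m (dim_col M)" "dim_col M' = dim_row M"
  shows "pos_def (adj M * X * M)"
  unfolding pos_def_iff
proof (intro conjI allI impI)
  note dX = pos_def_dim[OF X]
  show "hermitian (adj M * X * M)" using hermitian_conj[of X "adj M"] X M by (simp add: pos_def_iff)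
  fix f :: "nat \<Rightarrow> complex" assume "\<exists>i<dim_row (adj M * X * M). f i \<noteq> 0"
  then obtain i where i: "i < dim_col M" "f i \<noteq> 0" by auto
  let ?g = "\<lambda>i. \<Sum>j<dim_col M. M $$ (i,j) * f j"
  have dM': "dim_row M' = dim_col M" using arg_cong[OF inv(1), of dim_row] by simp
  have "\<exists>k<dim_row X. ?g k \<noteq> 0"
  proof (rule ccontr)
    assume "\<not> ?thesis"
    hence z: "?g k = 0" if "k < dim_row M" for k using that M by auto
    have "f i = (\<Sum>j<dim_col M. (M' * M) $$ (i,j) * f j)"
      using i by (simp add: inv if_distrib[of "\<lambda>x. x * _"] cong: if_cong)
    also have "\<dots> = (\<Sum>j<dim_col M. \<Sum>k<dim_row M. M' $$ (i,k) * M $$ (k,j) * f j)"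
      using i inv(2) dM' by (auto simp: mult_entry sum_distrib_right simp del: index_mult_mat(1) intro!: sum.cong)
    also have "\<dots> = (\<Sum>k<dim_row M. M' $$ (i,k) * ?g k)"
      by (subst sum.swap) (simp add: sum_distrib_left mult.assoc)
    also have "\<dots> = 0" using z by simp
    finally show False using i by simp
  qed
  thus "Re (qf (adj M * X * M) f) > 0"
    using qf_conj[OF M dX, of f] X by (simp add: pos_def_iff)
qed

lemma qf_mat_diag: "qf (mat_diag n (\<lambda>i. complex_of_real (d i))) f = of_real (\<Sum>i<n. d i * (cmod (f i))\<^sup>2)"
proof -
  have "qf (mat_diag n (\<lambda>i. complex_of_real (d i))) f =
     (\<Sum>i<n. \<Sum>j<n. if i = j then of_real (d i) * (f i * cnj (f i)) else 0)"
    unfolding qf_def mat_diag_dims by (intro sum.cong refl) (auto simp: mat_diag_def)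
  also have "\<dots> = (\<Sum>i<n. of_real (d i) * (f i * cnj (f i)))" by simp
  also have "\<dots> = of_real (\<Sum>i<n. d i * (cmod (f i))\<^sup>2)"
    unfolding complex_norm_square[symmetric] by simp
  finally show ?thesis .
qed

lemma hermitian_mat_diag: "hermitian (mat_diag n (\<lambda>i. complex_of_real (d i)))"
  by (simp add: hermitian_def adj_mat_diag)

lemma pos_def_mat_diag: "(\<And>i. i < n \<Longrightarrow> d i > 0) \<Longrightarrow> pos_def (mat_diag n (\<lambda>i. complex_of_real (d i)))"
  unfolding pos_def_iff
proof (intro conjI allI impI)
  fix f :: "nat \<Rightarrow> complex"
  assume d: "\<And>i. i < n \<Longrightarrow> d i > 0" and "\<exists>i<dim_row (mat_diag n (\<lambda>i. complex_of_real (d i))). f i \<noteq> 0"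
  then obtain i where "i < n" "f i \<noteq> 0" by auto
  hence "(\<Sum>i<n. d i * (cmod (f i))\<^sup>2) > 0"
  proof (intro sum_pos2[of _ i])
    show "d i * (cmod (f i))\<^sup>2 > 0" using \<open>i < n\<close> \<open>f i \<noteq> 0\<close> d by simp
    show "d j * (cmod (f j))\<^sup>2 \<ge> 0" if "j \<in> {..<n}" for j using that d[of j] by simp
  qed (use \<open>i < n\<close> in auto)
  thus "Re (qf (mat_diag n (\<lambda>i. complex_of_real (d i))) f) > 0" by (simp only: qf_mat_diag Re_complex_of_real)
qed (rule hermitian_mat_diag)

lemma pos_def_one: "pos_def (1\<^sub>m n)"
  using pos_def_mat_diag[of n "\<lambda>_. 1"] by (simp add: mat_diag_one)

lemma pos_def_spectralI:
  assumes U: "unitary_mat n U" and d: "\<And>i. i < n \<Longrightarrow> d i > 0"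
  shows "pos_def (U * mat_diag n (\<lambda>i. complex_of_real (d i)) * adj U)"
proof -
  have D: "pos_def (mat_diag n (\<lambda>i. complex_of_real (d i)))" by (intro pos_def_mat_diag d)
  have "pos_def (adj (adj U) * mat_diag n (\<lambda>i. complex_of_real (d i)) * adj U)"
    by (rule pos_def_conj[where M'=U]) (use U D unitary_dims[OF U] in \<open>simp_all add: unitary_mat_def\<close>)
  thus ?thesis by simp
qed

text \<open>Undoing the conjugation by \<open>U\<close> and testing on coordinate vectors gives
  positive eigenvalues. One decomposition serves all \<open>f\<close> simultaneously, so the rules
  of the calculus reduce to rules for diagonal matrices.\<close>

lemma pos_def_spectral:
  assumes A: "pos_def A" "dim_row A = n"
  obtains U d where "unitary_mat n U" "\<And>i. d i > (0::real)"
    "A = U * mat_diag n (\<lambda>i. complex_of_real (d i)) * adj U"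
    "\<And>f. cfun f A = U * mat_diag n (\<lambda>i. f (d i)) * adj U"
proof -
  obtain U d where U: "unitary_mat n U" and AU: "A = U * mat_diag n (\<lambda>i. complex_of_real (d i)) * adj U"
    using spectral_hermitian A unfolding pos_def_iff by blast
  note [simp] = unitary_dims[OF U]
  have UU: "adj U * U = 1\<^sub>m n" using U by (auto simp: unitary_mat_def)
  have "adj U * A * U = (adj U * U) * mat_diag n (\<lambda>i. complex_of_real (d i)) * (adj U * U)"
    by (simp add: AU mat_assoc)
  hence DU: "adj U * A * U = mat_diag n (\<lambda>i. complex_of_real (d i))" by (simp add: UU mat_one_left mat_one_right)
  have "pos_def (adj U * A * U)" using pos_def_conj[OF A(1), where M=U and M'="adj U"] A UU by simp
  hence pD: "pos_def (mat_diag n (\<lambda>i. complex_of_real (d i)))" unfolding DU .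
  have dpos: "d i > 0" if i: "i < n" for i
  proof -
    have "Re (qf (mat_diag n (\<lambda>i. complex_of_real (d i))) (\<lambda>j. if j = i then 1 else 0)) > 0"
      by (rule conjunct2[OF pD[unfolded pos_def_iff], rule_format]) (use i in \<open>auto intro!: exI[of _ i]\<close>)
    moreover have "(\<Sum>k<n. d k * (cmod (if k = i then 1 else 0))\<^sup>2) = (\<Sum>k<n. if k = i then d k else 0)"
      by (intro sum.cong) auto
    ultimately show ?thesis unfolding qf_mat_diag Re_complex_of_real using i by (simp only: sum.delta finite_lessThan lessThan_iff if_True)
  qed
  \<comment> \<open>Indices beyond the dimension get the eigenvalue 1, so that positivity holds
    without a range condition.\<close>
  define e where "e i = (if i < n then d i else 1)" for i
  have "mat_diag n (\<lambda>i. complex_of_real (d i)) = mat_diag n (\<lambda>i. complex_of_real (e i))"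
    by (rule eq_matI) (auto simp: mat_diag_def e_def)
  hence AU': "A = U * mat_diag n (\<lambda>i. complex_of_real (e i)) * adj U" using AU by simp
  show ?thesis
  proof (rule that[OF U _ AU'])
    show "e i > 0" for i using dpos by (auto simp: e_def)
    show "cfun f A = U * mat_diag n (\<lambda>i. f (e i)) * adj U" for f unfolding AU' by (rule cfun_eq[OF U])
  qed
qed

lemma cfun_dim [simp]:
  assumes "pos_def A"
  shows "dim_row (cfun f A) = dim_row A" "dim_col (cfun f A) = dim_row A"
proof -
  obtain U d where U: "unitary_mat (dim_row A) U" "cfun f A = U * mat_diag (dim_row A) (\<lambda>i. f (d i)) * adj U"
    using pos_def_spectral[OF assms refl] by metis
  show "dim_row (cfun f A) = dim_row A" "dim_col (cfun f A) = dim_row A"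
    using unitary_dims[OF U(1)] U by auto
qed

lemma cfun_mult:
  assumes "pos_def A"
  shows "cfun f A * cfun g A = cfun (\<lambda>x. f x * g x) A"
proof -
  obtain U d where U: "unitary_mat (dim_row A) U" "\<And>f. cfun f A = U * mat_diag (dim_row A) (\<lambda>i. f (d i)) * adj U"
    using pos_def_spectral[OF assms refl] by metis
  note [simp] = unitary_dims[OF U(1)]
  have UU: "adj U * U = 1\<^sub>m (dim_row A)" using U by (auto simp: unitary_mat_def)
  have "cfun f A * cfun g A = U * mat_diag (dim_row A) (\<lambda>i. f (d i)) * (adj U * U) * mat_diag (dim_row A) (\<lambda>i. g (d i)) * adj U"
    by (simp add: U(2) mat_assoc)
  also have "\<dots> = U * (mat_diag (dim_row A) (\<lambda>i. f (d i)) * mat_diag (dim_row A) (\<lambda>i. g (d i))) * adj U"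
    by (simp add: UU mat_one_right mat_one_left mat_assoc)
  finally show ?thesis by (simp add: U(2) mat_diag_diag)
qed

lemma adj_cfun:
  assumes "pos_def A"
  shows "adj (cfun f A) = cfun (\<lambda>x. cnj (f x)) A"
proof -
  obtain U d where U: "unitary_mat (dim_row A) U" "\<And>f. cfun f A = U * mat_diag (dim_row A) (\<lambda>i. f (d i)) * adj U"
    using pos_def_spectral[OF assms refl] by metis
  note [simp] = unitary_dims[OF U(1)]
  show ?thesis by (simp add: U(2) adj_mult adj_mat_diag mat_assoc)
qed

lemma cfun_const:
  assumes "pos_def A"
  shows "cfun (\<lambda>_. c) A = c \<cdot>\<^sub>m 1\<^sub>m (dim_row A)"
proof -
  obtain U d where U: "unitary_mat (dim_row A) U" "\<And>f. cfun f A = U * mat_diag (dim_row A) (\<lambda>i. f (d i)) * adj U"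
    using pos_def_spectral[OF assms refl] by metis
  note [simp] = unitary_dims[OF U(1)]
  have UU: "U * adj U = 1\<^sub>m (dim_row A)" using U by (auto simp: unitary_mat_def)
  have "mat_diag (dim_row A) (\<lambda>_. c) = c \<cdot>\<^sub>m 1\<^sub>m (dim_row A)" by (rule eq_matI) (auto simp: mat_diag_def)
  thus ?thesis by (simp add: U(2) mat_smult_left mat_smult_right mat_one_right UU)
qed

lemma cfun_cong:
  assumes "pos_def A" "\<And>x. x > 0 \<Longrightarrow> f x = g x"
  shows "cfun f A = cfun g A"
  by (rule pos_def_spectral[OF assms(1) refl]) (simp add: assms(2))

lemma cfun_id:
  assumes "pos_def A"
  shows "cfun complex_of_real A = A"
  by (rule pos_def_spectral[OF assms(1) refl]) simp

lemma pos_def_cfun: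
  assumes "pos_def A" "\<And>x. x > 0 \<Longrightarrow> f x > 0"
  shows "pos_def (cfun (\<lambda>x. complex_of_real (f x)) A)"
proof (rule pos_def_spectral[OF assms(1) refl])
  fix U :: "complex mat" and d :: "nat \<Rightarrow> real"
  assume "unitary_mat (dim_row A) U" "\<And>i. d i > 0"
    "\<And>f. cfun f A = U * mat_diag (dim_row A) (\<lambda>i. f (d i)) * adj U"
  thus ?thesis using pos_def_spectralI[of "dim_row A" U "\<lambda>i. f (d i)"] assms(2) by simp
qed

lemma cfun_cfun:
  assumes "pos_def A"
  shows "cfun g (cfun (\<lambda>x. complex_of_real (f x)) A) = cfun (\<lambda>x. g (f x)) A"
proof (rule pos_def_spectral[OF assms(1) refl])
  fix U :: "complex mat" and d :: "nat \<Rightarrow> real"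
  assume "unitary_mat (dim_row A) U" "\<And>i. d i > 0"
    "\<And>f. cfun f A = U * mat_diag (dim_row A) (\<lambda>i. f (d i)) * adj U"
  thus ?thesis using cfun_eq[of "dim_row A" U g "\<lambda>i. f (d i)"] by simp
qed

lemma cfun_smult: "pos_def A \<Longrightarrow> cfun (\<lambda>x. c * f x) A = c \<cdot>\<^sub>m cfun f A"
  using cfun_mult[of A "\<lambda>_. c" f] by (simp add: cfun_const mat_smult_left mat_one_left)

text \<open>The coefficients do not depend on \<open>f\<close>. Entries of a complex power are
  therefore finite sums of exponentials in the exponent, which is the source of holomorphy,
  boundedness and derivatives below.\<close>

lemma cfun_entry:
  assumes "pos_def A" "dim_row A = n"
  obtains c d where "\<And>i. d i > (0::real)"
    "\<And>f i j. i < n \<Longrightarrow> j < n \<Longrightarrow> cfun f A $$ (i,j) = (\<Sum>l<n. c i j l * f (d l))"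
proof -
  obtain U d where U: "unitary_mat n U" "\<And>i. d i > 0" "\<And>f. cfun f A = U * mat_diag n (\<lambda>i. f (d i)) * adj U"
    using pos_def_spectral[OF assms] by metis
  note [simp] = unitary_dims[OF U(1)]
  show ?thesis
  proof (rule that[of d "\<lambda>i j l. U $$ (i,l) * cnj (U $$ (j,l))"])
    show "cfun f A $$ (i, j) = (\<Sum>l<n. U $$ (i, l) * cnj (U $$ (j, l)) * f (d l))" if "i < n" "j < n" for f i j
      using that by (simp add: U(3) mat_diag_mult_right[of U n n] mult_entry carrier_matI algebra_simps del: index_mult_mat(1))
  qed (rule U)
qed

text \<open>The complex power \<open>A^z = exp (z ln A)\<close> of a positive definite matrix,
  entire in \<open>z\<close> and unitary for imaginary \<open>z\<close>.\<close>

definition cpw :: "complex mat \<Rightarrow> complex \<Rightarrow> complex mat" where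
  "cpw A z = cfun (\<lambda>x. exp (z * complex_of_real (ln x))) A"

lemma mpow_cpw: "pos_def A \<Longrightarrow> mpow A s = cpw A (complex_of_real s)"
  unfolding mpow_def mat_fun_eq_cfun cpw_def
  by (rule cfun_cong) (auto simp: powr_def exp_of_real[symmetric])

lemma mlog_cfun: "mlog A = cfun (\<lambda>x. complex_of_real (ln x)) A"
  by (simp add: mlog_def mat_fun_eq_cfun)

context
  fixes A :: "complex mat"
  assumes A: "pos_def A"
begin

lemma cpw_dim [simp]: "dim_row (cpw A z) = dim_row A" "dim_col (cpw A z) = dim_row A"
  using A by (simp_all add: cpw_def)

lemma mlog_dim [simp]: "dim_row (mlog A) = dim_row A" "dim_col (mlog A) = dim_row A"
  using A by (simp_all add: mlog_cfun)

lemma cpw_mult: "cpw A a * cpw A b = cpw A (a + b)"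
  using A by (simp add: cpw_def cfun_mult exp_add algebra_simps)

lemma cpw_mult_assoc: "dim_row B = dim_row A \<Longrightarrow> cpw A a * (cpw A b * B) = cpw A (a + b) * B"
  by (simp add: mat_assoc[symmetric] cpw_mult)

lemma cpw_0: "cpw A 0 = 1\<^sub>m (dim_row A)"
  using cfun_const[OF A, of 1] by (auto simp: cpw_def)

lemma cpw_1: "cpw A 1 = A"
  unfolding cpw_def using cfun_cong[OF A, of "\<lambda>x. exp (1 * complex_of_real (ln x))" complex_of_real]
  by (simp add: cfun_id[OF A] exp_of_real)

lemma adj_cpw: "adj (cpw A z) = cpw A (cnj z)"
  unfolding cpw_def adj_cfun[OF A] by (simp add: exp_cnj)

lemma pos_def_cpw: "pos_def (cpw A (complex_of_real r))"
  unfolding cpw_def using pos_def_cfun[OF A, of "\<lambda>x. exp (r * ln x)"] by (simp flip: exp_of_real)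

lemma cpw_cpw: "cpw (cpw A (complex_of_real r)) z = cpw A (complex_of_real r * z)"
proof -
  have "cpw A (complex_of_real r) = cfun (\<lambda>x. complex_of_real (exp (r * ln x))) A"
    unfolding cpw_def by (simp flip: exp_of_real)
  thus ?thesis unfolding cpw_def by (simp add: cfun_cfun[OF A] mult_ac)
qed

lemma cpw_mlog_comm: "cpw A z * mlog A = mlog A * cpw A z"
  unfolding cpw_def mlog_cfun using A by (simp add: cfun_mult mult.commute)

end

section \<open>Kronecker products, partial traces and reindexing\<close>

lemma idx_less: "a < n \<Longrightarrow> b < m \<Longrightarrow> a * m + b < n * (m::nat)"
proof -
  assume "a < n" "b < m"
  hence "a * m + b < Suc a * m" by simp
  moreover have "Suc a * m \<le> n * m" using \<open>a < n\<close> by (intro mult_le_mono1) simp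
  ultimately show ?thesis by linarith
qed

lemma div_less_idx: "i < n * m \<Longrightarrow> i div m < (n::nat)"
  by (rule less_mult_imp_div_less)

lemma mod_less_idx: "i < n * m \<Longrightarrow> i mod m < (m::nat)"
  by (cases "m = 0") auto

lemma idx_div [simp]: "b < m \<Longrightarrow> (a * m + b) div m = (a::nat)"
  and idx_mod [simp]: "b < m \<Longrightarrow> (a * m + b) mod m = (b::nat)"
  by simp_all

lemma sum_idx:
  fixes f :: "nat \<Rightarrow> 'a::comm_monoid_add"
  shows "(\<Sum>i<n*m. f i) = (\<Sum>a<n. \<Sum>b<m. f (a * m + b))"
proof -
  have "(\<Sum>b<m. f (a * m + b)) = sum f {a * m..<a * m + m}" for a
    by (rule sum.reindex_bij_witness[of _ "\<lambda>i. i - a * m" "\<lambda>b. a * m + b"]) auto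
  thus ?thesis by (simp add: sum.nat_group)
qed

lemma all_idx: "(\<forall>i<n*m. P i) \<longleftrightarrow> (\<forall>a<n. \<forall>b<(m::nat). P (a * m + b))"
  by (metis div_less_idx div_mult_mod_eq idx_less mod_less_idx)

lemma kron_dim [simp]: "dim_row (kron A B) = dim_row A * dim_row B" "dim_col (kron A B) = dim_col A * dim_col B"
  by (auto simp: kron_def)

lemma kron_entry:
  "i < dim_row A * dim_row B \<Longrightarrow> j < dim_col A * dim_col B \<Longrightarrow>
    kron A B $$ (i,j) = A $$ (i div dim_row B, j div dim_col B) * B $$ (i mod dim_row B, j mod dim_col B)"
  by (auto simp: kron_def)

lemma kron_mult:
  assumes "dim_col A = dim_row C" "dim_col B = dim_row D"
  shows "kron A B * kron C D = kron (A * C) (B * D)"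
proof (rule eq_matI)
  fix i j assume "i < dim_row (kron (A * C) (B * D))" "j < dim_col (kron (A * C) (B * D))"
  hence ij: "i < dim_row A * dim_row B" "j < dim_col C * dim_col D" by auto
  let ?a = "i div dim_row B" and ?b = "i mod dim_row B" and ?c = "j div dim_col D" and ?d = "j mod dim_col D"
  note l = div_less_idx[OF ij(1)] mod_less_idx[OF ij(1)] div_less_idx[OF ij(2)] mod_less_idx[OF ij(2)]
  have "(kron A B * kron C D) $$ (i,j) = (\<Sum>k<dim_row C * dim_row D. kron A B $$ (i,k) * kron C D $$ (k,j))"
    using ij assms by (subst mult_entry) auto
  also have "\<dots> = (\<Sum>k<dim_row C. \<Sum>l<dim_row D. A $$ (?a,k) * B $$ (?b,l) * (C $$ (k,?c) * D $$ (l,?d)))"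
    unfolding sum_idx using ij assms by (intro sum.cong refl) (auto simp: kron_entry idx_less)
  also have "\<dots> = (A * C) $$ (?a,?c) * (B * D) $$ (?b,?d)"
    using l assms by (simp add: mult_entry sum_product algebra_simps del: index_mult_mat(1))
  also have "\<dots> = kron (A * C) (B * D) $$ (i,j)" using ij by (simp add: kron_entry del: index_mult_mat(1))
  finally show "(kron A B * kron C D) $$ (i,j) = kron (A * C) (B * D) $$ (i,j)" .
qed auto

lemma adj_kron: "adj (kron A B) = kron (adj A) (adj B)"
  by (rule eq_matI) (auto simp: kron_entry div_less_idx mod_less_idx)

lemma kron_one: "kron (1\<^sub>m n) (1\<^sub>m m) = 1\<^sub>m (n * m)"
proof (rule eq_matI)
  fix i j assume "i < dim_row (1\<^sub>m (n*m) :: complex mat)" "j < dim_col (1\<^sub>m (n*m) :: complex mat)"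
  hence ij: "i < n * m" "j < n * m" by auto
  have "i = j \<longleftrightarrow> i div m = j div m \<and> i mod m = j mod m" by (metis div_mult_mod_eq)
  thus "kron (1\<^sub>m n) (1\<^sub>m m) $$ (i,j) = 1\<^sub>m (n*m) $$ (i,j)"
    using ij by (auto simp: kron_entry div_less_idx mod_less_idx)
qed auto

lemma kron_mat_diag: "kron (mat_diag n f) (mat_diag m g) = mat_diag (n * m) (\<lambda>i. f (i div m) * g (i mod m))"
proof (rule eq_matI)
  fix i j assume "i < dim_row (mat_diag (n * m) (\<lambda>i. f (i div m) * g (i mod m)))"
    "j < dim_col (mat_diag (n * m) (\<lambda>i. f (i div m) * g (i mod m)))"
  hence ij: "i < n * m" "j < n * m" by auto
  have "i = j \<longleftrightarrow> i div m = j div m \<and> i mod m = j mod m" by (metis div_mult_mod_eq)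
  thus "kron (mat_diag n f) (mat_diag m g) $$ (i,j) = mat_diag (n * m) (\<lambda>i. f (i div m) * g (i mod m)) $$ (i,j)"
    using ij by (auto simp: kron_entry div_less_idx mod_less_idx mat_diag_def)
qed auto

lemma kron_smult_left: "kron (c \<cdot>\<^sub>m A) B = c \<cdot>\<^sub>m kron A B"
  by (rule eq_matI) (auto simp: kron_entry div_less_idx mod_less_idx)

lemma kron_assoc: "kron (kron A B) C = kron A (kron B C)"
proof (rule eq_matI)
  fix i j assume "i < dim_row (kron A (kron B C))" "j < dim_col (kron A (kron B C))"
  hence ij: "i < dim_row A * (dim_row B * dim_row C)" "j < dim_col A * (dim_col B * dim_col C)" by auto
  hence ij': "i < dim_row A * dim_row B * dim_row C" "j < dim_col A * dim_col B * dim_col C" by (auto simp: mult.assoc)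
  have e: "x mod (b * c) div c = x div c mod b" "x mod (b * c) mod c = x mod c" "x div (b * c) = x div c div b" for x b c :: nat
  proof -
    show "x mod (b * c) div c = x div c mod b"
      using mod_mult2_eq[of x c b] by (cases "c = 0") (auto simp: mult.commute)
    show "x mod (b * c) mod c = x mod c" by (rule mod_mod_cancel) simp
    show "x div (b * c) = x div c div b" by (simp add: div_mult2_eq mult.commute[of b c])
  qed
  have l: "i mod (dim_row B * dim_row C) < dim_row B * dim_row C" "j mod (dim_col B * dim_col C) < dim_col B * dim_col C"
    using mod_less_idx[OF ij(1)] mod_less_idx[OF ij(2)] by auto
  have "kron A (kron B C) $$ (i,j) = A $$ (i div (dim_row B * dim_row C), j div (dim_col B * dim_col C)) *
     (B $$ (i div dim_row C mod dim_row B, j div dim_col C mod dim_col B) * C $$ (i mod dim_row C, j mod dim_col C))"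
    using ij l by (simp add: kron_entry e(1,2))
  moreover have "kron (kron A B) C $$ (i,j) = A $$ (i div dim_row C div dim_row B, j div dim_col C div dim_col B) *
     B $$ (i div dim_row C mod dim_row B, j div dim_col C mod dim_col B) * C $$ (i mod dim_row C, j mod dim_col C)"
    using ij' by (simp add: kron_entry div_less_idx)
  ultimately show "kron (kron A B) C $$ (i,j) = kron A (kron B C) $$ (i,j)"
    by (simp add: e(3))
qed (auto simp: mult.assoc)

lemma mtrace_kron: "dim_row A = dim_col A \<Longrightarrow> dim_row B = dim_col B \<Longrightarrow> mtrace (kron A B) = mtrace A * mtrace B"
  by (auto simp: mtrace_def sum_idx sum_product kron_entry idx_less intro!: sum.cong)

lemma unitary_kron:
  assumes "unitary_mat n U" "unitary_mat m V"
  shows "unitary_mat (n * m) (kron U V)"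
proof -
  note d = unitary_dims[OF assms(1)] unitary_dims[OF assms(2)]
  have e: "U * adj U = 1\<^sub>m n" "adj U * U = 1\<^sub>m n" "V * adj V = 1\<^sub>m m" "adj V * V = 1\<^sub>m m"
    using assms by (simp_all add: unitary_mat_def)
  have "kron U V \<in> carrier_mat (n * m) (n * m)" by (rule carrier_matI) (simp_all add: d)
  thus ?thesis by (simp add: unitary_mat_def adj_kron kron_mult kron_one d e)
qed

text \<open>The tensor product of two eigenbases diagonalises the Kronecker product, with products
  of eigenvalues on the diagonal. From this, powers of a Kronecker product factor and its logarithm
  splits into a sum.\<close>

lemma pos_def_kron_spectral:
  assumes "pos_def A" "pos_def B"
  obtains U V d e where
    "unitary_mat (dim_row A) U" "\<And>i. d i > (0::real)" "\<And>f. cfun f A = U * mat_diag (dim_row A) (\<lambda>i. f (d i)) * adj U"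
    "unitary_mat (dim_row B) V" "\<And>i. e i > (0::real)" "\<And>f. cfun f B = V * mat_diag (dim_row B) (\<lambda>i. f (e i)) * adj V"
    "pos_def (kron A B)"
    "\<And>f. cfun f (kron A B) = kron U V * mat_diag (dim_row A * dim_row B)
       (\<lambda>i. f (d (i div dim_row B) * e (i mod dim_row B))) * adj (kron U V)"
proof -
  obtain U d where U: "unitary_mat (dim_row A) U" "\<And>i. d i > 0"
    "A = U * mat_diag (dim_row A) (\<lambda>i. complex_of_real (d i)) * adj U"
    "\<And>f. cfun f A = U * mat_diag (dim_row A) (\<lambda>i. f (d i)) * adj U"
    by (rule pos_def_spectral[OF assms(1) refl]) blast
  obtain V e where V: "unitary_mat (dim_row B) V" "\<And>i. e i > 0"
    "B = V * mat_diag (dim_row B) (\<lambda>i. complex_of_real (e i)) * adj V"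
    "\<And>f. cfun f B = V * mat_diag (dim_row B) (\<lambda>i. f (e i)) * adj V"
    by (rule pos_def_spectral[OF assms(2) refl]) blast
  note d [simp] = unitary_dims[OF U(1)] unitary_dims[OF V(1)]
  let ?n = "dim_row A" and ?m = "dim_row B"
  have W: "unitary_mat (?n * ?m) (kron U V)" using unitary_kron U V by blast
  let ?e = "\<lambda>i. d (i div ?m) * e (i mod ?m)"
  have "kron A B = kron (U * mat_diag ?n (\<lambda>i. complex_of_real (d i)) * adj U) (V * mat_diag ?m (\<lambda>i. complex_of_real (e i)) * adj V)"
    by (rule arg_cong2[of A _ B _ kron, OF U(3) V(3)])
  also have "\<dots> = kron U V * mat_diag (?n * ?m) (\<lambda>i. complex_of_real (?e i)) * adj (kron U V)"
    unfolding of_real_mult kron_mat_diag[of ?n "\<lambda>i. complex_of_real (d i)" ?m "\<lambda>i. complex_of_real (e i)", symmetric]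
    by (simp add: kron_mult adj_kron)
  finally have K: "kron A B = kron U V * mat_diag (?n * ?m) (\<lambda>i. complex_of_real (?e i)) * adj (kron U V)" .
  show ?thesis
  proof (rule that[OF U(1,2,4) V(1,2,4)])
    show "pos_def (kron A B)" unfolding K by (rule pos_def_spectralI[OF W, of ?e]) (simp add: U(2) V(2))
    show "cfun f (kron A B) = kron U V * mat_diag (?n * ?m) (\<lambda>i. f (?e i)) * adj (kron U V)" for f
      unfolding K by (rule cfun_eq[OF W, of f ?e])
  qed
qed

lemma pos_def_kron: assumes "pos_def A" "pos_def B" shows "pos_def (kron A B)"
  by (rule pos_def_kron_spectral[OF assms])

lemma cpw_kron:
  assumes "pos_def A" "pos_def B"
  shows "cpw (kron A B) z = kron (cpw A z) (cpw B z)"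
proof (rule pos_def_kron_spectral[OF assms], goal_cases)
  case (1 U V d e)
  note [simp] = unitary_dims[OF 1(1)] unitary_dims[OF 1(4)]
  have nz: "d i \<noteq> 0" "e i \<noteq> 0" for i using 1(2)[of i] 1(5)[of i] by auto
  have K: "mat_diag (dim_row A * dim_row B) (\<lambda>i. exp (z * complex_of_real (ln (d (i div dim_row B) * e (i mod dim_row B)))))
     = kron (mat_diag (dim_row A) (\<lambda>i. exp (z * complex_of_real (ln (d i))))) (mat_diag (dim_row B) (\<lambda>i. exp (z * complex_of_real (ln (e i)))))"
    unfolding kron_mat_diag by (simp add: ln_mult nz 1(2) 1(5) ring_distribs exp_add)
  show ?case unfolding cpw_def 1(3) 1(6) 1(8) K
    by (simp add: kron_mult adj_kron)
qed

lemma cpw_scalar: "c > 0 \<Longrightarrow> cpw (complex_of_real c \<cdot>\<^sub>m 1\<^sub>m n) z = exp (z * complex_of_real (ln c)) \<cdot>\<^sub>m 1\<^sub>m n"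
  and mlog_scalar: "c > 0 \<Longrightarrow> mlog (complex_of_real c \<cdot>\<^sub>m 1\<^sub>m n) = complex_of_real (ln c) \<cdot>\<^sub>m 1\<^sub>m n"
  and pos_def_scalar: "c > 0 \<Longrightarrow> pos_def (complex_of_real c \<cdot>\<^sub>m 1\<^sub>m n)"
proof -
  have u: "unitary_mat n (1\<^sub>m n)" by (auto simp: unitary_mat_def)
  have d: "mat_diag n (\<lambda>_. a) = a \<cdot>\<^sub>m 1\<^sub>m n" for a :: complex by (rule eq_matI) (auto simp: mat_diag_def)
  have e: "1\<^sub>m n * mat_diag n (\<lambda>_. a) * adj (1\<^sub>m n) = a \<cdot>\<^sub>m 1\<^sub>m n" for a :: complex
    by (simp add: mat_one_left mat_one_right d)
  have f: "cfun f (complex_of_real c \<cdot>\<^sub>m 1\<^sub>m n) = f c \<cdot>\<^sub>m 1\<^sub>m n" for f c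
    using cfun_eq[OF u, of f "\<lambda>_. c"] unfolding e .
  show "cpw (complex_of_real c \<cdot>\<^sub>m 1\<^sub>m n) z = exp (z * complex_of_real (ln c)) \<cdot>\<^sub>m 1\<^sub>m n" by (simp add: cpw_def f)
  show "mlog (complex_of_real c \<cdot>\<^sub>m 1\<^sub>m n) = complex_of_real (ln c) \<cdot>\<^sub>m 1\<^sub>m n" by (simp add: mlog_cfun f)
  show "c > 0 \<Longrightarrow> pos_def (complex_of_real c \<cdot>\<^sub>m 1\<^sub>m n)"
    using pos_def_mat_diag[of n "\<lambda>_. c"] by (simp add: d)
qed

lemma cpw_one: "cpw (1\<^sub>m n) z = 1\<^sub>m n"
proof -
  have "complex_of_real 1 \<cdot>\<^sub>m 1\<^sub>m n = 1\<^sub>m n" by (rule eq_matI) auto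
  thus ?thesis using cpw_scalar[of 1 n z] by simp
qed

lemma mlog_kron:
  assumes "pos_def A" "pos_def B"
  shows "mlog (kron A B) = kron (mlog A) (1\<^sub>m (dim_row B)) + kron (1\<^sub>m (dim_row A)) (mlog B)"
proof (rule pos_def_kron_spectral[OF assms], goal_cases)
  case (1 U V d e)
  note [simp] = unitary_dims[OF 1(1)] unitary_dims[OF 1(4)]
  have nz: "d i \<noteq> 0" "e i \<noteq> 0" for i using 1(2)[of i] 1(5)[of i] by auto
  let ?n = "dim_row A" and ?m = "dim_row B"
  have u: "1\<^sub>m ?n = U * mat_diag ?n (\<lambda>_. 1) * adj U" "1\<^sub>m ?m = V * mat_diag ?m (\<lambda>_. 1) * adj V"
    using 1(1,4) by (auto simp: unitary_mat_def mat_diag_one mat_one_right)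
  have "kron (mlog A) (1\<^sub>m ?m) = kron U V * kron (mat_diag ?n (\<lambda>i. complex_of_real (ln (d i)))) (mat_diag ?m (\<lambda>_. 1)) * adj (kron U V)"
    unfolding mlog_cfun 1(3) u by (simp add: kron_mult adj_kron)
  moreover have "kron (1\<^sub>m ?n) (mlog B) = kron U V * kron (mat_diag ?n (\<lambda>_. 1)) (mat_diag ?m (\<lambda>i. complex_of_real (ln (e i)))) * adj (kron U V)"
    unfolding mlog_cfun 1(6) u by (simp add: kron_mult adj_kron)
  moreover have "mat_diag (?n * ?m) (\<lambda>i. complex_of_real (ln (d (i div ?m) * e (i mod ?m)))) =
     kron (mat_diag ?n (\<lambda>i. complex_of_real (ln (d i)))) (mat_diag ?m (\<lambda>_. 1)) +
     kron (mat_diag ?n (\<lambda>_. 1)) (mat_diag ?m (\<lambda>i. complex_of_real (ln (e i))))"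
    unfolding kron_mat_diag by (rule eq_matI) (auto simp: mat_diag_def ln_mult nz 1(2) 1(5))
  ultimately show ?case
    unfolding mlog_cfun[of "kron A B"] 1(8) by (simp add: mat_distrib_left mat_distrib_right)
qed

section \<open>Partial traces over the last tensor factor\<close>

definition ptrace :: "nat \<Rightarrow> nat \<Rightarrow> complex mat \<Rightarrow> complex mat" where
  "ptrace k m W = mat k k (\<lambda>(a,b). \<Sum>r<m. W $$ (a * m + r, b * m + r))"

lemma ptrace_dim [simp]: "dim_row (ptrace k m W) = k" "dim_col (ptrace k m W) = k"
  by (auto simp: ptrace_def)

lemma kron_one_mult_entry:
  assumes "dim_row X = k * m" "dim_row B = k" "dim_col B = k" "i < k * m" "j < dim_col X"
  shows "(kron B (1\<^sub>m m) * X) $$ (i,j) = (\<Sum>a<k. B $$ (i div m, a) * X $$ (a * m + i mod m, j))"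
proof -
  have "(kron B (1\<^sub>m m) * X) $$ (i,j) = (\<Sum>a<k. \<Sum>b<m. kron B (1\<^sub>m m) $$ (i, a * m + b) * X $$ (a * m + b, j))"
    using assms by (subst mult_entry) (auto simp: sum_idx)
  also have "\<dots> = (\<Sum>a<k. \<Sum>b<m. if b = i mod m then B $$ (i div m, a) * X $$ (a * m + b, j) else 0)"
    using assms mod_less_idx[OF assms(4)] by (intro sum.cong refl) (auto simp: kron_entry idx_less)
  finally show ?thesis using mod_less_idx[OF assms(4)] by simp
qed

lemma mult_kron_one_entry:
  assumes "dim_col X = k * m" "dim_row B = k" "dim_col B = k" "j < k * m" "i < dim_row X"
  shows "(X * kron B (1\<^sub>m m)) $$ (i,j) = (\<Sum>a<k. X $$ (i, a * m + j mod m) * B $$ (a, j div m))"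
proof -
  have "(X * kron B (1\<^sub>m m)) $$ (i,j) = (\<Sum>a<k. \<Sum>b<m. X $$ (i, a * m + b) * kron B (1\<^sub>m m) $$ (a * m + b, j))"
    using assms by (subst mult_entry) (auto simp: sum_idx)
  also have "\<dots> = (\<Sum>a<k. \<Sum>b<m. if b = j mod m then X $$ (i, a * m + b) * B $$ (a, j div m) else 0)"
    using assms mod_less_idx[OF assms(4)] by (intro sum.cong refl) (auto simp: kron_entry idx_less)
  finally show ?thesis using mod_less_idx[OF assms(4)] by simp
qed

lemma ptrace_mult_left:
  assumes "dim_row W = k * m" "dim_col W = k * m" "dim_row B = k" "dim_col B = k"
  shows "ptrace k m (kron B (1\<^sub>m m) * W) = B * ptrace k m W"
proof (rule eq_matI)
  fix a b assume "a < dim_row (B * ptrace k m W)" "b < dim_col (B * ptrace k m W)"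
  hence ab: "a < k" "b < k" using assms by auto
  have "ptrace k m (kron B (1\<^sub>m m) * W) $$ (a,b) = (\<Sum>r<m. \<Sum>c<k. B $$ (a,c) * W $$ (c * m + r, b * m + r))"
    using ab assms by (auto simp: ptrace_def kron_one_mult_entry idx_less intro!: sum.cong simp del: index_mult_mat(1))
  also have "\<dots> = (B * ptrace k m W) $$ (a,b)"
    using ab assms by (subst sum.swap) (auto simp: mult_entry ptrace_def sum_distrib_left intro!: sum.cong simp del: index_mult_mat(1))
  finally show "ptrace k m (kron B (1\<^sub>m m) * W) $$ (a,b) = (B * ptrace k m W) $$ (a,b)" .
qed (use assms in auto)

lemma ptrace_mult_right:
  assumes "dim_row W = k * m" "dim_col W = k * m" "dim_row B = k" "dim_col B = k"
  shows "ptrace k m (W * kron B (1\<^sub>m m)) = ptrace k m W * B"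
proof (rule eq_matI)
  fix a b assume "a < dim_row (ptrace k m W * B)" "b < dim_col (ptrace k m W * B)"
  hence ab: "a < k" "b < k" using assms by auto
  have "ptrace k m (W * kron B (1\<^sub>m m)) $$ (a,b) = (\<Sum>r<m. \<Sum>c<k. W $$ (a * m + r, c * m + r) * B $$ (c,b))"
    using ab assms by (auto simp: ptrace_def mult_kron_one_entry idx_less intro!: sum.cong simp del: index_mult_mat(1))
  also have "\<dots> = (ptrace k m W * B) $$ (a,b)"
    using ab assms by (subst sum.swap) (auto simp: mult_entry ptrace_def sum_distrib_right intro!: sum.cong simp del: index_mult_mat(1))
  finally show "ptrace k m (W * kron B (1\<^sub>m m)) $$ (a,b) = (ptrace k m W * B) $$ (a,b)" .
qed (use assms in auto)

lemma mtrace_ptrace: "dim_row W = k * m \<Longrightarrow> mtrace (ptrace k m W) = mtrace W"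
  by (auto simp: mtrace_def ptrace_def sum_idx)

lemma mtrace_kron_one_mult:
  assumes "dim_row W = k * m" "dim_col W = k * m" "dim_row B = k" "dim_col B = k"
  shows "mtrace (kron B (1\<^sub>m m) * W) = mtrace (B * ptrace k m W)"
  using mtrace_ptrace[of "kron B (1\<^sub>m m) * W" k m] ptrace_mult_left[OF assms] assms by simp

lemma ptrace_ptrace: "ptrace k m1 (ptrace (k * m1) m2 W) = ptrace k (m1 * m2) W"
proof (rule eq_matI)
  fix a b assume "a < dim_row (ptrace k (m1 * m2) W)" "b < dim_col (ptrace k (m1 * m2) W)"
  hence ab: "a < k" "b < k" by auto
  have e: "(c * m1 + x) * m2 + y = c * (m1 * m2) + (x * m2 + y)" for c x y :: nat by (simp add: ring_distribs)
  show "ptrace k m1 (ptrace (k * m1) m2 W) $$ (a,b) = ptrace k (m1 * m2) W $$ (a,b)"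
    using ab by (simp add: ptrace_def sum_idx idx_less e cong: sum.cong_simp)
qed auto

text \<open>The form of the partial trace at \<open>f\<close> is the sum over \<open>r < m\<close>
  of the form of \<open>W\<close> at \<open>f \<otimes> e_r\<close>. Since \<open>m \<ge> 1\<close>,
  the term \<open>r = 0\<close> is present and strictly positive.\<close>

lemma pos_def_ptrace:
  assumes W: "pos_def W" "dim_row W = k * m" and m: "m \<ge> 1"
  shows "pos_def (ptrace k m W)"
  unfolding pos_def_iff
proof (intro conjI allI impI)
  note d = pos_def_dim[OF W(1)]
  have hW: "hermitian W" using W by (simp add: pos_def_iff)
  show "hermitian (ptrace k m W)"
    unfolding hermitian_def
    by (auto intro!: eq_matI sum.cong hermitian_entry[OF hW, symmetric] simp: ptrace_def idx_less W)
  fix f :: "nat \<Rightarrow> complex" assume "\<exists>i<dim_row (ptrace k m W). f i \<noteq> 0"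
  then obtain i where i: "i < k" "f i \<noteq> 0" by auto
  \<comment> \<open>The coordinates of \<open>f \<otimes> e_r\<close>.\<close>
  define g where "g r i = (if i mod m = r then f (i div m) else 0)" for r i
  have "qf (ptrace k m W) f = (\<Sum>a<k. \<Sum>b<k. \<Sum>r<m. cnj (f a) * W $$ (a * m + r, b * m + r) * f b)"
    by (auto simp: qf_def ptrace_def sum_distrib_left sum_distrib_right intro!: sum.cong)
  also have "\<dots> = (\<Sum>a<k. \<Sum>r<m. \<Sum>b<k. cnj (f a) * W $$ (a * m + r, b * m + r) * f b)"
    by (intro sum.cong refl sum.swap)
  also have "\<dots> = (\<Sum>r<m. \<Sum>a<k. \<Sum>b<k. cnj (f a) * W $$ (a * m + r, b * m + r) * f b)"
    by (rule sum.swap)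
  also have "\<dots> = (\<Sum>r<m. qf W (g r))"
  proof (rule sum.cong[OF refl])
    fix r assume r: "r \<in> {..<m}"
    hence r: "r < m" by simp
    have g: "g r (b * m + q) = (if q = r then f b else 0)" if "q < m" for b q using that by (simp add: g_def)
    have S1: "(\<Sum>j<k*m. u j * g r j) = (\<Sum>b<k. u (b * m + r) * f b)" for u
    proof -
      have "(\<Sum>j<k*m. u j * g r j) = (\<Sum>b<k. \<Sum>q<m. if q = r then u (b * m + q) * f b else 0)"
        unfolding sum_idx by (intro sum.cong refl) (simp add: g)
      thus ?thesis using r by simp
    qed
    have S2: "(\<Sum>j<k*m. cnj (g r j) * u j) = (\<Sum>b<k. cnj (f b) * u (b * m + r))" for u
    proof -
      have "(\<Sum>j<k*m. cnj (g r j) * u j) = (\<Sum>b<k. \<Sum>q<m. if q = r then cnj (f b) * u (b * m + q) else 0)"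
        unfolding sum_idx by (intro sum.cong refl) (simp add: g)
      thus ?thesis using r by simp
    qed
    have "qf W (g r) = (\<Sum>i<k*m. \<Sum>b<k. cnj (g r i) * W $$ (i, b * m + r) * f b)"
      unfolding qf_def W by (intro sum.cong refl S1)
    also have "\<dots> = (\<Sum>i<k*m. cnj (g r i) * (\<Sum>b<k. W $$ (i, b * m + r) * f b))"
      by (simp add: sum_distrib_left mult.assoc)
    also have "\<dots> = (\<Sum>a<k. cnj (f a) * (\<Sum>b<k. W $$ (a * m + r, b * m + r) * f b))"
      by (rule S2)
    finally show "(\<Sum>a<k. \<Sum>b<k. cnj (f a) * W $$ (a * m + r, b * m + r) * f b) = qf W (g r)"
      by (simp add: sum_distrib_left mult.assoc)
  qed
  finally have e: "Re (qf (ptrace k m W) f) = (\<Sum>r<m. Re (qf W (g r)))" by simp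
  have "0 < Re (qf W (g 0))"
  proof -
    have "\<exists>j<dim_row W. g 0 j \<noteq> 0"
      using i m idx_less[OF i(1), of 0 m] by (intro exI[of _ "i * m"]) (auto simp: g_def W)
    thus ?thesis using W(1) unfolding pos_def_iff by blast
  qed
  moreover have "Re (qf W (g r)) \<ge> 0" for r using pos_def_psd[OF W(1)] by (simp add: psd_iff)
  ultimately show "Re (qf (ptrace k m W) f) > 0" unfolding e
    using m by (intro sum_pos2[of _ 0]) auto
qed

text \<open>For a permutation \<open>p\<close> of the indices this is conjugation by a permutation
  matrix, hence a trace-preserving *-isomorphism that commutes with the functional calculus.\<close>

definition reindex :: "(nat \<Rightarrow> nat) \<Rightarrow> complex mat \<Rightarrow> complex mat" where
  "reindex p X = mat (dim_row X) (dim_col X) (\<lambda>(i,j). X $$ (p i, p j))"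

lemma reindex_dim [simp]: "dim_row (reindex p X) = dim_row X" "dim_col (reindex p X) = dim_col X"
  by (auto simp: reindex_def)

lemma reindex_entry: "i < dim_row X \<Longrightarrow> j < dim_col X \<Longrightarrow> reindex p X $$ (i,j) = X $$ (p i, p j)"
  by (auto simp: reindex_def)

context
  fixes n :: nat and p :: "nat \<Rightarrow> nat"
  assumes p: "bij_betw p {..<n} {..<n}"
begin

lemma reindex_lt: "i < n \<Longrightarrow> p i < n" using bij_betwE[OF p] by blast

lemma reindex_sum: "(\<Sum>i<n. f (p i)) = (\<Sum>i<n. f i)"
  by (rule sum.reindex_bij_betw[OF p])

lemma reindex_mult:
  assumes "dim_row A = n" "dim_col A = n" "dim_row B = n" "dim_col B = n"
  shows "reindex p (A * B) = reindex p A * reindex p B"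
proof (rule eq_matI)
  fix i j assume "i < dim_row (reindex p A * reindex p B)" "j < dim_col (reindex p A * reindex p B)"
  hence ij: "i < n" "j < n" using assms by auto
  have "(reindex p A * reindex p B) $$ (i,j) = (\<Sum>k<n. A $$ (p i, p k) * B $$ (p k, p j))"
    using ij assms by (simp add: mult_entry reindex_entry del: index_mult_mat(1))
  also have "\<dots> = (\<Sum>k<n. A $$ (p i, k) * B $$ (k, p j))" by (rule reindex_sum)
  finally show "reindex p (A * B) $$ (i,j) = (reindex p A * reindex p B) $$ (i,j)"
    using ij assms reindex_lt by (simp add: mult_entry reindex_entry del: index_mult_mat(1))
qed (use assms in auto)

lemma reindex_adj: "dim_row A = n \<Longrightarrow> dim_col A = n \<Longrightarrow> reindex p (adj A) = adj (reindex p A)"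
  by (intro eq_matI) (auto simp: reindex_entry reindex_lt)

lemma reindex_mat_diag: "reindex p (mat_diag n f) = mat_diag n (\<lambda>i. f (p i))"
  by (intro eq_matI) (simp_all add: reindex_entry mat_diag_def reindex_lt inj_on_eq_iff[OF bij_betw_imp_inj_on[OF p]])

lemma reindex_mtrace: "dim_row A = n \<Longrightarrow> dim_col A = n \<Longrightarrow> mtrace (reindex p A) = mtrace A"
  using reindex_sum[of "\<lambda>i. A $$ (i,i)"] by (simp add: mtrace_def reindex_entry)

lemma reindex_hermitian: "hermitian A \<Longrightarrow> dim_row A = n \<Longrightarrow> hermitian (reindex p A)"
proof -
  assume h: "hermitian A" "dim_row A = n"
  hence d: "dim_col A = n" and a: "adj A = A" by (auto simp: hermitian_def)
  have "adj (reindex p A) = reindex p (adj A)" using h d by (intro reindex_adj[symmetric])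
  thus ?thesis unfolding a using h d by (simp add: hermitian_def)
qed

lemma reindex_unitary: "unitary_mat n U \<Longrightarrow> unitary_mat n (reindex p U)"
proof -
  assume U: "unitary_mat n U"
  note d = unitary_dims[OF U]
  have e: "U * adj U = 1\<^sub>m n" "adj U * U = 1\<^sub>m n" using U by (simp_all add: unitary_mat_def)
  have r1: "reindex p (1\<^sub>m n) = 1\<^sub>m n" using reindex_mat_diag[of "\<lambda>_. 1"] by (simp add: mat_diag_one)
  have "reindex p U * adj (reindex p U) = reindex p (U * adj U)" "adj (reindex p U) * reindex p U = reindex p (adj U * U)"
    by (simp_all add: reindex_mult reindex_adj d)
  moreover have "reindex p U \<in> carrier_mat n n" by (rule carrier_matI) (simp_all add: d)
  ultimately show ?thesis by (simp add: unitary_mat_def e r1)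
qed

lemma qf_reindex:
  assumes "dim_row A = n" "dim_col A = n"
  shows "qf (reindex p A) (\<lambda>i. f (p i)) = qf A f"
proof -
  have "qf (reindex p A) (\<lambda>i. f (p i)) = (\<Sum>i<n. \<Sum>j<n. cnj (f (p i)) * A $$ (p i, p j) * f (p j))"
    using assms by (simp add: qf_def reindex_entry)
  also have "\<dots> = (\<Sum>i<n. \<Sum>j<n. cnj (f (p i)) * A $$ (p i, j) * f j)"
    by (intro sum.cong refl reindex_sum)
  also have "\<dots> = (\<Sum>i<n. \<Sum>j<n. cnj (f i) * A $$ (i, j) * f j)"
    by (rule reindex_sum)
  finally show ?thesis using assms by (simp add: qf_def)
qed

lemma reindex_psd:
  assumes "psd A" "dim_row A = n"
  shows "psd (reindex p A)"
  unfolding psd_iff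
proof (intro conjI allI)
  show "hermitian (reindex p A)" using assms by (simp add: psd_iff reindex_hermitian)
  fix f :: "nat \<Rightarrow> complex"
  \<comment> \<open>Pulling \<open>f\<close> back along the inverse permutation turns the form of
    the reindexed matrix into that of \<open>A\<close>.\<close>
  let ?g = "\<lambda>i. f (inv_into {..<n} p i)"
  have "qf (reindex p A) f = qf (reindex p A) (\<lambda>i. ?g (p i))"
    using assms(2) bij_betw_inv_into_left[OF p] by (auto simp: qf_def intro!: sum.cong)
  also have "\<dots> = qf A ?g" using qf_reindex[of A ?g] assms psd_dim[OF assms(1)] by simp
  finally show "Re (qf (reindex p A) f) \<ge> 0" using assms by (simp add: psd_iff)
qed

lemma reindex_cfun:
  assumes "pos_def A" "dim_row A = n"
  shows "cfun f (reindex p A) = reindex p (cfun f A)" and "pos_def (reindex p A)"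
proof -
  obtain U d where U: "unitary_mat n U" "\<And>i. d i > (0::real)"
    "A = U * mat_diag n (\<lambda>i. complex_of_real (d i)) * adj U"
    "\<And>f. cfun f A = U * mat_diag n (\<lambda>i. f (d i)) * adj U"
    by (rule pos_def_spectral[OF assms]) blast
  note [simp] = unitary_dims[OF U(1)]
  note V = reindex_unitary[OF U(1)]
  have e: "reindex p (U * mat_diag n g * adj U) = reindex p U * mat_diag n (\<lambda>i. g (p i)) * adj (reindex p U)" for g
    by (simp add: reindex_mult reindex_adj reindex_mat_diag)
  show "cfun f (reindex p A) = reindex p (cfun f A)"
    unfolding U(4) e using cfun_eq[OF V, of f "\<lambda>i. d (p i)"] unfolding e[of "\<lambda>i. complex_of_real (d i)", symmetric] U(3)[symmetric] .
  have "pos_def (reindex p U * mat_diag n (\<lambda>i. complex_of_real (d (p i))) * adj (reindex p U))"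
    by (rule pos_def_spectralI[OF V]) (rule U(2))
  thus "pos_def (reindex p A)" by (simp add: e[of "\<lambda>i. complex_of_real (d i)", symmetric] flip: U(3))
qed

end

text \<open>\<open>sw m1 m2\<close> sends an index of \<open>C^k \<otimes> C^m2 \<otimes> C^m1\<close> to the corresponding index of \<open>C^k \<otimes> C^m1 \<otimes> C^m2\<close>.\<close>

definition sw :: "nat \<Rightarrow> nat \<Rightarrow> nat \<Rightarrow> nat" where
  "sw m1 m2 i = ((i div m1) div m2 * m1 + i mod m1) * m2 + (i div m1) mod m2"

lemma sw_idx: "b < m1 \<Longrightarrow> c < m2 \<Longrightarrow> sw m1 m2 ((a * m2 + c) * m1 + b) = (a * m1 + b) * m2 + c"
  by (simp add: sw_def)

lemma all_idx3:
  fixes k m1 m2 :: nat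
  shows "(\<forall>i<k*m1*m2. P i) \<longleftrightarrow> (\<forall>a<k. \<forall>b<m1. \<forall>c<m2. P ((a * m1 + b) * m2 + c))"
  unfolding all_idx by (rule refl)

lemma sw_sw: "i < k * m2 * m1 \<Longrightarrow> sw m2 m1 (sw m1 m2 i) = i"
  using all_idx3[of k m2 m1 "\<lambda>i. sw m2 m1 (sw m1 m2 i) = i"] by (auto simp: sw_idx)

lemma sw_less: "i < k * m2 * m1 \<Longrightarrow> sw m1 m2 i < k * m1 * m2"
  using all_idx3[of k m2 m1 "\<lambda>i. sw m1 m2 i < k * m1 * m2"] by (auto simp: sw_idx idx_less)

lemma sw_bij: "N = k * m1 * m2 \<Longrightarrow> bij_betw (sw m1 m2) {..<N} {..<N}"
proof -
  assume N: "N = k * m1 * m2"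
  hence N': "N = k * m2 * m1" by simp
  show ?thesis
  proof (rule bij_betwI[of _ _ _ "sw m2 m1"])
    show "sw m1 m2 \<in> {..<N} \<rightarrow> {..<N}" using sw_less[of _ k m2 m1] by (auto simp: N[symmetric] N'[symmetric])
    show "sw m2 m1 \<in> {..<N} \<rightarrow> {..<N}" using sw_less[of _ k m1 m2] by (auto simp: N[symmetric] N'[symmetric])
    show "sw m2 m1 (sw m1 m2 i) = i" if "i \<in> {..<N}" for i using sw_sw[of i k m2 m1] that by (simp add: N')
    show "sw m1 m2 (sw m2 m1 i) = i" if "i \<in> {..<N}" for i using sw_sw[of i k m1 m2] that by (simp add: N)
  qed
qed

section \<open>Superoperators and their amplifications\<close>

definition munit :: "nat \<Rightarrow> nat \<Rightarrow> nat \<Rightarrow> complex mat" where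
  "munit m k l = mat m m (\<lambda>(i,j). if i = k \<and> j = l then 1 else 0)"

lemma munit_carrier [simp]: "munit m k l \<in> carrier_mat m m" "dim_row (munit m k l) = m" "dim_col (munit m k l) = m"
  by (auto simp: munit_def)

lemma superop_dim:
  assumes "superop m L" "dim_row X = m" "dim_col X = m"
  shows "dim_row (L X) = m" "dim_col (L X) = m"
proof -
  have "X \<in> carrier_mat m m" using assms by (intro carrier_matI)
  hence "L X \<in> carrier_mat m m" using assms(1) by (auto simp: superop_def)
  thus "dim_row (L X) = m" "dim_col (L X) = m" by auto
qed

lemma superop_add:
  assumes "superop m L" "dim_row X = m" "dim_col X = m" "dim_row Y = m" "dim_col Y = m"
  shows "L (X + Y) = L X + L Y"
proof -
  have "X \<in> carrier_mat m m" "Y \<in> carrier_mat m m" using assms by (auto intro!: carrier_matI)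
  thus ?thesis using assms(1) by (auto simp: superop_def)
qed

lemma superop_smult:
  assumes "superop m L" "dim_row X = m" "dim_col X = m"
  shows "L (a \<cdot>\<^sub>m X) = a \<cdot>\<^sub>m L X"
proof -
  have "X \<in> carrier_mat m m" using assms by (auto intro!: carrier_matI)
  thus ?thesis using assms(1) by (auto simp: superop_def)
qed

lemma superop_zero:
  assumes "superop m L"
  shows "L (0\<^sub>m m m) = 0\<^sub>m m m"
proof -
  have "L (0 \<cdot>\<^sub>m 0\<^sub>m m m) = 0 \<cdot>\<^sub>m L (0\<^sub>m m m)" by (rule superop_smult[OF assms]) auto
  moreover have "0 \<cdot>\<^sub>m 0\<^sub>m m m = (0\<^sub>m m m :: complex mat)" by (rule eq_matI) auto
  moreover have "0 \<cdot>\<^sub>m L (0\<^sub>m m m) = 0\<^sub>m m m" using superop_dim[OF assms, of "0\<^sub>m m m"] by (intro eq_matI) auto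
  ultimately show ?thesis by simp
qed

text \<open>Expansion in matrix units. It reduces holomorphy, differentiability and boundedness of
  \<open>L (F s)\<close> to the same properties of the entries of \<open>F s\<close>.\<close>

lemma superop_entry:
  assumes L: "superop m L" and X: "dim_row X = m" "dim_col X = m" and ij: "i < m" "j < m"
  shows "L X $$ (i,j) = (\<Sum>k<m. \<Sum>l<m. X $$ (k,l) * L (munit m k l) $$ (i,j))"
proof -
  \<comment> \<open>The truncation of \<open>X\<close> to an index set: linearity is available for
    two summands only, so the entries are added one at a time by induction on
    \<open>S\<close>.\<close>
  define XS where "XS S = mat m m (\<lambda>(k,l). if (k,l) \<in> S then X $$ (k,l) else 0)" for S
  have dS: "dim_row (XS S) = m" "dim_col (XS S) = m" for S by (auto simp: XS_def)
  have "L (XS S) $$ (i,j) = (\<Sum>(k,l)\<in>S. X $$ (k,l) * L (munit m k l) $$ (i,j))"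
    if "finite S" "S \<subseteq> {..<m} \<times> {..<m}" for S
    using that
  proof (induction S rule: finite_induct)
    case empty
    have "XS {} = 0\<^sub>m m m" by (rule eq_matI) (auto simp: XS_def)
    thus ?case using superop_zero[OF L] ij by simp
  next
    case (insert kl S)
    obtain k l where kl: "kl = (k,l)" "k < m" "l < m" using insert by (cases kl) auto
    have "XS (insert kl S) = X $$ (k,l) \<cdot>\<^sub>m munit m k l + XS S"
      using insert kl by (intro eq_matI) (auto simp: XS_def munit_def)
    moreover have "L (X $$ (k,l) \<cdot>\<^sub>m munit m k l + XS S) = X $$ (k,l) \<cdot>\<^sub>m L (munit m k l) + L (XS S)"
      by (simp add: superop_add[OF L] superop_smult[OF L] dS)
    ultimately show ?case using insert kl ij superop_dim[OF L, of "munit m k l"] superop_dim[OF L dS, of S] by simp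
  qed
  from this[of "{..<m} \<times> {..<m}"] have "L (XS ({..<m} \<times> {..<m})) $$ (i,j) = (\<Sum>k<m. \<Sum>l<m. X $$ (k,l) * L (munit m k l) $$ (i,j))"
    by (simp add: sum.cartesian_product)
  moreover have "XS ({..<m} \<times> {..<m}) = X" using X by (intro eq_matI) (auto simp: XS_def)
  ultimately show ?thesis by simp
qed

section \<open>Amplifications by an ancilla\<close>

lemma blk_dim [simp]: "dim_row (blk m X a b) = m" "dim_col (blk m X a b) = m"
  by (auto simp: blk_def)

lemma blk_entry [simp]: "r < m \<Longrightarrow> s < m \<Longrightarrow> blk m X a b $$ (r,s) = X $$ (a * m + r, b * m + s)"
  by (auto simp: blk_def)

lemma ampl_dim [simp]: "dim_row (ampl k m L X) = k * m" "dim_col (ampl k m L X) = k * m"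
  by (auto simp: ampl_def)

lemma ampl_idx:
  "a < k \<Longrightarrow> b < k \<Longrightarrow> r < m \<Longrightarrow> s < m \<Longrightarrow>
    ampl k m L X $$ (a * m + r, b * m + s) = L (blk m X a b) $$ (r,s)"
  by (simp add: ampl_def idx_less)

lemma blk_ampl:
  assumes "superop m L" "a < k" "b < k"
  shows "blk m (ampl k m L X) a b = L (blk m X a b)"
  using superop_dim[OF assms(1), of "blk m X a b"] assms
  by (intro eq_matI) (auto simp: ampl_idx)

lemma eq_mat_idxI:
  assumes "dim_row A = k * m" "dim_col A = k * m" "dim_row B = k * m" "dim_col B = k * m"
    and "\<And>a b r s. a < k \<Longrightarrow> b < k \<Longrightarrow> r < m \<Longrightarrow> s < m \<Longrightarrow> A $$ (a * m + r, b * m + s) = B $$ (a * m + r, b * m + s)"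
  shows "A = B"
proof (rule eq_matI)
  fix i j assume "i < dim_row B" "j < dim_col B"
  hence ij: "i < k * m" "j < k * m" using assms by auto
  show "A $$ (i,j) = B $$ (i,j)"
    using assms(5)[OF div_less_idx[OF ij(1)] div_less_idx[OF ij(2)] mod_less_idx[OF ij(1)] mod_less_idx[OF ij(2)]]
    by simp
qed (use assms in auto)

lemma ampl_entry:
  assumes "superop m L" "a < k" "b < k" "r < m" "s < m"
  shows "ampl k m L X $$ (a * m + r, b * m + s) =
    (\<Sum>u<m. \<Sum>v<m. X $$ (a * m + u, b * m + v) * L (munit m u v) $$ (r,s))"
proof -
  have "ampl k m L X $$ (a * m + r, b * m + s) = L (blk m X a b) $$ (r,s)" using assms by (intro ampl_idx)
  also have "\<dots> = (\<Sum>u<m. \<Sum>v<m. blk m X a b $$ (u,v) * L (munit m u v) $$ (r,s))"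
    using assms by (intro superop_entry) auto
  finally show ?thesis by simp
qed

lemma ampl_add:
  assumes "superop m L" "dim_row X = k * m" "dim_col X = k * m" "dim_row Y = k * m" "dim_col Y = k * m"
  shows "ampl k m L (X + Y) = ampl k m L X + ampl k m L Y"
  using assms by (intro eq_mat_idxI[of _ k m])
    (simp_all add: ampl_entry idx_less sum.distrib ring_distribs)

lemma ampl_smult:
  assumes "superop m L" "dim_row X = k * m" "dim_col X = k * m"
  shows "ampl k m L (c \<cdot>\<^sub>m X) = c \<cdot>\<^sub>m ampl k m L X"
  using assms by (intro eq_mat_idxI[of _ k m])
    (simp_all add: ampl_entry idx_less sum_distrib_left mult.assoc)

lemma ampl_superop: "superop m L \<Longrightarrow> superop (k * m) (ampl k m L)"
  by (auto simp: superop_def[of "k * m"] ampl_add ampl_smult intro!: carrier_matI)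

lemma ampl_kron:
  assumes "superop m L" "dim_row A = k" "dim_col A = k" "dim_row B = m" "dim_col B = m"
  shows "ampl k m L (kron A B) = kron A (L B)"
proof (rule eq_mat_idxI[of _ k m])
  note d = superop_dim[OF assms(1,4,5)]
  fix a b r s assume l: "a < k" "b < k" "r < m" "s < m"
  have "ampl k m L (kron A B) $$ (a * m + r, b * m + s) = (\<Sum>u<m. \<Sum>v<m. A $$ (a,b) * (B $$ (u,v) * L (munit m u v) $$ (r,s)))"
    using l assms by (auto simp: ampl_entry kron_entry idx_less mult.assoc intro!: sum.cong)
  also have "\<dots> = A $$ (a,b) * L B $$ (r,s)"
    unfolding superop_entry[OF assms(1,4,5) l(3,4)] by (simp add: sum_distrib_left)
  also have "\<dots> = kron A (L B) $$ (a * m + r, b * m + s)" using l assms d by (simp add: kron_entry idx_less)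
  finally show "ampl k m L (kron A B) $$ (a * m + r, b * m + s) = kron A (L B) $$ (a * m + r, b * m + s)" .
qed (use superop_dim[OF assms(1,4,5)] assms in auto)

text \<open>\<open>id \<otimes> L\<close> does not act on the ancilla, so it commutes with
  multiplication by \<open>B \<otimes> 1\<close>. With the version for the right side, this is what
  allows the weight on the ancilla to be exchanged later.\<close>

lemma ampl_mult_left:
  assumes L: "superop m L" and X: "dim_row X = k * m" "dim_col X = k * m" and B: "dim_row B = k" "dim_col B = k"
  shows "ampl k m L (kron B (1\<^sub>m m) * X) = kron B (1\<^sub>m m) * ampl k m L X"
proof (rule eq_mat_idxI[of _ k m])
  fix a b r s assume l: "a < k" "b < k" "r < m" "s < m"
  let ?T = "\<lambda>u v. L (munit m u v) $$ (r,s)"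
  have "ampl k m L (kron B (1\<^sub>m m) * X) $$ (a * m + r, b * m + s) =
      (\<Sum>u<m. \<Sum>v<m. \<Sum>c<k. B $$ (a,c) * X $$ (c * m + u, b * m + v) * ?T u v)"
    using l X B by (auto simp: ampl_entry[OF L] kron_one_mult_entry idx_less sum_distrib_right intro!: sum.cong simp del: index_mult_mat(1))
  also have "\<dots> = (\<Sum>u<m. \<Sum>c<k. \<Sum>v<m. B $$ (a,c) * X $$ (c * m + u, b * m + v) * ?T u v)"
    by (intro sum.cong refl sum.swap)
  also have "\<dots> = (\<Sum>c<k. \<Sum>u<m. \<Sum>v<m. B $$ (a,c) * X $$ (c * m + u, b * m + v) * ?T u v)"
    by (rule sum.swap)
  also have "\<dots> = (\<Sum>c<k. B $$ (a,c) * ampl k m L X $$ (c * m + r, b * m + s))"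
    using l by (auto simp: ampl_entry[OF L] sum_distrib_left mult.assoc intro!: sum.cong)
  also have "\<dots> = (kron B (1\<^sub>m m) * ampl k m L X) $$ (a * m + r, b * m + s)"
    using l X B by (subst kron_one_mult_entry[of _ k m]) (auto simp: idx_less)
  finally show "ampl k m L (kron B (1\<^sub>m m) * X) $$ (a * m + r, b * m + s) =
    (kron B (1\<^sub>m m) * ampl k m L X) $$ (a * m + r, b * m + s)" .
qed (use assms in auto)

lemma ampl_mult_right:
  assumes L: "superop m L" and X: "dim_row X = k * m" "dim_col X = k * m" and B: "dim_row B = k" "dim_col B = k"
  shows "ampl k m L (X * kron B (1\<^sub>m m)) = ampl k m L X * kron B (1\<^sub>m m)"
proof (rule eq_mat_idxI[of _ k m])
  fix a b r s assume l: "a < k" "b < k" "r < m" "s < m"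
  let ?T = "\<lambda>u v. L (munit m u v) $$ (r,s)"
  have "ampl k m L (X * kron B (1\<^sub>m m)) $$ (a * m + r, b * m + s) =
      (\<Sum>u<m. \<Sum>v<m. \<Sum>c<k. X $$ (a * m + u, c * m + v) * B $$ (c,b) * ?T u v)"
    using l X B by (auto simp: ampl_entry[OF L] mult_kron_one_entry idx_less sum_distrib_right intro!: sum.cong simp del: index_mult_mat(1))
  also have "\<dots> = (\<Sum>u<m. \<Sum>c<k. \<Sum>v<m. X $$ (a * m + u, c * m + v) * B $$ (c,b) * ?T u v)"
    by (intro sum.cong refl sum.swap)
  also have "\<dots> = (\<Sum>c<k. \<Sum>u<m. \<Sum>v<m. X $$ (a * m + u, c * m + v) * B $$ (c,b) * ?T u v)"
    by (rule sum.swap)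
  also have "\<dots> = (\<Sum>c<k. ampl k m L X $$ (a * m + r, c * m + s) * B $$ (c,b))"
    using l by (auto simp: ampl_entry[OF L] sum_distrib_left sum_distrib_right mult_ac intro!: sum.cong)
  also have "\<dots> = (ampl k m L X * kron B (1\<^sub>m m)) $$ (a * m + r, b * m + s)"
    using l X B by (subst mult_kron_one_entry[of _ k m]) (auto simp: idx_less)
  finally show "ampl k m L (X * kron B (1\<^sub>m m)) $$ (a * m + r, b * m + s) =
    (ampl k m L X * kron B (1\<^sub>m m)) $$ (a * m + r, b * m + s)" .
qed (use assms in auto)

lemma blk_blk:
  assumes "p < m1" "q < m1"
  shows "blk m2 (blk (m1 * m2) X a b) p q = blk m2 X (a * m1 + p) (b * m1 + q)"
proof (rule eq_matI)
  have e: "c * (m1 * m2) + (x * m2 + y) = (c * m1 + x) * m2 + y" for c x y :: nat by (simp add: ring_distribs)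
  fix i j assume "i < dim_row (blk m2 X (a * m1 + p) (b * m1 + q))" "j < dim_col (blk m2 X (a * m1 + p) (b * m1 + q))"
  hence "i < m2" "j < m2" by auto
  thus "blk m2 (blk (m1 * m2) X a b) p q $$ (i,j) = blk m2 X (a * m1 + p) (b * m1 + q) $$ (i,j)"
    using assms by (simp add: idx_less e)
qed auto

text \<open>Associativity of the tensor product: a factor on which \<open>L\<close> does not act
  becomes part of the ancilla.\<close>

lemma ampl_ampl: "ampl k (m1 * m2) (ampl m1 m2 L) X = ampl (k * m1) m2 L X"
proof (rule eq_mat_idxI[of _ "k * m1" m2])
  have e: "(c * m1 + x) * m2 + y = c * (m1 * m2) + (x * m2 + y)" for c x y :: nat by (simp add: ring_distribs)
  fix A B r s assume l: "A < k * m1" "B < k * m1" "r < m2" "s < m2"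
  define a p b q where ap: "a = A div m1" "p = A mod m1" "b = B div m1" "q = B mod m1"
  have AB: "A = a * m1 + p" "B = b * m1 + q" by (auto simp: ap)
  have l': "a < k" "b < k" "p < m1" "q < m1" using l by (auto simp: ap div_less_idx mod_less_idx)
  have "ampl k (m1 * m2) (ampl m1 m2 L) X $$ (A * m2 + r, B * m2 + s) =
      ampl m1 m2 L (blk (m1 * m2) X a b) $$ (p * m2 + r, q * m2 + s)"
    unfolding AB e using l l' by (intro ampl_idx) (auto simp: idx_less)
  also have "\<dots> = L (blk m2 X A B) $$ (r,s)"
    using l l' by (simp add: ampl_idx blk_blk AB)
  also have "\<dots> = ampl (k * m1) m2 L X $$ (A * m2 + r, B * m2 + s)" using l by (simp add: ampl_idx)
  finally show "ampl k (m1 * m2) (ampl m1 m2 L) X $$ (A * m2 + r, B * m2 + s) = ampl (k * m1) m2 L X $$ (A * m2 + r, B * m2 + s)" .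
qed (auto simp: mult.assoc)

lemma ampl_mid_right:
  assumes "dim_row X = a * m" "dim_col X = a * m"
  shows "ampl_mid a m 1 L X = ampl a m L X"
  using assms by (intro eq_matI) (auto simp: ampl_mid_def ampl_def blk_def)

lemma ampl_mid_one_dim [simp]: "dim_row (ampl_mid a m b L X) = a * m * b" "dim_col (ampl_mid a m b L X) = a * m * b"
  by (auto simp: ampl_mid_def)

text \<open>The counterpart of \<open>ampl_ampl\<close> for an action on the first of two factors.
  \<open>LSI_CB\<close> speaks only of maps acting on the last factor, so the two factors are
  exchanged before the amplification and exchanged back after it.\<close>

lemma ampl_ampl_mid:
  assumes X: "dim_row X = k * m1 * m2" "dim_col X = k * m1 * m2"
  shows "ampl k (m1 * m2) (ampl_mid 1 m1 m2 L) X = reindex (sw m2 m1) (ampl (k * m2) m1 L (reindex (sw m1 m2) X))"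
proof (rule eq_mat_idxI[of _ "k * m1" m2])
  have e: "(c * m1 + x) * m2 + y = c * (m1 * m2) + (x * m2 + y)" for c x y :: nat by (simp add: ring_distribs)
  have kk: "k * m2 * m1 = k * m1 * m2" by simp
  fix A B r s assume l: "A < k * m1" "B < k * m1" "r < m2" "s < m2"
  define a p b q where ap: "a = A div m1" "p = A mod m1" "b = B div m1" "q = B mod m1"
  have AB: "A = a * m1 + p" "B = b * m1 + q" by (auto simp: ap)
  have l': "a < k" "b < k" "p < m1" "q < m1" using l by (auto simp: ap div_less_idx mod_less_idx)
  have "ampl k (m1 * m2) (ampl_mid 1 m1 m2 L) X $$ (A * m2 + r, B * m2 + s) =
      ampl_mid 1 m1 m2 L (blk (m1 * m2) X a b) $$ (p * m2 + r, q * m2 + s)"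
    unfolding AB e using l l' by (intro ampl_idx) (auto simp: idx_less)
  also have "\<dots> = L (mat m1 m1 (\<lambda>(u,v). blk (m1 * m2) X a b $$ (u * m2 + r, v * m2 + s))) $$ (p,q)"
    using l l' by (simp add: ampl_mid_def idx_less)
  also have "mat m1 m1 (\<lambda>(u,v). blk (m1 * m2) X a b $$ (u * m2 + r, v * m2 + s))
     = blk m1 (reindex (sw m1 m2) X) (a * m2 + r) (b * m2 + s)"
  proof (rule eq_matI)
    fix u v assume "u < dim_row (blk m1 (reindex (sw m1 m2) X) (a * m2 + r) (b * m2 + s))"
      "v < dim_col (blk m1 (reindex (sw m1 m2) X) (a * m2 + r) (b * m2 + s))"
    hence uv: "u < m1" "v < m1" by auto
    have "(a * m2 + r) * m1 + u < k * m2 * m1" "(b * m2 + s) * m1 + v < k * m2 * m1"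
      using l l' uv by (auto intro!: idx_less)
    thus "mat m1 m1 (\<lambda>(u,v). blk (m1 * m2) X a b $$ (u * m2 + r, v * m2 + s)) $$ (u,v)
      = blk m1 (reindex (sw m1 m2) X) (a * m2 + r) (b * m2 + s) $$ (u,v)"
      using uv l l' X by (simp add: idx_less reindex_entry kk sw_idx e)
  qed auto
  also have "L (blk m1 (reindex (sw m1 m2) X) (a * m2 + r) (b * m2 + s)) $$ (p,q)
     = ampl (k * m2) m1 L (reindex (sw m1 m2) X) $$ ((a * m2 + r) * m1 + p, (b * m2 + s) * m1 + q)"
    using l l' by (intro ampl_idx[symmetric] idx_less) auto
  also have "\<dots> = reindex (sw m2 m1) (ampl (k * m2) m1 L (reindex (sw m1 m2) X)) $$ (A * m2 + r, B * m2 + s)"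
  proof -
    have "A * m2 + r < k * m2 * m1" "B * m2 + s < k * m2 * m1" unfolding kk using l by (auto intro!: idx_less)
    thus ?thesis using l l' by (simp add: reindex_entry AB sw_idx)
  qed
  finally show "ampl k (m1 * m2) (ampl_mid 1 m1 m2 L) X $$ (A * m2 + r, B * m2 + s) =
     reindex (sw m2 m1) (ampl (k * m2) m1 L (reindex (sw m1 m2) X)) $$ (A * m2 + r, B * m2 + s)" .
qed auto

lemma reindex_kron:
  assumes "dim_row A = k" "dim_col A = k" "dim_row B = m1" "dim_col B = m1" "dim_row C = m2" "dim_col C = m2"
  shows "reindex (sw m1 m2) (kron (kron A B) C) = kron (kron A C) B"
proof (rule eq_mat_idxI[of _ "k * m2" m1])
  have kk: "k * m2 * m1 = k * m1 * m2" by simp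
  fix I J r s assume l: "I < k * m2" "J < k * m2" "r < m1" "s < m1"
  define a p b q where ap: "a = I div m2" "p = I mod m2" "b = J div m2" "q = J mod m2"
  have AB: "I = a * m2 + p" "J = b * m2 + q" by (auto simp: ap)
  have l': "a < k" "b < k" "p < m2" "q < m2" using l by (auto simp: ap div_less_idx mod_less_idx)
  have t: "I * m1 + r < k * m1 * m2" "J * m1 + s < k * m1 * m2" unfolding kk[symmetric] using l by (auto intro!: idx_less)
  have t2: "(a * m1 + r) * m2 + p < k * m1 * m2" "(b * m1 + s) * m2 + q < k * m1 * m2" "a * m1 + r < k * m1" "b * m1 + s < k * m1"
     using l l' by (auto intro!: idx_less)
  have "reindex (sw m1 m2) (kron (kron A B) C) $$ (I * m1 + r, J * m1 + s) = kron (kron A B) C $$ ((a * m1 + r) * m2 + p, (b * m1 + s) * m2 + q)"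
    using t l l' assms by (simp add: reindex_entry AB sw_idx)
  also have "\<dots> = A $$ (a,b) * B $$ (r,s) * C $$ (p,q)"
    using t2 l l' assms by (simp add: kron_entry)
  also have "\<dots> = kron (kron A C) B $$ (I * m1 + r, J * m1 + s)"
    using l l' assms by (simp add: kron_entry idx_less AB)
  finally show "reindex (sw m1 m2) (kron (kron A B) C) $$ (I * m1 + r, J * m1 + s) = kron (kron A C) B $$ (I * m1 + r, J * m1 + s)" .
qed (use assms in auto)

lemma reindex_reindex:
  assumes "dim_row X = k * m1 * m2" "dim_col X = k * m1 * m2"
  shows "reindex (sw m2 m1) (reindex (sw m1 m2) X) = X"
proof (rule eq_matI)
  fix i j assume "i < dim_row X" "j < dim_col X"
  thus "reindex (sw m2 m1) (reindex (sw m1 m2) X) $$ (i,j) = X $$ (i,j)"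
    using assms sw_less[of i k m1 m2] sw_less[of j k m1 m2] sw_sw[of i k m1 m2] sw_sw[of j k m1 m2]
    by (simp add: reindex_entry mult.commute[of m2 m1] mult.assoc)
qed auto

lemma mtrace_kron_mult:
  assumes "dim_row A = k" "dim_col A = k" "dim_row B = m" "dim_col B = m" "dim_row X = k * m" "dim_col X = k * m"
  shows "mtrace (kron A B * X) = (\<Sum>a<k. \<Sum>b<k. A $$ (a,b) * mtrace (B * blk m X b a))"
proof -
  have "mtrace (kron A B * X) = (\<Sum>i<k*m. \<Sum>j<k*m. kron A B $$ (i,j) * X $$ (j,i))"
    using assms by (intro mtrace_mult_sum) auto
  also have "\<dots> = (\<Sum>a<k. \<Sum>r<m. \<Sum>b<k. \<Sum>s<m. A $$ (a,b) * (B $$ (r,s) * X $$ (b * m + s, a * m + r)))"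
    unfolding sum_idx using assms by (intro sum.cong refl) (simp add: kron_entry idx_less)
  also have "\<dots> = (\<Sum>a<k. \<Sum>b<k. \<Sum>r<m. \<Sum>s<m. A $$ (a,b) * (B $$ (r,s) * X $$ (b * m + s, a * m + r)))"
    by (intro sum.cong refl sum.swap)
  also have "\<dots> = (\<Sum>a<k. \<Sum>b<k. A $$ (a,b) * mtrace (B * blk m X b a))"
    using assms by (intro sum.cong refl) (simp add: mtrace_mult_sum[where n=m] sum_distrib_left)
  finally show ?thesis .
qed

text \<open>The constant \<open>c\<close> covers two situations: \<open>c = 1\<close> for a
  semigroup that preserves \<open>\<sigma>\<close>, and \<open>c = 0\<close> for its generator,
  which \<open>\<sigma>\<close> annihilates.\<close>

lemma mtrace_kron_ampl:
  assumes L: "superop m L" and inv: "\<And>Y. dim_row Y = m \<Longrightarrow> dim_col Y = m \<Longrightarrow> mtrace (\<sigma> * L Y) = c * mtrace (\<sigma> * Y)"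
    and d: "dim_row A = k" "dim_col A = k" "dim_row \<sigma> = m" "dim_col \<sigma> = m" "dim_row X = k * m" "dim_col X = k * m"
  shows "mtrace (kron A \<sigma> * ampl k m L X) = c * mtrace (kron A \<sigma> * X)"
  using d by (simp add: mtrace_kron_mult blk_ampl[OF L] inv sum_distrib_left mult_ac)

section \<open>Complex interpolation of matrix powers\<close>

text \<open>The factor \<open>exp (e (z^2 - 1))\<close> has modulus at most 1 on the strip and
  decays as the imaginary part grows. The maximum modulus principle then applies on a tall
  rectangle, and \<open>e\<close> tends to 0 afterwards.\<close>

theorem three_lines:
  assumes hol: "g holomorphic_on UNIV"
    and bdd: "\<And>z. 0 \<le> Re z \<Longrightarrow> Re z \<le> 1 \<Longrightarrow> cmod (g z) \<le> C"
    and left: "\<And>y. cmod (g (Complex 0 y)) \<le> M" and right: "\<And>y. cmod (g (Complex 1 y)) \<le> M"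
    and s: "0 \<le> Re s" "Re s \<le> 1"
  shows "cmod (g s) \<le> M"
proof (rule field_le_epsilon)
  fix \<delta> :: real assume \<delta>: "\<delta> > 0"
  \<comment> \<open>\<open>M\<close> may be 0; a strictly positive bound is needed as a denominator
    in the choice of the height \<open>R\<close>.\<close>
  define M' where "M' = M + \<delta>"
  have M0: "M \<ge> 0" using left[of 0] norm_ge_zero order_trans by blast
  hence M': "M' > 0" "M \<le> M'" using \<delta> by (auto simp: M'_def)
  have C0: "C \<ge> 0" using bdd[OF s] norm_ge_zero order_trans by blast
  have main: "cmod (g s) * exp (e * ((Re s)\<^sup>2 - (Im s)\<^sup>2 - 1)) \<le> M'" if e: "e > 0" for e
  proof -
    define f where "f z = g z * exp (complex_of_real e * (z\<^sup>2 - 1))" for z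
    have nf: "cmod (f z) = cmod (g z) * exp (e * ((Re z)\<^sup>2 - (Im z)\<^sup>2 - 1))" for z
      by (simp add: f_def norm_mult power2_eq_square)
    \<comment> \<open>Large enough to contain \<open>s\<close> and to ensure
      \<open>C \<le> M' e R^2 \<le> M' exp (e R^2)\<close>, so that the damping beats the crude
      bound \<open>C\<close> on the horizontal sides.\<close>
    define R where "R = 1 + \<bar>Im s\<bar> + C / (e * M')"
    have R1: "R \<ge> 1" "R \<ge> C / (e * M')" "\<bar>Im s\<bar> \<le> R" using C0 e M' by (auto simp: R_def)
    have RR: "R\<^sup>2 \<ge> C / (e * M')"
    proof -
      have "R * 1 \<le> R * R" using R1 by (intro mult_left_mono) auto
      hence "C / (e * M') \<le> R * R" using R1(2) by linarith
      thus ?thesis by (simp add: power2_eq_square)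
    qed
    have CR: "C * exp (- (e * R\<^sup>2)) \<le> M'"
    proof -
      have "C \<le> M' * (e * R\<^sup>2)" using RR e M' by (simp add: field_simps)
      also have "\<dots> \<le> M' * exp (e * R\<^sup>2)" using M' exp_ge_add_one_self[of "e * R\<^sup>2"] by (intro mult_left_mono) linarith+
      finally show ?thesis by (simp add: exp_minus field_simps)
    qed
    let ?S = "cbox (Complex 0 (-R)) (Complex 1 R)"
    have "cmod (f s) \<le> M'"
    proof (rule maximum_modulus_frontier[of f ?S])
      have "f holomorphic_on UNIV" unfolding f_def by (intro holomorphic_intros hol)
      thus "f holomorphic_on interior ?S" by (rule holomorphic_on_subset) auto
      show "continuous_on (closure ?S) f"
        using \<open>f holomorphic_on UNIV\<close> holomorphic_on_imp_continuous_on continuous_on_subset by blast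
      show "bounded ?S" by simp
      show "s \<in> ?S" using s R1 by (auto simp: in_cbox_complex_iff)
      fix z assume "z \<in> frontier ?S"
      hence "z \<in> ?S" "z \<notin> box (Complex 0 (-R)) (Complex 1 R)" by (auto simp: frontier_def)
      hence z: "0 \<le> Re z" "Re z \<le> 1" "- R \<le> Im z" "Im z \<le> R"
        and zz: "Re z = 0 \<or> Re z = 1 \<or> Im z = R \<or> Im z = - R"
        by (auto simp: in_cbox_complex_iff in_box_complex_iff)
      have rz: "(Re z)\<^sup>2 \<le> 1" using z by (simp add: power_le_one)
      show "cmod (f z) \<le> M'"
      proof (cases "Re z = 0 \<or> Re z = 1")
        case True
        hence "cmod (g z) \<le> M" using left[of "Im z"] right[of "Im z"] by (metis complex_surj)
        moreover have "e * ((Re z)\<^sup>2 - (Im z)\<^sup>2 - 1) \<le> 0"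
          using e rz zero_le_power2[of "Im z"] by (intro mult_nonneg_nonpos) linarith+
        ultimately have "cmod (g z) * exp (e * ((Re z)\<^sup>2 - (Im z)\<^sup>2 - 1)) \<le> M * 1"
          using M0 by (intro mult_mono) auto
        thus ?thesis using M' by (simp add: nf)
      next
        case False
        hence "(Im z)\<^sup>2 = R\<^sup>2" using zz by auto
        hence "e * ((Re z)\<^sup>2 - (Im z)\<^sup>2 - 1) \<le> e * (- R\<^sup>2)" using e rz by (intro mult_left_mono) auto
        hence "cmod (g z) * exp (e * ((Re z)\<^sup>2 - (Im z)\<^sup>2 - 1)) \<le> C * exp (- (e * R\<^sup>2))"
          using bdd[of z] z C0 by (intro mult_mono) auto
        thus ?thesis using CR by (simp add: nf)
      qed
    qed
    thus ?thesis by (simp add: nf)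
  qed
  have "((\<lambda>e. cmod (g s) * exp (e * ((Re s)\<^sup>2 - (Im s)\<^sup>2 - 1))) \<longlongrightarrow> cmod (g s) * exp (0 * ((Re s)\<^sup>2 - (Im s)\<^sup>2 - 1))) (at_right 0)"
    by (intro tendsto_intros)
  hence "cmod (g s) * exp (0 * ((Re s)\<^sup>2 - (Im s)\<^sup>2 - 1)) \<le> M'"
    by (rule tendsto_upperbound[OF _ eventually_mono[OF eventually_at_right_less main]]) simp_all
  thus "cmod (g s) \<le> M + \<delta>" by (simp add: M'_def)
qed

text \<open>Entries are entire and bounded on the closed strip. The class contains complex powers
  and is closed under products and superoperators, so the three lines theorem applies to traces of
  the expressions below.\<close>

definition bhol :: "nat \<Rightarrow> (complex \<Rightarrow> complex mat) \<Rightarrow> bool" where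
  "bhol n F \<longleftrightarrow> (\<forall>s. dim_row (F s) = n \<and> dim_col (F s) = n) \<and>
     (\<forall>i<n. \<forall>j<n. (\<lambda>s. F s $$ (i,j)) holomorphic_on UNIV) \<and>
     (\<exists>C. \<forall>s. 0 \<le> Re s \<longrightarrow> Re s \<le> 1 \<longrightarrow> (\<forall>i<n. \<forall>j<n. cmod (F s $$ (i,j)) \<le> C))"

lemma bhol_combination:
  assumes dims: "\<And>s. dim_row (F s) = n \<and> dim_col (F s) = n"
    and hol: "\<And>i j. i < n \<Longrightarrow> j < n \<Longrightarrow> (\<lambda>s. F s $$ (i,j)) holomorphic_on UNIV"
    and bdd: "\<And>i j. i < n \<Longrightarrow> j < n \<Longrightarrow> \<exists>C. \<forall>s. 0 \<le> Re s \<longrightarrow> Re s \<le> 1 \<longrightarrow> cmod (F s $$ (i,j)) \<le> C"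
  shows "bhol n F"
proof -
  obtain C where C: "\<And>i j s. i < n \<Longrightarrow> j < n \<Longrightarrow> 0 \<le> Re s \<Longrightarrow> Re s \<le> 1 \<Longrightarrow> cmod (F s $$ (i,j)) \<le> C i j"
    using bdd by metis
  have "cmod (F s $$ (i,j)) \<le> (\<Sum>i<n. \<Sum>j<n. \<bar>C i j\<bar>)" if "i < n" "j < n" "0 \<le> Re s" "Re s \<le> 1" for i j s
  proof -
    have "cmod (F s $$ (i,j)) \<le> \<bar>C i j\<bar>" using C[OF that] by linarith
    also have "\<dots> \<le> (\<Sum>j<n. \<bar>C i j\<bar>)" using that by (intro member_le_sum) auto
    also have "\<dots> \<le> (\<Sum>i<n. \<Sum>j<n. \<bar>C i j\<bar>)"
      using that by (intro member_le_sum[of i _ "\<lambda>i. \<Sum>j<n. \<bar>C i j\<bar>"]) (auto intro!: sum_nonneg)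
    finally show ?thesis .
  qed
  thus ?thesis using dims hol unfolding bhol_def by blast
qed

text \<open>The modulus of \<open>exp ((a s + b) ln d)\<close> depends on the real part of
  \<open>s\<close> alone, hence is bounded on the strip.\<close>

lemma bhol_cpw:
  assumes "pos_def A" "dim_row A = n"
  shows "bhol n (\<lambda>s. cpw A (complex_of_real a * s + complex_of_real b))"
proof (rule bhol_combination)
  obtain c d where d: "\<And>i. d i > (0::real)"
    and e: "\<And>f i j. i < n \<Longrightarrow> j < n \<Longrightarrow> cfun f A $$ (i,j) = (\<Sum>l<n. c i j l * f (d l))"
    using cfun_entry[OF assms] by metis
  show "dim_row (cpw A (complex_of_real a * s + complex_of_real b)) = n \<and> dim_col (cpw A (complex_of_real a * s + complex_of_real b)) = n" for s using assms by simp
  fix i j assume ij: "i < n" "j < n"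
  have e': "cpw A (complex_of_real a * s + complex_of_real b) $$ (i,j) =
      (\<Sum>l<n. c i j l * exp ((complex_of_real a * s + complex_of_real b) * complex_of_real (ln (d l))))" for s
    unfolding cpw_def by (rule e[OF ij])
  show "(\<lambda>s. cpw A (complex_of_real a * s + complex_of_real b) $$ (i,j)) holomorphic_on UNIV"
    unfolding e' by (intro holomorphic_intros)
  show "\<exists>C. \<forall>s. 0 \<le> Re s \<longrightarrow> Re s \<le> 1 \<longrightarrow> cmod (cpw A (complex_of_real a * s + complex_of_real b) $$ (i,j)) \<le> C"
  proof (intro exI allI impI)
    fix s assume s: "0 \<le> Re s" "Re s \<le> 1"
    show "cmod (cpw A (complex_of_real a * s + complex_of_real b) $$ (i,j)) \<le> (\<Sum>l<n. cmod (c i j l) * exp ((\<bar>a\<bar> + \<bar>b\<bar>) * \<bar>ln (d l)\<bar>))"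
      unfolding e'
    proof (intro order_trans[OF norm_sum] sum_mono)
      fix l
      have "(a * Re s + b) * ln (d l) \<le> \<bar>a * Re s + b\<bar> * \<bar>ln (d l)\<bar>" by (metis abs_ge_self abs_mult)
      also have "\<dots> \<le> (\<bar>a\<bar> + \<bar>b\<bar>) * \<bar>ln (d l)\<bar>"
      proof (intro mult_right_mono)
        have "\<bar>a * Re s\<bar> \<le> \<bar>a\<bar> * 1" unfolding abs_mult using s by (intro mult_left_mono) auto
        thus "\<bar>a * Re s + b\<bar> \<le> \<bar>a\<bar> + \<bar>b\<bar>" by linarith
      qed auto
      finally show "cmod (c i j l * exp ((complex_of_real a * s + complex_of_real b) * complex_of_real (ln (d l)))) \<le>
        cmod (c i j l) * exp ((\<bar>a\<bar> + \<bar>b\<bar>) * \<bar>ln (d l)\<bar>)"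
        by (auto simp: norm_mult intro!: mult_left_mono)
    qed
  qed
qed

lemma bholD:
  assumes "bhol n F"
  shows "dim_row (F s) = n" "dim_col (F s) = n"
    "i < n \<Longrightarrow> j < n \<Longrightarrow> (\<lambda>s. F s $$ (i,j)) holomorphic_on UNIV"
  using assms by (simp_all add: bhol_def)

lemma bhol_bound:
  assumes "bhol n F"
  obtains C where "\<And>s i j. 0 \<le> Re s \<Longrightarrow> Re s \<le> 1 \<Longrightarrow> i < n \<Longrightarrow> j < n \<Longrightarrow> cmod (F s $$ (i,j)) \<le> C"
proof -
  have "\<exists>C. \<forall>s. 0 \<le> Re s \<longrightarrow> Re s \<le> 1 \<longrightarrow> (\<forall>i<n. \<forall>j<n. cmod (F s $$ (i,j)) \<le> C)"
    using assms by (simp add: bhol_def)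
  thus ?thesis using that by blast
qed

lemma bhol_mult:
  assumes F: "bhol n F" and G: "bhol n G"
  shows "bhol n (\<lambda>s. F s * G s)"
proof (rule bhol_combination)
  have d: "dim_row (F s) = n" "dim_col (F s) = n" "dim_row (G s) = n" "dim_col (G s) = n" for s
    by (simp_all add: bholD[OF F] bholD[OF G])
  show "dim_row (F s * G s) = n \<and> dim_col (F s * G s) = n" for s by (simp add: d)
  fix i j assume ij: "i < n" "j < n"
  have e: "(F s * G s) $$ (i,j) = (\<Sum>k<n. F s $$ (i,k) * G s $$ (k,j))" for s
    using ij by (simp add: mult_entry d del: index_mult_mat(1))
  show "(\<lambda>s. (F s * G s) $$ (i,j)) holomorphic_on UNIV"
    unfolding e using ij by (intro holomorphic_intros bholD(3)[OF F] bholD(3)[OF G]) auto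
  obtain C where C: "\<And>s i j. 0 \<le> Re s \<Longrightarrow> Re s \<le> 1 \<Longrightarrow> i < n \<Longrightarrow> j < n \<Longrightarrow> cmod (F s $$ (i,j)) \<le> C"
    by (rule bhol_bound[OF F]) blast
  obtain D where D: "\<And>s i j. 0 \<le> Re s \<Longrightarrow> Re s \<le> 1 \<Longrightarrow> i < n \<Longrightarrow> j < n \<Longrightarrow> cmod (G s $$ (i,j)) \<le> D"
    by (rule bhol_bound[OF G]) blast
  show "\<exists>C. \<forall>s. 0 \<le> Re s \<longrightarrow> Re s \<le> 1 \<longrightarrow> cmod ((F s * G s) $$ (i,j)) \<le> C"
  proof (intro exI allI impI)
    fix s assume s: "0 \<le> Re s" "Re s \<le> 1"
    show "cmod ((F s * G s) $$ (i,j)) \<le> (\<Sum>k<n. C * D)"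
      unfolding e
    proof (intro order_trans[OF norm_sum] sum_mono)
      fix k assume "k \<in> {..<n}"
      hence k: "cmod (F s $$ (i,k)) \<le> C" "cmod (G s $$ (k,j)) \<le> D" using C[OF s] D[OF s] ij by auto
      thus "cmod (F s $$ (i,k) * G s $$ (k,j)) \<le> C * D"
        unfolding norm_mult using order_trans[OF norm_ge_zero k(1)] by (intro mult_mono) auto
    qed
  qed
qed

lemma bhol_superop:
  assumes F: "bhol n F" and L: "superop n L"
  shows "bhol n (\<lambda>s. L (F s))"
proof (rule bhol_combination)
  have d: "dim_row (F s) = n" "dim_col (F s) = n" for s
    by (simp_all add: bholD[OF F])
  show "dim_row (L (F s)) = n \<and> dim_col (L (F s)) = n" for s using superop_dim[OF L d] by simp
  fix i j assume ij: "i < n" "j < n"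
  note e = superop_entry[OF L d ij]
  show "(\<lambda>s. L (F s) $$ (i,j)) holomorphic_on UNIV"
    unfolding e by (intro holomorphic_intros bholD(3)[OF F]) auto
  obtain C where C: "\<And>s i j. 0 \<le> Re s \<Longrightarrow> Re s \<le> 1 \<Longrightarrow> i < n \<Longrightarrow> j < n \<Longrightarrow> cmod (F s $$ (i,j)) \<le> C"
    by (rule bhol_bound[OF F]) blast
  show "\<exists>C. \<forall>s. 0 \<le> Re s \<longrightarrow> Re s \<le> 1 \<longrightarrow> cmod (L (F s) $$ (i,j)) \<le> C"
  proof (intro exI allI impI)
    fix s assume s: "0 \<le> Re s" "Re s \<le> 1"
    show "cmod (L (F s) $$ (i,j)) \<le> (\<Sum>k<n. \<Sum>l<n. C * cmod (L (munit n k l) $$ (i,j)))"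
      unfolding e
    proof (intro order_trans[OF norm_sum] sum_mono)
      fix k l assume "k \<in> {..<n}" "l \<in> {..<n}"
      thus "cmod (F s $$ (k,l) * L (munit n k l) $$ (i,j)) \<le> C * cmod (L (munit n k l) $$ (i,j))"
        unfolding norm_mult using C[OF s] by (intro mult_right_mono) auto
    qed
  qed
qed

lemma bhol_three_lines:
  assumes F: "bhol n F"
    and left: "\<And>y. cmod (mtrace (F (Complex 0 y))) \<le> M" and right: "\<And>y. cmod (mtrace (F (Complex 1 y))) \<le> M"
    and s: "0 \<le> Re s" "Re s \<le> 1"
  shows "cmod (mtrace (F s)) \<le> M"
proof -
  have d: "dim_row (F s) = n" "dim_col (F s) = n" for s
    by (simp_all add: bholD[OF F])
  obtain C where C: "\<And>s i j. 0 \<le> Re s \<Longrightarrow> Re s \<le> 1 \<Longrightarrow> i < n \<Longrightarrow> j < n \<Longrightarrow> cmod (F s $$ (i,j)) \<le> C"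
    by (rule bhol_bound[OF F]) blast
  show ?thesis
  proof (rule three_lines[OF _ _ left right s])
    show "(\<lambda>s. mtrace (F s)) holomorphic_on UNIV"
      unfolding mtrace_def d by (intro holomorphic_intros bholD(3)[OF F]) auto
    show "cmod (mtrace (F z)) \<le> (\<Sum>i<n. C)" if "0 \<le> Re z" "Re z \<le> 1" for z
      unfolding mtrace_def d using C[OF that] by (intro order_trans[OF norm_sum] sum_mono) auto
  qed
qed

text \<open>Entrywise complex derivative at one point, with the dimensions included so that the
  product rule composes without side conditions.\<close>

definition mder :: "nat \<Rightarrow> (complex \<Rightarrow> complex mat) \<Rightarrow> complex mat \<Rightarrow> complex \<Rightarrow> bool" where
  "mder n F D z \<longleftrightarrow> (\<forall>s. dim_row (F s) = n \<and> dim_col (F s) = n) \<and> dim_row D = n \<and> dim_col D = n \<and>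
     (\<forall>i<n. \<forall>j<n. ((\<lambda>s. F s $$ (i,j)) has_field_derivative D $$ (i,j)) (at z))"

lemma mder_cpw:
  assumes "pos_def A" "dim_row A = n"
  shows "mder n (\<lambda>s. cpw A (a * s + b)) (a \<cdot>\<^sub>m (cpw A (a * z + b) * mlog A)) z"
  unfolding mder_def
proof (intro conjI allI impI)
  obtain c d where d: "\<And>i. d i > (0::real)"
    and e: "\<And>f i j. i < n \<Longrightarrow> j < n \<Longrightarrow> cfun f A $$ (i,j) = (\<Sum>l<n. c i j l * f (d l))"
    using cfun_entry[OF assms] by metis
  have m: "a \<cdot>\<^sub>m (cpw A (a * z + b) * mlog A) = cfun (\<lambda>x. a * (exp ((a * z + b) * complex_of_real (ln x)) * complex_of_real (ln x))) A"
    unfolding cpw_def mlog_cfun cfun_mult[OF assms(1)] by (rule cfun_smult[OF assms(1), symmetric])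
  fix i j assume ij: "i < n" "j < n"
  have e': "cpw A (a * s + b) $$ (i,j) = (\<Sum>l<n. c i j l * exp ((a * s + b) * complex_of_real (ln (d l))))" for s
    unfolding cpw_def by (rule e[OF ij])
  show "((\<lambda>s. cpw A (a * s + b) $$ (i,j)) has_field_derivative (a \<cdot>\<^sub>m (cpw A (a * z + b) * mlog A)) $$ (i,j)) (at z)"
    unfolding e' m e[OF ij]
    by (rule DERIV_sum) (auto intro!: derivative_eq_intros simp: algebra_simps)
qed (use assms in auto)

lemma mder_mult:
  assumes "mder n F D z" "mder n G E z"
  shows "mder n (\<lambda>s. F s * G s) (D * G z + F z * E) z"
proof -
  have d: "dim_row (F s) = n" "dim_col (F s) = n" "dim_row (G s) = n" "dim_col (G s) = n"
     "dim_row D = n" "dim_col D = n" "dim_row E = n" "dim_col E = n" for s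
    using assms by (auto simp: mder_def)
  show ?thesis unfolding mder_def
  proof (intro conjI allI impI)
    fix i j assume ij: "i < n" "j < n"
    have e: "(F s * G s) $$ (i,j) = (\<Sum>k<n. F s $$ (i,k) * G s $$ (k,j))" for s
      using ij by (simp add: mult_entry d del: index_mult_mat(1))
    have e2: "(D * G z + F z * E) $$ (i,j) = (\<Sum>k<n. D $$ (i,k) * G z $$ (k,j) + F z $$ (i,k) * E $$ (k,j))"
      using ij by (simp add: mult_entry d sum.distrib del: index_mult_mat(1))
    show "((\<lambda>s. (F s * G s) $$ (i,j)) has_field_derivative (D * G z + F z * E) $$ (i,j)) (at z)"
      unfolding e e2
    proof (rule DERIV_sum)
      fix k assume "k \<in> {..<n}"
      hence "((\<lambda>s. F s $$ (i,k)) has_field_derivative D $$ (i,k)) (at z)"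
        "((\<lambda>s. G s $$ (k,j)) has_field_derivative E $$ (k,j)) (at z)"
        using assms ij by (auto simp: mder_def)
      from DERIV_mult[OF this]
      show "((\<lambda>s. F s $$ (i,k) * G s $$ (k,j)) has_field_derivative D $$ (i,k) * G z $$ (k,j) + F z $$ (i,k) * E $$ (k,j)) (at z)"
        by (simp add: algebra_simps)
    qed
  qed (auto simp: d)
qed

lemma mder_superop:
  assumes F: "mder n F D z" and L: "superop n L"
  shows "mder n (\<lambda>s. L (F s)) (L D) z"
proof -
  have d: "dim_row (F s) = n" "dim_col (F s) = n" "dim_row D = n" "dim_col D = n" for s
    using F by (auto simp: mder_def)
  show ?thesis unfolding mder_def
  proof (intro conjI allI impI)
    fix i j assume ij: "i < n" "j < n"
    show "((\<lambda>s. L (F s) $$ (i,j)) has_field_derivative L D $$ (i,j)) (at z)"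
      unfolding superop_entry[OF L d(1,2) ij] superop_entry[OF L d(3,4) ij]
      by (intro DERIV_sum DERIV_cmult_right) (use F in \<open>auto simp: mder_def\<close>)
  qed (use superop_dim[OF L] d in auto)
qed

lemma mder_mtrace:
  assumes "mder n F D (complex_of_real t)"
  shows "((\<lambda>t. Re (mtrace (F (complex_of_real t)))) has_real_derivative Re (mtrace D)) (at t)"
proof -
  have d: "dim_row (F s) = n" "dim_row D = n" for s
    using assms by (auto simp: mder_def)
  have "((\<lambda>s. mtrace (F s)) has_field_derivative mtrace D) (at (complex_of_real t))"
    unfolding mtrace_def d using assms by (intro DERIV_sum) (auto simp: mder_def)
  hence "((\<lambda>t. mtrace (F (complex_of_real t))) has_vector_derivative mtrace D) (at t)"
    by (rule has_vector_derivative_real_field)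
  from bounded_linear.has_vector_derivative[OF bounded_linear_Re this]
  show ?thesis by (simp add: has_real_derivative_iff_has_vector_derivative)
qed

text \<open>A maximum over a one-sided unit interval is enough: the strip provides bounds on [0,1]
  only, and the semigroup provides them for nonnegative times only.\<close>

lemma deriv_nonpos_at_max:
  assumes "(f has_real_derivative D) (at a)" "\<And>t. a < t \<Longrightarrow> t \<le> a + 1 \<Longrightarrow> f t \<le> f a"
  shows "D \<le> 0"
proof (rule ccontr)
  assume "\<not> ?thesis"
  then obtain e where e: "e > 0" "\<And>h. 0 < h \<Longrightarrow> h < e \<Longrightarrow> f a < f (a + h)"
    using DERIV_pos_inc_right[OF assms(1)] by auto
  define h where "h = min (e/2) 1"
  have "0 < h" "h < e" "h \<le> 1" using e by (auto simp: h_def)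
  thus False using e(2)[of h] assms(2)[of "a + h"] by auto
qed

lemma deriv_nonneg_at_max:
  assumes "(f has_real_derivative D) (at a)" "\<And>t. a - 1 \<le> t \<Longrightarrow> t < a \<Longrightarrow> f t \<le> f a"
  shows "D \<ge> 0"
proof (rule ccontr)
  assume "\<not> ?thesis"
  then obtain e where e: "e > 0" "\<And>h. 0 < h \<Longrightarrow> h < e \<Longrightarrow> f a < f (a - h)"
    using DERIV_neg_dec_left[OF assms(1)] by auto
  define h where "h = min (e/2) 1"
  have "0 < h" "h < e" "h \<le> 1" using e by (auto simp: h_def)
  thus False using e(2)[of h] assms(2)[of "a - h"] by auto
qed

lemma Complex_arith:
  "Complex a b + Complex c d = Complex (a + c) (b + d)" "2 * Complex a b = Complex (2 * a) (2 * b)"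
  "1 + Complex a b = Complex (1 + a) b" "Complex 1 0 = 1" "Complex 0 0 = 0"
  by (auto simp: complex_eq_iff)

lemma mtrace_adj_mult_sum:
  assumes "dim_row A = n" "dim_col A = n" "dim_row B = n" "dim_col B = n"
  shows "mtrace (adj A * B) = (\<Sum>i<n. \<Sum>j<n. cnj (A $$ (j,i)) * B $$ (j,i))"
  using assms by (simp add: mtrace_mult_sum[where n=n])

text \<open>The additive form follows entrywise from \<open>2 x y \<le> x^2 + y^2\<close>. It loses
  nothing where it is applied, since both squares have the same trace there.\<close>

lemma trace_cauchy_schwarz:
  assumes "dim_row A = n" "dim_col A = n" "dim_row B = n" "dim_col B = n"
  shows "cmod (mtrace (adj A * B)) \<le> (Re (mtrace (adj A * A)) + Re (mtrace (adj B * B))) / 2"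
proof -
  have sq: "Re (mtrace (adj C * C)) = (\<Sum>i<n. \<Sum>j<n. (cmod (C $$ (j,i)))\<^sup>2)"
    if "dim_row C = n" "dim_col C = n" for C
  proof -
    have "mtrace (adj C * C) = (\<Sum>i<n. \<Sum>j<n. complex_of_real ((cmod (C $$ (j,i)))\<^sup>2))"
      unfolding mtrace_adj_mult_sum[OF that that] complex_norm_square by (simp add: mult.commute)
    thus ?thesis by simp
  qed
  have "cmod (mtrace (adj A * B)) \<le> (\<Sum>i<n. \<Sum>j<n. cmod (cnj (A $$ (j,i)) * B $$ (j,i)))"
    unfolding mtrace_adj_mult_sum[OF assms] by (intro order_trans[OF norm_sum] sum_mono order_trans[OF norm_sum]) auto
  also have "\<dots> \<le> (\<Sum>i<n. \<Sum>j<n. ((cmod (A $$ (j,i)))\<^sup>2 + (cmod (B $$ (j,i)))\<^sup>2) / 2)"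
  proof (intro sum_mono)
    fix i j
    show "cmod (cnj (A $$ (j,i)) * B $$ (j,i)) \<le> ((cmod (A $$ (j,i)))\<^sup>2 + (cmod (B $$ (j,i)))\<^sup>2) / 2"
      using sum_squares_bound[of "cmod (A $$ (j,i))" "cmod (B $$ (j,i))"] by (simp add: norm_mult)
  qed
  also have "\<dots> = (Re (mtrace (adj A * A)) + Re (mtrace (adj B * B))) / 2"
    using assms by (simp add: sq sum.distrib sum_divide_distrib[symmetric] add_divide_distrib[symmetric])
  finally show ?thesis .
qed

text \<open>Affine exponents with real coefficients; their real part stays bounded on the strip, and
  with it the powers.\<close>

abbreviation lin :: "real \<Rightarrow> real \<Rightarrow> complex \<Rightarrow> complex" where
  "lin a b s \<equiv> complex_of_real a * s + complex_of_real b"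

text \<open>Strong subadditivity is the case \<open>R1 = \<rho>_A1 \<otimes> 1\<close>, \<open>R2 = \<rho>_A2 \<otimes> 1\<close>, \<open>RA = \<rho>_A \<otimes> 1\<close>. The inequality is the sign
  of the derivative at 0 of a function which is bounded on the strip by its value at 0.\<close>

theorem trace_log_inequality:
  assumes pd: "pos_def \<rho>" "pos_def R1" "pos_def R2" "pos_def RA"
    and n: "dim_row \<rho> = n" "dim_row R1 = n" "dim_row R2 = n" "dim_row RA = n"
    and H: "\<And>y. mtrace (R1 * (cpw RA (Complex (-1/2) y) * (R2 * cpw RA (Complex (-1/2) (-y))))) = mtrace \<rho>"
  shows "Re (mtrace (\<rho> * mlog R1)) + Re (mtrace (\<rho> * mlog R2))
    \<le> Re (mtrace (\<rho> * mlog \<rho>)) + Re (mtrace (\<rho> * mlog RA))"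
proof -
  note pdim = pd[THEN pos_def_dim]
  note D [simp] = n pdim[unfolded n] cpw_dim[OF pd(1)] cpw_dim[OF pd(2)] cpw_dim[OF pd(3)] cpw_dim[OF pd(4)]
    mlog_dim[OF pd(1)] mlog_dim[OF pd(2)] mlog_dim[OF pd(3)] mlog_dim[OF pd(4)]
  note C0 = pd[THEN cpw_0, unfolded n]
  note C1 = pd[THEN cpw_1]
  note CM = pd[THEN cpw_mult] pd[THEN cpw_mult_assoc, unfolded n]
  note CA = pd[THEN adj_cpw]
  \<comment> \<open>The powers of \<open>R1\<close> and \<open>RA\<close> are split symmetrically
    around \<open>R2\<close>, so that on the edge \<open>Re s = 1\<close> the product falls into two
    similar halves.\<close>
  define F where "F s = cpw \<rho> (lin (-1) 1 s) * (cpw R1 (lin (1/2) 0 s) *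
      (cpw RA (lin (-1/2) 0 s) * (cpw R2 (lin 1 0 s) *
      (cpw RA (lin (-1/2) 0 s) * cpw R1 (lin (1/2) 0 s)))))" for s
  have bF: "bhol n F" unfolding F_def by (intro bhol_mult bhol_cpw pd n)
  have left: "cmod (mtrace (F (Complex 0 y))) \<le> Re (mtrace \<rho>)" for y
  proof -
    \<comment> \<open>For \<open>Re s = 0\<close> all exponents except that of \<open>\<rho>\<close>
      are imaginary, so \<open>V\<close> is unitary. Splitting \<open>\<rho>^(1 - iy)\<close> as
      \<open>\<rho>^(1/2) \<rho>^(1/2 - iy)\<close> leaves two factors whose squares have trace
      \<open>mtrace \<rho>\<close>.\<close>
    define V where "V = cpw R1 (Complex 0 (y/2)) * (cpw RA (Complex 0 (-y/2)) * (cpw R2 (Complex 0 y) *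
      (cpw RA (Complex 0 (-y/2)) * cpw R1 (Complex 0 (y/2)))))"
    have dV [simp]: "dim_row V = n" "dim_col V = n" by (auto simp: V_def)
    have ex: "lin (-1) 1 (Complex 0 y) = Complex 1 (-y)"
      "lin (1/2) 0 (Complex 0 y) = Complex 0 (y/2)"
      "lin (-1/2) 0 (Complex 0 y) = Complex 0 (-y/2)"
      "lin 1 0 (Complex 0 y) = Complex 0 y"
      by (auto simp: complex_eq_iff)
    have FV: "F (Complex 0 y) = cpw \<rho> (Complex 1 (-y)) * V"
      unfolding F_def V_def ex ..
    have z: "Complex 0 a + Complex 0 b = 0" if "a + b = 0" for a b using that by (auto simp: complex_eq_iff)
    have VV: "V * adj V = 1\<^sub>m n"
      by (simp add: V_def adj_mult CA complex_cnj mat_assoc CM z Complex_arith C0 mat_one_left mat_one_right)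
    have A: "mtrace (adj (cpw \<rho> (Complex (1/2) 0)) * cpw \<rho> (Complex (1/2) 0)) = mtrace \<rho>"
      by (simp add: CA complex_cnj CM Complex_arith C1)
    have B: "mtrace (adj (cpw \<rho> (Complex (1/2) (-y)) * V) * (cpw \<rho> (Complex (1/2) (-y)) * V)) = mtrace \<rho>"
    proof -
      have "mtrace (adj (cpw \<rho> (Complex (1/2) (-y)) * V) * (cpw \<rho> (Complex (1/2) (-y)) * V)) = mtrace (adj V * (\<rho> * V))"
        by (simp add: adj_mult CA complex_cnj mat_assoc CM Complex_arith C1)
      also have "\<dots> = mtrace (\<rho> * V * adj V)" by (rule mtrace_cyc) auto
      also have "\<dots> = mtrace \<rho>" by (simp add: mat_assoc VV mat_one_right)
      finally show ?thesis .
    qed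
    have "adj (cpw \<rho> (Complex (1/2) 0)) * (cpw \<rho> (Complex (1/2) (-y)) * V) = F (Complex 0 y)"
      unfolding FV by (simp add: CA complex_cnj CM Complex_arith)
    thus ?thesis using trace_cauchy_schwarz[of "cpw \<rho> (Complex (1/2) 0)" n "cpw \<rho> (Complex (1/2) (-y)) * V"] A B by simp
  qed
  have right: "cmod (mtrace (F (Complex 1 y))) \<le> Re (mtrace \<rho>)" for y
  proof -
    \<comment> \<open>For \<open>Re s = 1\<close> the power of \<open>\<rho>\<close> is unitary, and
      \<open>R2\<close> is divided equally between \<open>T\<close> and \<open>S\<close>. After
      cyclic rotation the two squares are the trace in \<open>H\<close> at \<open>-y/2\<close> and
      at \<open>y/2\<close>.\<close>
    define T where "T = cpw R1 (Complex (1/2) (y/2)) * (cpw RA (Complex (-1/2) (-y/2)) * cpw R2 (Complex (1/2) (y/2)))"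
    define S where "S = cpw R2 (Complex (1/2) (y/2)) * (cpw RA (Complex (-1/2) (-y/2)) * cpw R1 (Complex (1/2) (y/2)))"
    have dT [simp]: "dim_row T = n" "dim_col T = n" "dim_row S = n" "dim_col S = n" by (auto simp: T_def S_def)
    have ex: "lin (-1) 1 (Complex 1 y) = Complex 0 (-y)"
      "lin (1/2) 0 (Complex 1 y) = Complex (1/2) (y/2)"
      "lin (-1/2) 0 (Complex 1 y) = Complex (-1/2) (-y/2)"
      "lin 1 0 (Complex 1 y) = Complex 1 y"
      by (auto simp: complex_eq_iff)
    have FV: "F (Complex 1 y) = cpw \<rho> (Complex 0 (-y)) * (T * S)"
      unfolding F_def T_def S_def ex by (simp add: mat_assoc CM Complex_arith)
    define A where "A = adj T * cpw \<rho> (Complex 0 y)"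
    have dA [simp]: "dim_row A = n" "dim_col A = n" by (auto simp: A_def)
    have FA: "F (Complex 1 y) = adj A * S" unfolding FV A_def by (simp add: adj_mult CA complex_cnj mat_assoc Complex_arith)
    have "mtrace (adj A * A) = mtrace (cpw \<rho> (Complex 0 (-y)) * (T * adj T * cpw \<rho> (Complex 0 y)))"
      by (simp add: A_def adj_mult CA complex_cnj mat_assoc Complex_arith)
    also have "\<dots> = mtrace (T * adj T * cpw \<rho> (Complex 0 y) * cpw \<rho> (Complex 0 (-y)))"
      by (rule mtrace_cyc) auto
    also have "\<dots> = mtrace (T * adj T)" by (simp add: mat_assoc CM Complex_arith C0 mat_one_right)
    also have "\<dots> = mtrace (cpw R1 (Complex (1/2) (y/2)) * (cpw RA (Complex (-1/2) (-y/2)) * (R2 * (cpw RA (Complex (-1/2) (y/2)) * cpw R1 (Complex (1/2) (-y/2))))))"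
      by (simp add: T_def adj_mult CA complex_cnj mat_assoc CM Complex_arith C1)
    also have "\<dots> = mtrace (cpw RA (Complex (-1/2) (-y/2)) * (R2 * (cpw RA (Complex (-1/2) (y/2)) * cpw R1 (Complex (1/2) (-y/2)))) * cpw R1 (Complex (1/2) (y/2)))"
      by (rule mtrace_cyc) auto
    also have "\<dots> = mtrace (cpw RA (Complex (-1/2) (-y/2)) * (R2 * cpw RA (Complex (-1/2) (y/2))) * R1)"
      by (simp add: mat_assoc CM Complex_arith C1)
    also have "\<dots> = mtrace (R1 * (cpw RA (Complex (-1/2) (-y/2)) * (R2 * cpw RA (Complex (-1/2) (y/2)))))"
      by (rule mtrace_cyc) auto
    also have "\<dots> = mtrace \<rho>" using H[of "-y/2"] by simp
    finally have 1: "mtrace (adj A * A) = mtrace \<rho>" .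
    have "mtrace (adj S * S) = mtrace (cpw R1 (Complex (1/2) (-y/2)) * (cpw RA (Complex (-1/2) (y/2)) * (R2 * (cpw RA (Complex (-1/2) (-y/2)) * cpw R1 (Complex (1/2) (y/2))))))"
      by (simp add: S_def adj_mult CA complex_cnj mat_assoc CM Complex_arith C1)
    also have "\<dots> = mtrace (cpw RA (Complex (-1/2) (y/2)) * (R2 * (cpw RA (Complex (-1/2) (-y/2)) * cpw R1 (Complex (1/2) (y/2)))) * cpw R1 (Complex (1/2) (-y/2)))"
      by (rule mtrace_cyc) auto
    also have "\<dots> = mtrace (cpw RA (Complex (-1/2) (y/2)) * (R2 * cpw RA (Complex (-1/2) (-y/2))) * R1)"
      by (simp add: mat_assoc CM Complex_arith C1)
    also have "\<dots> = mtrace (R1 * (cpw RA (Complex (-1/2) (y/2)) * (R2 * cpw RA (Complex (-1/2) (-y/2)))))"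
      by (rule mtrace_cyc) auto
    also have "\<dots> = mtrace \<rho>" using H[of "y/2"] by simp
    finally have 2: "mtrace (adj S * S) = mtrace \<rho>" .
    show ?thesis unfolding FA using trace_cauchy_schwarz[of A n S] 1 2 by simp
  qed
  have F0: "F 0 = \<rho>" unfolding F_def by (simp add: C0 C1 mat_one_right)
  \<comment> \<open>The product rule at 0: all factors except \<open>\<rho>\<close> are the identity
    there, so only logarithms remain, and the halves add up to
    \<open>mlog R1 - mlog RA + mlog R2\<close>.\<close>
  define E where "E = (-1) \<cdot>\<^sub>m (\<rho> * mlog \<rho>) + \<rho> * ((1/2) \<cdot>\<^sub>m mlog R1 + ((-1/2) \<cdot>\<^sub>m mlog RA + (mlog R2 + ((-1/2) \<cdot>\<^sub>m mlog RA + (1/2) \<cdot>\<^sub>m mlog R1))))"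
  have "mder n F E 0"
  proof -
    have one: "1 \<cdot>\<^sub>m M = M" for M :: "complex mat" by (rule eq_matI) auto
    note m = mder_cpw[where z=0]
    have d1: "mder n (\<lambda>s. cpw R1 (lin (1/2) 0 s)) ((1/2) \<cdot>\<^sub>m mlog R1) 0"
      and dA: "mder n (\<lambda>s. cpw RA (lin (-1/2) 0 s)) ((-1/2) \<cdot>\<^sub>m mlog RA) 0"
      and d2: "mder n (\<lambda>s. cpw R2 (lin 1 0 s)) (mlog R2) 0"
      and d0: "mder n (\<lambda>s. cpw \<rho> (lin (-1) 1 s)) ((-1) \<cdot>\<^sub>m (\<rho> * mlog \<rho>)) 0"
      using m[OF pd(2) n(2), of "complex_of_real (1/2)" "complex_of_real 0"] m[OF pd(4) n(4), of "complex_of_real (-1/2)" "complex_of_real 0"]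
        m[OF pd(3) n(3), of "complex_of_real 1" "complex_of_real 0"] m[OF pd(1) n(1), of "complex_of_real (-1)" "complex_of_real 1"]
      by (simp_all add: C0 C1 mat_one_left one)
    show ?thesis
      using mder_mult[OF d0 mder_mult[OF d1 mder_mult[OF dA mder_mult[OF d2 mder_mult[OF dA d1]]]]]
      unfolding F_def[abs_def] E_def by (simp add: C0 C1 mat_one_left mat_one_right)
  qed
  hence "((\<lambda>t. Re (mtrace (F (complex_of_real t)))) has_real_derivative Re (mtrace E)) (at 0)"
    using mder_mtrace[of n F E 0] by simp
  \<comment> \<open>The bound on the strip is \<open>Re (mtrace \<rho>)\<close>, which is the value
    at 0.\<close>
  moreover have "Re (mtrace (F (complex_of_real t))) \<le> Re (mtrace (F (complex_of_real 0)))" if "0 < t" "t \<le> 0 + 1" for t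
    using bhol_three_lines[OF bF left right, of "complex_of_real t"] that F0 complex_Re_le_cmod[of "mtrace (F (complex_of_real t))"] by simp
  ultimately have "Re (mtrace E) \<le> 0" by (rule deriv_nonpos_at_max)
  thus ?thesis unfolding E_def
    by (simp add: mtrace_add mat_distrib_left mat_smult_right mtrace_smult)
qed

section \<open>Contractivity of unital completely positive maps\<close>

text \<open>Positivity of the amplification to 2 x 2 blocks, the level at which a Cauchy-Schwarz
  inequality for \<open>P\<close> lives.\<close>

definition two_positive :: "nat \<Rightarrow> (complex mat \<Rightarrow> complex mat) \<Rightarrow> bool" where
  "two_positive n P \<longleftrightarrow> (\<forall>X. dim_row X = 2 * n \<longrightarrow> dim_col X = 2 * n \<longrightarrow> psd X \<longrightarrow> psd (ampl 2 n P X))"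

lemma psd_mult_adj: "psd (C * adj C)"
proof -
  have "hermitian (C * 1\<^sub>m (dim_col C) * adj C)"
    by (rule hermitian_conj) (auto simp: hermitian_def)
  moreover have "Re (qf (C * adj C) f) \<ge> 0" for f
    using qf_conj[of "adj C" "1\<^sub>m (dim_col C)" f] pos_def_psd[OF pos_def_one]
    by (simp add: psd_iff mat_one_right)
  ultimately show ?thesis by (simp add: psd_iff mat_one_right)
qed

text \<open>Stacking \<open>G\<close> on \<open>adj H\<close> and multiplying by the adjoint gives a
  positive block matrix with blocks \<open>G * adj G\<close>, \<open>G * H\<close> and
  \<open>adj H * H\<close>. Its image is positive; testing it on vectors built from
  \<open>K2\<close> and \<open>K1\<close> and summing yields the bound.\<close>

lemma two_positive_trace_bound:
  assumes L: "superop n P" and P: "two_positive n P"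
    and d [simp]: "dim_row G = n" "dim_col G = n" "dim_row H = n" "dim_col H = n"
      "dim_row K1 = n" "dim_col K1 = n" "dim_row K2 = n" "dim_col K2 = n"
  shows "cmod (mtrace (K2 * P (G * H) * K1)) \<le>
    (Re (mtrace (K2 * P (G * adj G) * adj K2)) + Re (mtrace (adj K1 * P (adj H * H) * K1))) / 2"
proof -
  define C where "C = mat (2 * n) n (\<lambda>(i,j). if i < n then G $$ (i,j) else adj H $$ (i - n, j))"
  define X where "X = C * adj C"
  have dC [simp]: "dim_row C = 2 * n" "dim_col C = n" by (auto simp: C_def)
  have dX [simp]: "dim_row X = 2 * n" "dim_col X = 2 * n" by (auto simp: X_def)
  have b: "blk n X 0 0 = G * adj G" "blk n X 0 1 = G * H" "blk n X 1 1 = adj H * H"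
    by (rule eq_matI; auto simp: X_def mult_entry C_def simp del: index_mult_mat(1) intro!: sum.cong)+
  define M where "M = ampl 2 n P X"
  have psdM: "psd M" using P psd_mult_adj[of C] unfolding two_positive_def M_def X_def by simp
  hence hM: "hermitian M" by (simp add: psd_iff)
  have dM [simp]: "dim_row M = 2 * n" "dim_col M = 2 * n" by (auto simp: M_def)
  have dP: "dim_row (P Y) = n" "dim_col (P Y) = n" if "dim_row Y = n" "dim_col Y = n" for Y
    using superop_dim[OF L that] by auto
  have M00: "M $$ (r,s) = P (G * adj G) $$ (r,s)" and M01: "M $$ (r, n + s) = P (G * H) $$ (r,s)"
    and M11: "M $$ (n + r, n + s) = P (adj H * H) $$ (r,s)" if "r < n" "s < n" for r s
    using ampl_idx[of 0 2 0 r n s P X] ampl_idx[of 0 2 1 r n s P X] ampl_idx[of 1 2 1 r n s P X] that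
    by (auto simp: M_def b simp del: One_nat_def)
  have M10: "M $$ (n + r, s) = cnj (P (G * H) $$ (s,r))" if "r < n" "s < n" for r s
    using hermitian_entry[OF hM, of "n + r" s] M01[of s r] that by simp
  let ?a = "mtrace (K2 * P (G * adj G) * adj K2)" and ?c = "mtrace (adj K1 * P (adj H * H) * K1)"
    and ?b = "mtrace (K2 * P (G * H) * K1)"
  have tr3: "mtrace (A * B * C) = (\<Sum>l<n. \<Sum>r<n. \<Sum>s<n. A $$ (l,r) * B $$ (r,s) * C $$ (s,l))"
    if "dim_row A = n" "dim_col A = n" "dim_row B = n" "dim_col B = n" "dim_row C = n" "dim_col C = n" for A B C
  proof -
    have "mtrace (A * B * C) = (\<Sum>l<n. \<Sum>s<n. \<Sum>r<n. A $$ (l,r) * B $$ (r,s) * C $$ (s,l))"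
      using that by (simp add: mtrace_mult_sum[where n=n] mult_entry sum_distrib_right del: index_mult_mat(1))
    also have "\<dots> = (\<Sum>l<n. \<Sum>r<n. \<Sum>s<n. A $$ (l,r) * B $$ (r,s) * C $$ (s,l))"
      by (intro sum.cong refl sum.swap)
    finally show ?thesis .
  qed
  have main: "0 \<le> Re ?a + 2 * Re (w * ?b) + Re ?c" if w: "cmod w = 1" for w
  proof -
    \<comment> \<open>Conjugated row \<open>l\<close> of \<open>K2\<close> above \<open>w\<close>
      times column \<open>l\<close> of \<open>K1\<close>: summing the forms over \<open>l\<close>
      assembles the traces, with \<open>w\<close> multiplying only the off-diagonal one.\<close>
    define f where "f l i = (if i < n then cnj (K2 $$ (l,i)) else w * K1 $$ (i - n, l))" for l i
    have f: "f l r = cnj (K2 $$ (l,r))" "f l (n + r) = w * K1 $$ (r,l)" if "r < n" for l r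
      using that by (auto simp: f_def)
    have ww: "cnj w * w = 1" using w by (simp add: complex_norm_square[symmetric] mult.commute)
    have split: "(\<Sum>i<2*n. h i) = (\<Sum>r<n. h r) + (\<Sum>r<n. h (n + r))" for h :: "nat \<Rightarrow> complex"
      using sum_idx[of h 2 n] by (simp add: numeral_2_eq_2)
    have "(\<Sum>l<n. qf M (f l)) = (\<Sum>l<n. (\<Sum>r<n. \<Sum>s<n. K2 $$ (l,r) * P (G * adj G) $$ (r,s) * adj K2 $$ (s,l))
        + (\<Sum>r<n. \<Sum>s<n. w * (K2 $$ (l,r) * P (G * H) $$ (r,s) * K1 $$ (s,l)))
        + (\<Sum>r<n. \<Sum>s<n. cnj (w * (K2 $$ (l,s) * P (G * H) $$ (s,r) * K1 $$ (r,l))))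
        + (\<Sum>r<n. \<Sum>s<n. adj K1 $$ (l,r) * P (adj H * H) $$ (r,s) * K1 $$ (s,l)))"
    proof (rule sum.cong[OF refl])
      fix l assume l: "l \<in> {..<n}"
      have "qf M (f l) = (\<Sum>r<n. (\<Sum>s<n. cnj (f l r) * M $$ (r,s) * f l s) + (\<Sum>s<n. cnj (f l r) * M $$ (r,n+s) * f l (n+s)))
         + (\<Sum>r<n. (\<Sum>s<n. cnj (f l (n+r)) * M $$ (n+r,s) * f l s) + (\<Sum>s<n. cnj (f l (n+r)) * M $$ (n+r,n+s) * f l (n+s)))"
        by (simp add: qf_def split)
      also have "(\<Sum>r<n. (\<Sum>s<n. cnj (f l r) * M $$ (r,s) * f l s) + (\<Sum>s<n. cnj (f l r) * M $$ (r,n+s) * f l (n+s)))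
         = (\<Sum>r<n. \<Sum>s<n. K2 $$ (l,r) * P (G * adj G) $$ (r,s) * adj K2 $$ (s,l))
        + (\<Sum>r<n. \<Sum>s<n. w * (K2 $$ (l,r) * P (G * H) $$ (r,s) * K1 $$ (s,l)))"
        unfolding sum.distrib using l by (intro arg_cong2[where f="(+)"] sum.cong refl) (simp_all add: f M00 M01)
      also have "(\<Sum>r<n. (\<Sum>s<n. cnj (f l (n+r)) * M $$ (n+r,s) * f l s) + (\<Sum>s<n. cnj (f l (n+r)) * M $$ (n+r,n+s) * f l (n+s)))
         = (\<Sum>r<n. \<Sum>s<n. cnj (w * (K2 $$ (l,s) * P (G * H) $$ (s,r) * K1 $$ (r,l))))
        + (\<Sum>r<n. \<Sum>s<n. (cnj w * w) * (adj K1 $$ (l,r) * P (adj H * H) $$ (r,s) * K1 $$ (s,l)))"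
        unfolding sum.distrib using l by (intro arg_cong2[where f="(+)"] sum.cong refl) (simp_all add: f M10 M11)
      finally show "qf M (f l) = (\<Sum>r<n. \<Sum>s<n. K2 $$ (l,r) * P (G * adj G) $$ (r,s) * adj K2 $$ (s,l))
        + (\<Sum>r<n. \<Sum>s<n. w * (K2 $$ (l,r) * P (G * H) $$ (r,s) * K1 $$ (s,l)))
        + (\<Sum>r<n. \<Sum>s<n. cnj (w * (K2 $$ (l,s) * P (G * H) $$ (s,r) * K1 $$ (r,l))))
        + (\<Sum>r<n. \<Sum>s<n. adj K1 $$ (l,r) * P (adj H * H) $$ (r,s) * K1 $$ (s,l))"
        unfolding ww by (simp add: add.assoc)
    qed
    also have "\<dots> = ?a + w * ?b + cnj (w * ?b) + ?c"
    proof -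
      have "(\<Sum>l<n. \<Sum>r<n. \<Sum>s<n. cnj (w * (K2 $$ (l,s) * P (G * H) $$ (s,r) * K1 $$ (r,l)))) =
         (\<Sum>l<n. \<Sum>s<n. \<Sum>r<n. cnj (w * (K2 $$ (l,s) * P (G * H) $$ (s,r) * K1 $$ (r,l))))"
        by (intro sum.cong refl sum.swap)
      thus ?thesis unfolding sum.distrib by (simp add: tr3 dP sum_distrib_left)
    qed
    finally have "Re (\<Sum>l<n. qf M (f l)) = Re ?a + 2 * Re (w * ?b) + Re ?c" by simp
    moreover have "Re (\<Sum>l<n. qf M (f l)) \<ge> 0" using psdM by (auto simp: psd_iff intro!: sum_nonneg)
    ultimately show ?thesis by simp
  qed
  show ?thesis
  proof (cases "?b = 0")
    case True
    thus ?thesis using main[of 1] by simp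
  next
    case False
    \<comment> \<open>The phase that turns the off-diagonal trace into minus its modulus.\<close>
    define w where "w = - cnj ?b / cmod ?b"
    have "cmod w = 1" using False by (simp add: w_def norm_divide)
    moreover have "w * ?b = - complex_of_real (cmod ?b)"
    proof -
      have "w * ?b = - (?b * cnj ?b) / cmod ?b" by (simp add: w_def)
      also have "\<dots> = - complex_of_real (cmod ?b)"
        using False unfolding complex_norm_square[symmetric] by (simp add: power2_eq_square)
      finally show ?thesis .
    qed
    ultimately show ?thesis using main[of w] by simp
  qed
qed

text \<open>At \<open>s = 1/q\<close> with \<open>R = Z^q\<close> the argument of \<open>P\<close>
  is \<open>\<Gamma>^(-1/q)(Z)\<close> and the power of \<open>R\<close> outside is
  \<open>Z^(q-1)\<close>, the ingredients of the Dirichlet form for \<open>q > 1\<close>.\<close>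

definition interp :: "(complex mat \<Rightarrow> complex mat) \<Rightarrow> complex mat \<Rightarrow> complex mat \<Rightarrow> complex \<Rightarrow> complex mat" where
  "interp P \<tau> R s = cpw \<tau> (lin (1/2) 0 s) * (cpw R (lin (-1) 1 s) *
     (cpw \<tau> (lin (1/2) 0 s) * P (cpw \<tau> (lin (-1/2) 0 s) *
      (cpw R (lin 1 0 s) * cpw \<tau> (lin (-1/2) 0 s)))))"

context
  fixes n :: nat and P :: "complex mat \<Rightarrow> complex mat" and \<tau> R :: "complex mat"
  assumes L: "superop n P" and P2: "two_positive n P" and P1: "P (1\<^sub>m n) = 1\<^sub>m n"
    and pd: "pos_def \<tau>" "pos_def R" and n: "dim_row \<tau> = n" "dim_row R = n"
    and inv: "\<And>Y. dim_row Y = n \<Longrightarrow> dim_col Y = n \<Longrightarrow> mtrace (\<tau> * P Y) = mtrace (\<tau> * Y)"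
begin

text \<open>Each edge is an instance of \<open>two_positive_trace_bound\<close> whose two squares
  have trace \<open>mtrace R\<close>: unitality of \<open>P\<close> evaluates them on the left edge,
  invariance of \<open>\<tau>\<close> on the right edge.\<close>

lemma interp_bound:
  assumes s: "0 \<le> Re s" "Re s \<le> 1"
  shows "cmod (mtrace (interp P \<tau> R s)) \<le> Re (mtrace R)"
proof -
  note pdim = pd[THEN pos_def_dim]
  note D [simp] = n pdim[unfolded n] cpw_dim[OF pd(1)] cpw_dim[OF pd(2)]
    mlog_dim[OF pd(1)] mlog_dim[OF pd(2)]
  note C0 = pd[THEN cpw_0, unfolded n]
  note C1 = pd[THEN cpw_1]
  note CM = pd[THEN cpw_mult] pd[THEN cpw_mult_assoc, unfolded n]
  note CA = pd[THEN adj_cpw]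
  note dP [simp] = superop_dim[OF L]
  show ?thesis
  proof (rule bhol_three_lines[OF _ _ _ s])
    show "bhol n (interp P \<tau> R)" unfolding interp_def by (intro bhol_mult bhol_superop[OF _ L] bhol_cpw pd n)
  next
    fix y
    have ex: "lin (-1) 1 (Complex 0 y) = Complex 1 (-y)"
      "lin (1/2) 0 (Complex 0 y) = Complex 0 (y/2)"
      "lin (-1/2) 0 (Complex 0 y) = Complex 0 (-y/2)"
      "lin 1 0 (Complex 0 y) = Complex 0 y"
      by (auto simp: complex_eq_iff)
    \<comment> \<open>The argument of \<open>P\<close> is unitary here. Writing it as
      \<open>1 * V\<close> makes both squares inside \<open>P\<close> equal to the identity, which
      \<open>P\<close> fixes.\<close>
    define V where "V = cpw \<tau> (Complex 0 (-y/2)) * (cpw R (Complex 0 y) * cpw \<tau> (Complex 0 (-y/2)))"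
    define K1 where "K1 = cpw \<tau> (Complex 0 (y/2)) * cpw R (Complex (1/2) (-y))"
    define K2 where "K2 = cpw R (Complex (1/2) 0) * cpw \<tau> (Complex 0 (y/2))"
    have dd [simp]: "dim_row V = n" "dim_col V = n" "dim_row K1 = n" "dim_col K1 = n" "dim_row K2 = n" "dim_col K2 = n"
      by (auto simp: V_def K1_def K2_def)
    have VV: "adj V * V = 1\<^sub>m n"
      by (simp add: V_def adj_mult CA complex_cnj mat_assoc CM Complex_arith C0 mat_one_left mat_one_right)
    have "interp P \<tau> R (Complex 0 y) = K1 * (K2 * P V)"
      unfolding interp_def ex K1_def K2_def V_def by (simp add: mat_assoc CM Complex_arith)
    hence "mtrace (interp P \<tau> R (Complex 0 y)) = mtrace (K2 * P V * K1)"
      using mtrace_cyc[of K1 "K2 * P V"] by simp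
    moreover have "cmod (mtrace (K2 * P (1\<^sub>m n * V) * K1)) \<le>
       (Re (mtrace (K2 * P (1\<^sub>m n * adj (1\<^sub>m n)) * adj K2)) + Re (mtrace (adj K1 * P (adj V * V) * K1))) / 2"
      by (rule two_positive_trace_bound[OF L P2]) auto
    moreover have "K2 * P (1\<^sub>m n * adj (1\<^sub>m n)) * adj K2 = R"
      by (simp add: mat_one_left mat_one_right P1)
        (simp add: K2_def adj_mult CA complex_cnj mat_assoc CM Complex_arith C0 C1 mat_one_left mat_one_right)
    moreover have "adj K1 * P (adj V * V) * K1 = R"
      unfolding VV P1
      by (simp add: mat_one_right)
        (simp add: K1_def adj_mult CA complex_cnj mat_assoc CM Complex_arith C0 C1 mat_one_left mat_one_right)
    ultimately show "cmod (mtrace (interp P \<tau> R (Complex 0 y))) \<le> Re (mtrace R)"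
      by (simp add: mat_one_left)
  next
    fix y
    have ex: "lin (-1) 1 (Complex 1 y) = Complex 0 (-y)"
      "lin (1/2) 0 (Complex 1 y) = Complex (1/2) (y/2)"
      "lin (-1/2) 0 (Complex 1 y) = Complex (-1/2) (-y/2)"
      "lin 1 0 (Complex 1 y) = Complex 1 y"
      by (auto simp: complex_eq_iff)
    \<comment> \<open>\<open>R\<close> is divided equally between \<open>G\<close> and
      \<open>H\<close>. In the squares the outer factors combine to \<open>\<tau>\<close>, so
      invariance removes \<open>P\<close> and the powers of \<open>\<tau>\<close> cancel around the
      trace.\<close>
    define G where "G = cpw \<tau> (Complex (-1/2) (-y/2)) * cpw R (Complex (1/2) y)"
    define H where "H = cpw R (Complex (1/2) 0) * cpw \<tau> (Complex (-1/2) (-y/2))"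
    define K1 where "K1 = cpw \<tau> (Complex (1/2) (y/2)) * cpw R (Complex 0 (-y))"
    define K2 where "K2 = cpw \<tau> (Complex (1/2) (y/2))"
    have dd [simp]: "dim_row G = n" "dim_col G = n" "dim_row H = n" "dim_col H = n" "dim_row K1 = n" "dim_col K1 = n" "dim_row K2 = n" "dim_col K2 = n"
      by (auto simp: G_def H_def K1_def K2_def)
    have "interp P \<tau> R (Complex 1 y) = K1 * (K2 * P (G * H))"
      unfolding interp_def ex K1_def K2_def G_def H_def by (simp add: mat_assoc CM Complex_arith)
    hence "mtrace (interp P \<tau> R (Complex 1 y)) = mtrace (K2 * P (G * H) * K1)"
      using mtrace_cyc[of K1 "K2 * P (G * H)"] by simp
    moreover have "cmod (mtrace (K2 * P (G * H) * K1)) \<le>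
       (Re (mtrace (K2 * P (G * adj G) * adj K2)) + Re (mtrace (adj K1 * P (adj H * H) * K1))) / 2"
      by (rule two_positive_trace_bound[OF L P2]) auto
    moreover have "mtrace (K2 * P (G * adj G) * adj K2) = mtrace R"
    proof -
      have "mtrace (K2 * P (G * adj G) * adj K2) = mtrace (K2 * (P (G * adj G) * adj K2))" by (simp add: mat_assoc)
      also have "\<dots> = mtrace (P (G * adj G) * adj K2 * K2)" by (rule mtrace_cyc) auto
      also have "\<dots> = mtrace (P (G * adj G) * \<tau>)"
        by (simp add: K2_def CA complex_cnj mat_assoc CM Complex_arith C1)
      also have "\<dots> = mtrace (\<tau> * P (G * adj G))" by (rule mtrace_cyc) auto
      also have "\<dots> = mtrace (\<tau> * (G * adj G))" by (rule inv) auto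
      also have "\<dots> = mtrace (cpw \<tau> 1 * (cpw \<tau> (Complex (-1/2) (-y/2)) * (R * cpw \<tau> (Complex (-1/2) (y/2)))))"
        unfolding C1 by (simp add: G_def adj_mult CA complex_cnj mat_assoc CM Complex_arith C1)
      also have "\<dots> = mtrace (cpw \<tau> (Complex (1/2) (-y/2)) * R * cpw \<tau> (Complex (-1/2) (y/2)))"
        by (simp add: mat_assoc CM Complex_arith)
      also have "\<dots> = mtrace (cpw \<tau> (Complex (-1/2) (y/2)) * (cpw \<tau> (Complex (1/2) (-y/2)) * R))" by (rule mtrace_cyc) auto
      also have "\<dots> = mtrace R" by (simp add: mat_assoc CM Complex_arith C0 mat_one_left)
      finally show ?thesis .
    qed
    moreover have "mtrace (adj K1 * P (adj H * H) * K1) = mtrace R"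
    proof -
      have "mtrace (adj K1 * P (adj H * H) * K1) = mtrace (K1 * (adj K1 * P (adj H * H)))" by (rule mtrace_cyc) auto
      also have "\<dots> = mtrace (\<tau> * P (adj H * H))"
        by (simp add: K1_def adj_mult CA complex_cnj mat_assoc CM Complex_arith C0 C1 mat_one_left mat_one_right)
      also have "\<dots> = mtrace (\<tau> * (adj H * H))" by (rule inv) auto
      also have "\<dots> = mtrace (cpw \<tau> 1 * (cpw \<tau> (Complex (-1/2) (y/2)) * (R * cpw \<tau> (Complex (-1/2) (-y/2)))))"
        unfolding C1 by (simp add: H_def adj_mult CA complex_cnj mat_assoc CM Complex_arith C1)
      also have "\<dots> = mtrace (cpw \<tau> (Complex (1/2) (y/2)) * R * cpw \<tau> (Complex (-1/2) (-y/2)))"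
        by (simp add: mat_assoc CM Complex_arith)
      also have "\<dots> = mtrace (cpw \<tau> (Complex (-1/2) (-y/2)) * (cpw \<tau> (Complex (1/2) (y/2)) * R))" by (rule mtrace_cyc) auto
      also have "\<dots> = mtrace R" by (simp add: mat_assoc CM Complex_arith C0 mat_one_left)
      finally show ?thesis .
    qed
    ultimately show "cmod (mtrace (interp P \<tau> R (Complex 1 y))) \<le> Re (mtrace R)" by simp
  qed
qed

text \<open>The trace of \<open>interp\<close> attains its bound at \<open>s = 1\<close>, so its
  derivative there is nonnegative. Rearranged, the conclusion says that
  \<open>mlog R - mlog \<tau>\<close> has no larger expectation in \<open>Q\<close> than in
  \<open>R\<close>; this is the estimate needed for \<open>q = 1\<close>.\<close>

lemma interp_log:
  defines "Q \<equiv> cpw \<tau> (1/2) * (P (cpw \<tau> (-1/2) * (R * cpw \<tau> (-1/2))) * cpw \<tau> (1/2))"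
  shows "Re (mtrace (R * mlog \<tau>)) - Re (mtrace (R * mlog R)) \<le> Re (mtrace (Q * mlog \<tau>)) - Re (mtrace (Q * mlog R))"
proof -
  note pdim = pd[THEN pos_def_dim]
  note D [simp] = n pdim[unfolded n] cpw_dim[OF pd(1)] cpw_dim[OF pd(2)]
    mlog_dim[OF pd(1)] mlog_dim[OF pd(2)]
  note C0 = pd[THEN cpw_0, unfolded n]
  note C1 = pd[THEN cpw_1]
  note CM = pd[THEN cpw_mult] pd[THEN cpw_mult_assoc, unfolded n]
  note dP [simp] = superop_dim[OF L]
  define Y where "Y = cpw \<tau> (-1/2) * (R * cpw \<tau> (-1/2))"
  have dY [simp]: "dim_row Y = n" "dim_col Y = n" by (auto simp: Y_def)
  \<comment> \<open>The derivative at 1 of the argument of \<open>P\<close>.\<close>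
  define G' where "G' = (-1/2) \<cdot>\<^sub>m (cpw \<tau> (-1/2) * mlog \<tau>) * (R * cpw \<tau> (-1/2)) + cpw \<tau> (-1/2) *
     (R * mlog R * cpw \<tau> (-1/2) + R * ((-1/2) \<cdot>\<^sub>m (cpw \<tau> (-1/2) * mlog \<tau>)))"
  have dG [simp]: "dim_row G' = n" "dim_col G' = n" by (auto simp: G'_def)
  define E where "E = (1/2) \<cdot>\<^sub>m (cpw \<tau> (1/2) * mlog \<tau>) * (cpw \<tau> (1/2) * P Y) + cpw \<tau> (1/2) *
     ((-1) \<cdot>\<^sub>m mlog R * (cpw \<tau> (1/2) * P Y) + ((1/2) \<cdot>\<^sub>m (cpw \<tau> (1/2) * mlog \<tau>) * P Y + cpw \<tau> (1/2) * P G'))"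
  have one: "1 \<cdot>\<^sub>m M = M" for M :: "complex mat" by (rule eq_matI) auto
  have d1: "mder n (\<lambda>s. cpw \<tau> (lin (1/2) 0 s)) ((1/2) \<cdot>\<^sub>m (cpw \<tau> (1/2) * mlog \<tau>)) 1"
    using mder_cpw[OF pd(1) n(1), of "complex_of_real (1/2)" "complex_of_real 0" 1] by simp
  have d2: "mder n (\<lambda>s. cpw R (lin (-1) 1 s)) ((-1) \<cdot>\<^sub>m mlog R) 1"
    using mder_cpw[OF pd(2) n(2), of "complex_of_real (-1)" "complex_of_real 1" 1] by (simp add: C0 mat_one_left)
  have d3: "mder n (\<lambda>s. cpw \<tau> (lin (-1/2) 0 s)) ((-1/2) \<cdot>\<^sub>m (cpw \<tau> (-1/2) * mlog \<tau>)) 1"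
    using mder_cpw[OF pd(1) n(1), of "complex_of_real (-1/2)" "complex_of_real 0" 1] by simp
  have d4: "mder n (\<lambda>s. cpw R (lin 1 0 s)) (R * mlog R) 1"
    using mder_cpw[OF pd(2) n(2), of "complex_of_real 1" "complex_of_real 0" 1] by (simp add: C1 one)
  have "mder n (interp P \<tau> R) E 1"
    using mder_mult[OF d1 mder_mult[OF d2 mder_mult[OF d1 mder_superop[OF mder_mult[OF d3 mder_mult[OF d4 d3]] L]]]]
    unfolding interp_def[abs_def] E_def G'_def Y_def by (simp add: C0 C1 mat_one_left)
  hence "((\<lambda>t. Re (mtrace (interp P \<tau> R (complex_of_real t)))) has_real_derivative Re (mtrace E)) (at 1)"
    using mder_mtrace[of n "interp P \<tau> R" E 1] by simp
  moreover have "Re (mtrace (interp P \<tau> R (complex_of_real t))) \<le> Re (mtrace (interp P \<tau> R (complex_of_real 1)))" if "1 - 1 \<le> t" "t < 1" for t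
  proof -
    have "mtrace (interp P \<tau> R 1) = mtrace (\<tau> * P Y)"
      unfolding interp_def Y_def by (simp add: C0 C1 mat_one_left CM)
    also have "\<dots> = mtrace (\<tau> * Y)" by (rule inv) auto
    also have "\<dots> = mtrace (cpw \<tau> 1 * Y)" by (simp add: C1)
    also have "\<dots> = mtrace (cpw \<tau> (1/2) * (R * cpw \<tau> (-1/2)))" by (simp add: Y_def CM)
    also have "\<dots> = mtrace ((R * cpw \<tau> (-1/2)) * cpw \<tau> (1/2))" by (rule mtrace_cyc) auto
    also have "\<dots> = mtrace R" by (simp add: mat_assoc CM C0 mat_one_right)
    finally show ?thesis
      using interp_bound[of "complex_of_real t"] that complex_Re_le_cmod[of "mtrace (interp P \<tau> R (complex_of_real t))"] by simp
  qed
  ultimately have E0: "Re (mtrace E) \<ge> 0" by (rule deriv_nonneg_at_max)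
  have com: "cpw \<tau> z * (mlog \<tau> * M) = mlog \<tau> * (cpw \<tau> z * M)" if "dim_row M = n" for z M
    using that cpw_mlog_comm[OF pd(1), of z] by (simp add: mat_assoc[symmetric])
  \<comment> \<open>Powers and logarithm of \<open>\<tau>\<close> commute, so the two half
    derivatives of its outer powers contribute the same trace and combine to a full
    logarithm.\<close>
  have q1: "mtrace (cpw \<tau> (1/2) * (mlog \<tau> * (cpw \<tau> (1/2) * P Y))) = mtrace (Q * mlog \<tau>)"
  proof -
    have "mtrace (cpw \<tau> (1/2) * (mlog \<tau> * (cpw \<tau> (1/2) * P Y))) = mtrace (mlog \<tau> * (cpw \<tau> (1/2) * (cpw \<tau> (1/2) * P Y)))"
      by (simp add: com)
    also have "\<dots> = mtrace (cpw \<tau> (1/2) * (mlog \<tau> * cpw \<tau> (1/2) * P Y))"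
      by (simp add: mat_assoc com)
    also have "\<dots> = mtrace (mlog \<tau> * cpw \<tau> (1/2) * P Y * cpw \<tau> (1/2))" by (rule mtrace_cyc) auto
    also have "\<dots> = mtrace (mlog \<tau> * Q)" by (simp add: Q_def Y_def mat_assoc)
    also have "\<dots> = mtrace (Q * mlog \<tau>)" by (rule mtrace_cyc) (auto simp: Q_def)
    finally show ?thesis .
  qed
  have q3: "mtrace (cpw \<tau> (1/2) * (cpw \<tau> (1/2) * (mlog \<tau> * P Y))) = mtrace (Q * mlog \<tau>)"
    using q1 by (simp add: com)
  have q2: "mtrace (cpw \<tau> (1/2) * (mlog R * (cpw \<tau> (1/2) * P Y))) = mtrace (Q * mlog R)"
  proof -
    have "mtrace (cpw \<tau> (1/2) * (mlog R * (cpw \<tau> (1/2) * P Y))) = mtrace (mlog R * (cpw \<tau> (1/2) * P Y) * cpw \<tau> (1/2))"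
      by (rule mtrace_cyc) auto
    also have "\<dots> = mtrace (mlog R * Q)" by (simp add: Q_def Y_def mat_assoc)
    also have "\<dots> = mtrace (Q * mlog R)" by (rule mtrace_cyc) (auto simp: Q_def)
    finally show ?thesis .
  qed
  \<comment> \<open>Differentiating inside \<open>P\<close> leaves a trace against
    \<open>\<tau>\<close>, so invariance removes \<open>P\<close> and only logarithmic terms in
    \<open>R\<close> are left.\<close>
  have q4: "mtrace (cpw \<tau> (1/2) * (cpw \<tau> (1/2) * P G')) = mtrace (R * mlog R) - mtrace (R * mlog \<tau>)"
  proof -
    have "mtrace (cpw \<tau> (1/2) * (cpw \<tau> (1/2) * P G')) = mtrace (\<tau> * P G')" by (simp add: CM C1)
    also have "\<dots> = mtrace (\<tau> * G')" by (rule inv) auto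
    also have "\<dots> = mtrace (cpw \<tau> 1 * G')" by (simp add: C1)
    also have "\<dots> = - (1/2) * mtrace (cpw \<tau> (1/2) * (mlog \<tau> * (R * cpw \<tau> (-1/2)))) + mtrace (cpw \<tau> (1/2) * (R * (mlog R * cpw \<tau> (-1/2))))
        - (1/2) * mtrace (cpw \<tau> (1/2) * (R * (cpw \<tau> (-1/2) * mlog \<tau>)))"
      by (simp add: G'_def mat_distrib_left mat_distrib_right mat_smult_left mat_smult_right mtrace_add mtrace_smult mat_assoc CM)
    also have "mtrace (cpw \<tau> (1/2) * (mlog \<tau> * (R * cpw \<tau> (-1/2)))) = mtrace ((mlog \<tau> * (R * cpw \<tau> (-1/2))) * cpw \<tau> (1/2))"
      by (rule mtrace_cyc) auto
    also have "\<dots> = mtrace (mlog \<tau> * R)" by (simp add: mat_assoc CM C0 mat_one_right)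
    also have "\<dots> = mtrace (R * mlog \<tau>)" by (rule mtrace_cyc) auto
    also have "mtrace (cpw \<tau> (1/2) * (R * (mlog R * cpw \<tau> (-1/2)))) = mtrace ((R * (mlog R * cpw \<tau> (-1/2))) * cpw \<tau> (1/2))"
      by (rule mtrace_cyc) auto
    also have "\<dots> = mtrace (R * mlog R)" by (simp add: mat_assoc CM C0 mat_one_right)
    also have "mtrace (cpw \<tau> (1/2) * (R * (cpw \<tau> (-1/2) * mlog \<tau>))) = mtrace ((R * (cpw \<tau> (-1/2) * mlog \<tau>)) * cpw \<tau> (1/2))"
      by (rule mtrace_cyc) auto
    also have "\<dots> = mtrace (R * mlog \<tau>)" by (simp add: mat_assoc com CM C0 mat_one_right)
    finally show ?thesis by simp
  qed
  have "mtrace E = mtrace (Q * mlog \<tau>) - mtrace (Q * mlog R) + mtrace (R * mlog R) - mtrace (R * mlog \<tau>)"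
  proof -
    have "mtrace E = (1/2) * mtrace (cpw \<tau> (1/2) * (mlog \<tau> * (cpw \<tau> (1/2) * P Y)))
       - mtrace (cpw \<tau> (1/2) * (mlog R * (cpw \<tau> (1/2) * P Y)))
       + (1/2) * mtrace (cpw \<tau> (1/2) * (cpw \<tau> (1/2) * (mlog \<tau> * P Y))) + mtrace (cpw \<tau> (1/2) * (cpw \<tau> (1/2) * P G'))"
      unfolding E_def by (simp add: mat_distrib_left mat_distrib_right mat_smult_left mat_smult_right mtrace_add mtrace_smult mat_assoc)
    thus ?thesis unfolding q1 q2 q3 q4 by simp
  qed
  thus ?thesis using E0 by simp
qed

end

declare One_nat_def [simp del]

section \<open>The semigroup generated by a superoperator\<close>

text \<open>The entrywise l1 norm, in which the bound for a superoperator can be read off from its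
  values on matrix units.\<close>

definition entry_norm :: "nat \<Rightarrow> complex mat \<Rightarrow> real" where
  "entry_norm m X = (\<Sum>i<m. \<Sum>j<m. cmod (X $$ (i,j)))"

lemma entry_norm_nonneg: "entry_norm m X \<ge> 0"
  by (auto simp: entry_norm_def intro!: sum_nonneg)

lemma entry_le_entry_norm: "i < m \<Longrightarrow> j < m \<Longrightarrow> cmod (X $$ (i,j)) \<le> entry_norm m X"
proof -
  assume ij: "i < m" "j < m"
  have "cmod (X $$ (i,j)) \<le> (\<Sum>j<m. cmod (X $$ (i,j)))" using ij by (intro member_le_sum) auto
  also have "\<dots> \<le> entry_norm m X" unfolding entry_norm_def
    using ij by (intro member_le_sum[of i _ "\<lambda>i. \<Sum>j<m. cmod (X $$ (i,j))"]) (auto intro!: sum_nonneg)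
  finally show ?thesis .
qed

lemma superop_bounded:
  assumes L: "superop m L"
  obtains K where "K \<ge> 0" "\<And>X. dim_row X = m \<Longrightarrow> dim_col X = m \<Longrightarrow> entry_norm m (L X) \<le> K * entry_norm m X"
proof -
  define K where "K = (\<Sum>k<m. \<Sum>l<m. entry_norm m (L (munit m k l)))"
  have K0: "K \<ge> 0" unfolding K_def by (intro sum_nonneg entry_norm_nonneg)
  have "entry_norm m (L X) \<le> K * entry_norm m X" if X: "dim_row X = m" "dim_col X = m" for X
  proof -
    have kl: "entry_norm m (L (munit m k l)) \<le> K" if "k < m" "l < m" for k l
    proof -
      have "entry_norm m (L (munit m k l)) \<le> (\<Sum>l<m. entry_norm m (L (munit m k l)))"
        using that by (intro member_le_sum) (auto simp: entry_norm_nonneg)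
      also have "\<dots> \<le> K" unfolding K_def
        using that by (intro member_le_sum[of k _ "\<lambda>k. \<Sum>l<m. entry_norm m (L (munit m k l))"]) (auto intro!: sum_nonneg simp: entry_norm_nonneg)
      finally show ?thesis .
    qed
    have "entry_norm m (L X) \<le> (\<Sum>i<m. \<Sum>j<m. \<Sum>k<m. \<Sum>l<m. cmod (X $$ (k,l)) * cmod (L (munit m k l) $$ (i,j)))"
      unfolding entry_norm_def
    proof (intro sum_mono)
      fix i j assume ij: "i \<in> {..<m}" "j \<in> {..<m}"
      have "L X $$ (i,j) = (\<Sum>k<m. \<Sum>l<m. X $$ (k,l) * L (munit m k l) $$ (i,j))"
        using ij by (intro superop_entry[OF L X]) auto
      hence "cmod (L X $$ (i,j)) \<le> (\<Sum>k<m. cmod (\<Sum>l<m. X $$ (k,l) * L (munit m k l) $$ (i,j)))"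
        by (simp only: norm_sum)
      also have "\<dots> \<le> (\<Sum>k<m. \<Sum>l<m. cmod (X $$ (k,l) * L (munit m k l) $$ (i,j)))"
        by (rule sum_mono) (rule norm_sum)
      finally show "cmod (L X $$ (i,j)) \<le> (\<Sum>k<m. \<Sum>l<m. cmod (X $$ (k,l)) * cmod (L (munit m k l) $$ (i,j)))"
        unfolding norm_mult .
    qed
    also have "\<dots> = (\<Sum>i<m. \<Sum>k<m. \<Sum>j<m. \<Sum>l<m. cmod (X $$ (k,l)) * cmod (L (munit m k l) $$ (i,j)))"
      by (intro sum.cong refl sum.swap)
    also have "\<dots> = (\<Sum>i<m. \<Sum>k<m. \<Sum>l<m. \<Sum>j<m. cmod (X $$ (k,l)) * cmod (L (munit m k l) $$ (i,j)))"
      by (intro sum.cong refl sum.swap)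
    also have "\<dots> = (\<Sum>k<m. \<Sum>i<m. \<Sum>l<m. \<Sum>j<m. cmod (X $$ (k,l)) * cmod (L (munit m k l) $$ (i,j)))"
      by (rule sum.swap)
    also have "\<dots> = (\<Sum>k<m. \<Sum>l<m. \<Sum>i<m. \<Sum>j<m. cmod (X $$ (k,l)) * cmod (L (munit m k l) $$ (i,j)))"
      by (intro sum.cong refl sum.swap)
    also have "\<dots> = (\<Sum>k<m. \<Sum>l<m. cmod (X $$ (k,l)) * entry_norm m (L (munit m k l)))"
      by (simp add: entry_norm_def sum_distrib_left)
    also have "\<dots> \<le> (\<Sum>k<m. \<Sum>l<m. cmod (X $$ (k,l)) * K)"
      using kl by (intro sum_mono mult_left_mono) auto
    also have "\<dots> = K * entry_norm m X" by (simp add: entry_norm_def sum_distrib_left mult.commute)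
    finally show ?thesis .
  qed
  thus ?thesis using that K0 by blast
qed

lemma superop_power_dim:
  assumes "superop m L" "dim_row X = m" "dim_col X = m"
  shows "dim_row ((L ^^ n) X) = m \<and> dim_col ((L ^^ n) X) = m"
  by (induction n) (use assms superop_dim[OF assms(1)] in auto)

text \<open>The n-th power of \<open>L\<close> grows at most like \<open>K^n\<close>, so the
  exponential series dominates. Absolute convergence is recorded because the Cauchy product for
  tensor semigroups needs it.\<close>

lemma sexp_summable:
  assumes L: "superop m L" and X: "dim_row X = m" "dim_col X = m" and ij: "i < m" "j < m"
  shows "summable (\<lambda>n. cmod (z ^ n / fact n * ((L ^^ n) X) $$ (i,j)))"
proof -
  obtain K where K: "K \<ge> 0" "\<And>X. dim_row X = m \<Longrightarrow> dim_col X = m \<Longrightarrow> entry_norm m (L X) \<le> K * entry_norm m X"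
    by (rule superop_bounded[OF L]) blast
  have b: "entry_norm m ((L ^^ n) X) \<le> K ^ n * entry_norm m X" for n
  proof (induction n)
    case (Suc n)
    have "entry_norm m ((L ^^ Suc n) X) \<le> K * entry_norm m ((L ^^ n) X)"
      using K(2)[of "(L ^^ n) X"] superop_power_dim[OF L X, of n] by simp
    also have "\<dots> \<le> K * (K ^ n * entry_norm m X)" using Suc K by (intro mult_left_mono)
    finally show ?case by (simp add: mult_ac)
  qed simp
  have "summable (\<lambda>n. inverse (fact n) * (cmod z * K) ^ n * entry_norm m X)"
    by (intro summable_mult2 summable_exp)
  moreover have "norm (cmod (z ^ n / fact n * ((L ^^ n) X) $$ (i,j))) \<le> inverse (fact n) * (cmod z * K) ^ n * entry_norm m X" for n
  proof -
    have "cmod (((L ^^ n) X) $$ (i,j)) \<le> K ^ n * entry_norm m X"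
      using entry_le_entry_norm[OF ij, of "(L ^^ n) X"] b[of n] by linarith
    hence "cmod (z ^ n / fact n) * cmod (((L ^^ n) X) $$ (i,j)) \<le> cmod (z ^ n / fact n) * (K ^ n * entry_norm m X)"
      by (intro mult_left_mono) auto
    also have "\<dots> = inverse (fact n) * (cmod z * K) ^ n * entry_norm m X"
      by (simp add: norm_divide norm_power power_mult_distrib field_simps)
    finally have "cmod (z ^ n / fact n * ((L ^^ n) X) $$ (i,j)) \<le> inverse (fact n) * (cmod z * K) ^ n * entry_norm m X"
      unfolding norm_mult .
    thus ?thesis by simp
  qed
  ultimately show ?thesis by (rule summable_comparison_test'[where N=0])
qed

lemma sexp_dim [simp]: "dim_row (sexp m t L X) = m" "dim_col (sexp m t L X) = m"
  by (auto simp: sexp_def)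

lemma sexp_entry:
  "i < m \<Longrightarrow> j < m \<Longrightarrow> sexp m t L X $$ (i,j) = (\<Sum>n. complex_of_real t ^ n / fact n * ((L ^^ n) X) $$ (i,j))"
  by (auto simp: sexp_def)

lemma superop_power:
  assumes "superop m L"
  shows "superop m (L ^^ n)"
proof (induction n)
  case 0 show ?case by (auto simp: superop_def)
next
  case (Suc n)
  thus ?case using assms by (auto simp: superop_def)
qed

lemma superop_sexp:
  assumes L: "superop m L"
  shows "superop m (sexp m t L)"
  unfolding superop_def
proof (intro conjI ballI allI)
  fix X :: "complex mat" assume X: "X \<in> carrier_mat m m"
  hence dX: "dim_row X = m" "dim_col X = m" by auto
  show "sexp m t L X \<in> carrier_mat m m" by (rule carrier_matI) auto
  show "sexp m t L (a \<cdot>\<^sub>m X) = a \<cdot>\<^sub>m sexp m t L X" for a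
  proof (rule eq_matI)
    fix i j assume "i < dim_row (a \<cdot>\<^sub>m sexp m t L X)" "j < dim_col (a \<cdot>\<^sub>m sexp m t L X)"
    hence ij: "i < m" "j < m" by auto
    have "sexp m t L (a \<cdot>\<^sub>m X) $$ (i,j) = (\<Sum>n. a * (complex_of_real t ^ n / fact n * ((L ^^ n) X) $$ (i,j)))"
      using ij superop_power_dim[OF L dX] by (simp add: sexp_entry superop_smult[OF superop_power[OF L] dX] mult_ac)
    also have "\<dots> = a * sexp m t L X $$ (i,j)"
      unfolding sexp_entry[OF ij] by (rule suminf_mult[OF summable_norm_cancel[OF sexp_summable[OF L dX ij]]])
    finally show "sexp m t L (a \<cdot>\<^sub>m X) $$ (i,j) = (a \<cdot>\<^sub>m sexp m t L X) $$ (i,j)" using ij by simp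
  qed auto
  fix Y :: "complex mat" assume Y: "Y \<in> carrier_mat m m"
  hence dY: "dim_row Y = m" "dim_col Y = m" by auto
  show "sexp m t L (X + Y) = sexp m t L X + sexp m t L Y"
  proof (rule eq_matI)
    fix i j assume "i < dim_row (sexp m t L X + sexp m t L Y)" "j < dim_col (sexp m t L X + sexp m t L Y)"
    hence ij: "i < m" "j < m" by auto
    have "sexp m t L (X + Y) $$ (i,j) = (\<Sum>n. complex_of_real t ^ n / fact n * ((L ^^ n) X) $$ (i,j) + complex_of_real t ^ n / fact n * ((L ^^ n) Y) $$ (i,j))"
      using ij superop_power_dim[OF L dX] superop_power_dim[OF L dY]
      by (simp add: sexp_entry superop_add[OF superop_power[OF L] dX dY] ring_distribs add_divide_distrib)
    also have "\<dots> = sexp m t L X $$ (i,j) + sexp m t L Y $$ (i,j)"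
      unfolding sexp_entry[OF ij] by (rule suminf_add[symmetric, OF summable_norm_cancel[OF sexp_summable[OF L dX ij]] summable_norm_cancel[OF sexp_summable[OF L dY ij]]])
    finally show "sexp m t L (X + Y) $$ (i,j) = (sexp m t L X + sexp m t L Y) $$ (i,j)" using ij by simp
  qed auto
qed

lemma sexp_0:
  assumes "dim_row X = m" "dim_col X = m"
  shows "sexp m 0 L X = X"
proof (rule eq_matI)
  fix i j assume "i < dim_row X" "j < dim_col X"
  hence ij: "i < m" "j < m" using assms by auto
  have "sexp m 0 L X $$ (i,j) = (\<Sum>n. (((L ^^ n) X) $$ (i,j) / fact n) * 0 ^ n)"
    unfolding sexp_entry[OF ij] by (simp add: mult_ac)
  thus "sexp m 0 L X $$ (i,j) = X $$ (i,j)" unfolding powser_zero by simp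
qed (use assms in auto)

lemma sexp_deriv_0:
  assumes L: "superop m L" and X: "dim_row X = m" "dim_col X = m" and ij: "i < m" "j < m"
  shows "((\<lambda>t. sexp m t L X $$ (i,j)) has_vector_derivative L X $$ (i,j)) (at 0)"
proof -
  define c where "c n = ((L ^^ n) X) $$ (i,j) / fact n" for n
  \<comment> \<open>Convergence at 1 makes termwise differentiation legitimate at 0, which lies
    strictly inside the unit disc.\<close>
  have "summable (\<lambda>n. c n * 1 ^ n)"
    using summable_norm_cancel[OF sexp_summable[OF L X ij, of 1]] by (simp add: c_def)
  from termdiffs_strong[OF this, of 0]
  have "((\<lambda>x. \<Sum>n. c n * x ^ n) has_field_derivative (\<Sum>n. diffs c n * 0 ^ n)) (at (complex_of_real 0))" by simp
  also have "(\<Sum>n. diffs c n * 0 ^ n) = L X $$ (i,j)" unfolding powser_zero by (simp add: diffs_def c_def)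
  finally have "((\<lambda>t. \<Sum>n. c n * complex_of_real t ^ n) has_vector_derivative L X $$ (i,j)) (at 0)"
    by (rule has_vector_derivative_real_field)
  moreover have "(\<lambda>t. \<Sum>n. c n * complex_of_real t ^ n) = (\<lambda>t. sexp m t L X $$ (i,j))"
    by (rule ext) (simp add: sexp_entry[OF ij] c_def mult_ac)
  ultimately show ?thesis by simp
qed

text \<open>The bridge from semigroup to generator: inequalities and identities for
  \<open>sexp m t L\<close> at nonnegative times become statements about \<open>L\<close> by
  differentiating at 0.\<close>

lemma ampl_sexp_trace_deriv:
  assumes L: "superop m L" and B: "dim_row B = k * m" "dim_col B = k * m"
  shows "((\<lambda>t. Re (mtrace (B * ampl k m (sexp m t L) X))) has_real_derivative Re (mtrace (B * ampl k m L X))) (at 0)"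
proof -
  have e: "ampl k m \<Phi> X $$ (j,i) = \<Phi> (blk m X (j div m) (i div m)) $$ (j mod m, i mod m)"
    if "i < k * m" "j < k * m" for \<Phi> i j using that by (simp add: ampl_def)
  have "((\<lambda>t. \<Sum>i<k*m. \<Sum>j<k*m. B $$ (i,j) * ampl k m (sexp m t L) X $$ (j,i)) has_vector_derivative
     (\<Sum>i<k*m. \<Sum>j<k*m. B $$ (i,j) * ampl k m L X $$ (j,i))) (at 0)"
  proof (intro has_vector_derivative_sum)
    fix i j assume "i \<in> {..<k*m}" "j \<in> {..<k*m}"
    hence ij: "i < k * m" "j < k * m" by auto
    show "((\<lambda>t. B $$ (i,j) * ampl k m (sexp m t L) X $$ (j,i)) has_vector_derivative B $$ (i,j) * ampl k m L X $$ (j,i)) (at 0)"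
      unfolding e[OF ij] using mod_less_idx[OF ij(1)] mod_less_idx[OF ij(2)]
      by (intro has_vector_derivative_mult_right sexp_deriv_0[OF L]) auto
  qed
  hence "((\<lambda>t. mtrace (B * ampl k m (sexp m t L) X)) has_vector_derivative mtrace (B * ampl k m L X)) (at 0)"
    using B by (simp add: mtrace_mult_sum[where n="k*m"])
  from bounded_linear.has_vector_derivative[OF bounded_linear_Re this]
  show ?thesis by (simp add: has_real_derivative_iff_has_vector_derivative)
qed

section \<open>Tensor products of semigroups\<close>

lemma ampl_one_dim:
  assumes "dim_row X = m" "dim_col X = m" "dim_row (L X) = m" "dim_col (L X) = m"
  shows "ampl 1 m L X = L X"
proof -
  have "blk m X 0 0 = X" using assms by (intro eq_matI) auto
  thus ?thesis using assms by (intro eq_matI) (auto simp: ampl_def)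
qed

lemma ampl_cong:
  "(\<And>Y. dim_row Y = m \<Longrightarrow> dim_col Y = m \<Longrightarrow> L Y = L' Y) \<Longrightarrow> ampl k m L X = ampl k m L' X"
  by (simp add: ampl_def)

lemma ampl_comp:
  assumes "superop m L'"
  shows "ampl k m (\<lambda>Y. L (L' Y)) X = ampl k m L (ampl k m L' X)"
  by (rule eq_mat_idxI[of _ k m]) (simp_all add: ampl_idx blk_ampl[OF assms])

lemma kron_one_left: "kron (1\<^sub>m 1) A = A"
  by (intro eq_matI) (auto simp: kron_entry)

lemma ampl_mid_left:
  assumes "dim_row X = m1 * m2" "dim_col X = m1 * m2"
  shows "ampl_mid 1 m1 m2 L X = reindex (sw m2 m1) (ampl m2 m1 L (reindex (sw m1 m2) X))"
  using ampl_ampl_mid[of X 1 m1 m2 L] ampl_one_dim[of X "m1 * m2" "ampl_mid 1 m1 m2 L"] assms by simp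

lemma reindex_swap_kron:
  assumes "dim_row A = m1" "dim_col A = m1" "dim_row B = m2" "dim_col B = m2"
  shows "reindex (sw m1 m2) (kron A B) = kron B A"
  using reindex_kron[of "1\<^sub>m 1" 1 A m1 B m2] assms by (simp add: kron_one_left)

lemma superop_ampl_mid_left:
  assumes L: "superop m1 L"
  shows "superop (m1 * m2) (ampl_mid 1 m1 m2 L)"
proof -
  have r: "reindex p (X + Y) = reindex p X + reindex p Y" "reindex p (a \<cdot>\<^sub>m X) = a \<cdot>\<^sub>m reindex p X"
    if "dim_row X = m1 * m2" "dim_col X = m1 * m2" "dim_row Y = m1 * m2" "dim_col Y = m1 * m2"
      "bij_betw p {..<m1*m2} {..<m1*m2}" for p X Y a
    using that reindex_lt[OF that(5)] by (auto intro!: eq_matI simp: reindex_entry)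
  note b = sw_bij[of "m1 * m2" 1 m1 m2] sw_bij[of "m1 * m2" 1 m2 m1]
  have mm: "m2 * m1 = m1 * m2" by simp
  show ?thesis unfolding superop_def
  proof (intro conjI ballI allI)
    fix X :: "complex mat" and a assume X: "X \<in> carrier_mat (m1 * m2) (m1 * m2)"
    show "ampl_mid 1 m1 m2 L X \<in> carrier_mat (m1 * m2) (m1 * m2)" by (rule carrier_matI) auto
    show "ampl_mid 1 m1 m2 L (a \<cdot>\<^sub>m X) = a \<cdot>\<^sub>m ampl_mid 1 m1 m2 L X"
      using X b by (simp add: ampl_mid_left r(2)[where Y=X] ampl_smult[OF L] mm
          r(2)[where X="ampl m2 m1 L (reindex (sw m1 m2) X)" and Y="ampl m2 m1 L (reindex (sw m1 m2) X)"])
    fix Y :: "complex mat" assume Y: "Y \<in> carrier_mat (m1 * m2) (m1 * m2)"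
    show "ampl_mid 1 m1 m2 L (X + Y) = ampl_mid 1 m1 m2 L X + ampl_mid 1 m1 m2 L Y"
      using X Y b by (simp add: ampl_mid_left r(1) ampl_add[OF L] mm)
  qed
qed

lemma ampl_mid_left_kron:
  assumes "superop m1 L" "dim_row A = m1" "dim_col A = m1" "dim_row B = m2" "dim_col B = m2"
  shows "ampl_mid 1 m1 m2 L (kron A B) = kron (L A) B"
  using assms superop_dim[OF assms(1-3)]
  by (simp add: ampl_mid_left reindex_swap_kron ampl_kron)

lemma munit_kron:
  assumes "k < m1 * m2" "l < m1 * m2"
  shows "munit (m1 * m2) k l = kron (munit m1 (k div m2) (l div m2)) (munit m2 (k mod m2) (l mod m2))"
proof (rule eq_matI)
  fix i j assume "i < dim_row (kron (munit m1 (k div m2) (l div m2)) (munit m2 (k mod m2) (l mod m2)))"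
    "j < dim_col (kron (munit m1 (k div m2) (l div m2)) (munit m2 (k mod m2) (l mod m2)))"
  hence ij: "i < m1 * m2" "j < m1 * m2" by auto
  have "i = k \<longleftrightarrow> i div m2 = k div m2 \<and> i mod m2 = k mod m2" "j = l \<longleftrightarrow> j div m2 = l div m2 \<and> j mod m2 = l mod m2"
    by (metis div_mult_mod_eq)+
  thus "munit (m1 * m2) k l $$ (i,j) = kron (munit m1 (k div m2) (l div m2)) (munit m2 (k mod m2) (l mod m2)) $$ (i,j)"
    using ij by (auto simp: kron_entry munit_def div_less_idx mod_less_idx)
qed auto

text \<open>Matrix units of a tensor product are Kronecker products of matrix units, so linearity
  reduces an identity of superoperators to elementary tensors.\<close>

lemma superop_eq_kron:
  assumes L: "superop (m1 * m2) L" and L': "superop (m1 * m2) L'"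
    and eq: "\<And>A B. dim_row A = m1 \<Longrightarrow> dim_col A = m1 \<Longrightarrow> dim_row B = m2 \<Longrightarrow> dim_col B = m2 \<Longrightarrow> L (kron A B) = L' (kron A B)"
    and X: "dim_row X = m1 * m2" "dim_col X = m1 * m2"
  shows "L X = L' X"
proof (rule eq_matI)
  fix i j assume "i < dim_row (L' X)" "j < dim_col (L' X)"
  hence ij: "i < m1 * m2" "j < m1 * m2" using superop_dim[OF L' X] by auto
  show "L X $$ (i,j) = L' X $$ (i,j)"
    unfolding superop_entry[OF L X ij] superop_entry[OF L' X ij]
    by (intro sum.cong refl) (simp add: munit_kron eq)
qed (simp_all add: superop_dim[OF L X] superop_dim[OF L' X])

text \<open>Pascal's rule in the form of the induction step of the Leibniz formula: one more
  derivative falls either on \<open>a\<close> or on \<open>b\<close>.\<close>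

lemma binomial_convolution:
  fixes a b :: "nat \<Rightarrow> complex"
  shows "(\<Sum>k\<le>n. of_nat (n choose k) * a (Suc k) * b (n - k)) + (\<Sum>k\<le>n. of_nat (n choose k) * a k * b (Suc n - k))
     = (\<Sum>k\<le>Suc n. of_nat (Suc n choose k) * a k * b (Suc n - k))"
proof -
  have "(\<Sum>k\<le>Suc n. of_nat (Suc n choose k) * a k * b (Suc n - k)) =
     a 0 * b (Suc n) + (\<Sum>k\<le>n. of_nat (Suc n choose Suc k) * a (Suc k) * b (n - k))"
    by (subst sum.atMost_Suc_shift) simp
  also have "(\<Sum>k\<le>n. of_nat (Suc n choose Suc k) * a (Suc k) * b (n - k)) =
     (\<Sum>k\<le>n. of_nat (n choose k) * a (Suc k) * b (n - k)) + (\<Sum>k\<le>n. of_nat (n choose Suc k) * a (Suc k) * b (Suc n - Suc k))"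
    by (simp add: ring_distribs sum.distrib)
  also have "a 0 * b (Suc n) + (\<dots>) = (\<Sum>k\<le>n. of_nat (n choose k) * a (Suc k) * b (n - k)) +
     (\<Sum>k\<le>Suc n. of_nat (n choose k) * a k * b (Suc n - k))"
    by (subst sum.atMost_Suc_shift) simp
  also have "(\<Sum>k\<le>Suc n. of_nat (n choose k) * a k * b (Suc n - k)) = (\<Sum>k\<le>n. of_nat (n choose k) * a k * b (Suc n - k))"
    by simp
  finally show ?thesis by simp
qed

lemma one_le_mult: "1 \<le> a \<Longrightarrow> 1 \<le> b \<Longrightarrow> 1 \<le> a * (b :: nat)"
  using mult_le_mono[of 1 a 1 b] by simp

lemma completely_positiveD:
  assumes "completely_positive m \<Phi>" "k \<ge> 1" "dim_row X = k * m" "dim_col X = k * m" "psd X"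
  shows "psd (ampl k m \<Phi> X)"
proof -
  have "X \<in> carrier_mat (k * m) (k * m)" using assms by (intro carrier_matI)
  thus ?thesis using assms unfolding completely_positive_def by blast
qed

text \<open>The induction step of the final theorem: \<open>L1\<close> stands for the generator of
  all previous factors and \<open>L2\<close> for the new one. The sum formula is required on
  matrices of the right size, which is where \<open>tensor_generator\<close> satisfies it.\<close>

locale tensor_pair =
  fixes m1 m2 :: nat and L1 L2 L :: "complex mat \<Rightarrow> complex mat"
  assumes L1: "superop m1 L1" and L2: "superop m2 L2"
    and L_eq: "\<And>X. dim_row X = m1 * m2 \<Longrightarrow> dim_col X = m1 * m2 \<Longrightarrow>
      L X = ampl_mid 1 m1 m2 L1 X + ampl_mid m1 m2 1 L2 X"
begin

lemma L_superop: "superop (m1 * m2) L"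
proof -
  note s1 = superop_ampl_mid_left[OF L1, of m2] and s2 = ampl_superop[OF L2, of m1]
  have e: "L X = ampl_mid 1 m1 m2 L1 X + ampl m1 m2 L2 X" if "dim_row X = m1 * m2" "dim_col X = m1 * m2" for X
    using L_eq[OF that] ampl_mid_right[OF that] by simp
  show ?thesis unfolding superop_def
  proof (intro conjI ballI allI)
    fix X :: "complex mat" and a assume "X \<in> carrier_mat (m1 * m2) (m1 * m2)"
    hence X: "dim_row X = m1 * m2" "dim_col X = m1 * m2" by auto
    show "L X \<in> carrier_mat (m1 * m2) (m1 * m2)" by (rule carrier_matI) (simp_all add: e[OF X])
    show "L (a \<cdot>\<^sub>m X) = a \<cdot>\<^sub>m L X"
      using X by (simp add: e superop_smult[OF s1] superop_smult[OF s2])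
        (rule eq_matI; simp add: ring_distribs)
    fix Y :: "complex mat" assume "Y \<in> carrier_mat (m1 * m2) (m1 * m2)"
    hence Y: "dim_row Y = m1 * m2" "dim_col Y = m1 * m2" by auto
    show "L (X + Y) = L X + L Y"
      using X Y by (simp add: e superop_add[OF s1] superop_add[OF s2])
        (rule eq_matI; simp)
  qed
qed

lemma L_kron:
  assumes "dim_row A = m1" "dim_col A = m1" "dim_row B = m2" "dim_col B = m2"
  shows "L (kron A B) = kron (L1 A) B + kron A (L2 B)"
  using assms by (simp add: L_eq ampl_mid_right ampl_mid_left_kron[OF L1] ampl_kron[OF L2])

text \<open>On elementary tensors \<open>L\<close> acts like a derivation, so its powers obey the
  Leibniz formula.\<close>

lemma L_power_kron:
  assumes "dim_row A = m1" "dim_col A = m1" "dim_row B = m2" "dim_col B = m2"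
    and l: "a < m1" "b < m1" "r < m2" "s < m2"
  shows "(L ^^ n) (kron A B) $$ (a * m2 + r, b * m2 + s) =
    (\<Sum>k\<le>n. of_nat (n choose k) * ((L1 ^^ k) A) $$ (a,b) * ((L2 ^^ (n - k)) B) $$ (r,s))"
  using assms(1-4)
proof (induction n arbitrary: A B)
  case 0
  thus ?case using l by (simp add: kron_entry idx_less)
next
  case (Suc n)
  note d1 = superop_dim[OF L1 Suc.prems(1,2)] and d2 = superop_dim[OF L2 Suc.prems(3,4)]
  have "(L ^^ Suc n) (kron A B) = (L ^^ n) (kron (L1 A) B + kron A (L2 B))"
    using Suc.prems by (simp add: funpow_swap1 L_kron)
  also have "\<dots> = (L ^^ n) (kron (L1 A) B) + (L ^^ n) (kron A (L2 B))"
    using Suc.prems d1 d2 by (intro superop_add[OF superop_power[OF L_superop]]) auto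
  finally have "(L ^^ Suc n) (kron A B) $$ (a * m2 + r, b * m2 + s) =
     (L ^^ n) (kron (L1 A) B) $$ (a * m2 + r, b * m2 + s) + (L ^^ n) (kron A (L2 B)) $$ (a * m2 + r, b * m2 + s)"
    using superop_power_dim[OF L_superop, of "kron A (L2 B)" n] Suc.prems d2 l by (simp add: idx_less)
  also have "\<dots> = (\<Sum>k\<le>n. of_nat (n choose k) * ((L1 ^^ Suc k) A) $$ (a,b) * ((L2 ^^ (n - k)) B) $$ (r,s)) +
      (\<Sum>k\<le>n. of_nat (n choose k) * ((L1 ^^ k) A) $$ (a,b) * ((L2 ^^ (Suc n - k)) B) $$ (r,s))"
    using Suc.IH[of "L1 A" B] Suc.IH[of A "L2 B"] Suc.prems d1 d2
    by (simp add: funpow_swap1 Suc_diff_le)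
  also have "\<dots> = (\<Sum>k\<le>Suc n. of_nat (Suc n choose k) * ((L1 ^^ k) A) $$ (a,b) * ((L2 ^^ (Suc n - k)) B) $$ (r,s))"
    by (rule binomial_convolution)
  finally show ?case .
qed

text \<open>The binomial coefficients of \<open>L_power_kron\<close> turn the exponential series of
  \<open>L\<close> into the Cauchy product of the two series of the factors.\<close>

lemma sexp_kron:
  assumes A: "dim_row A = m1" "dim_col A = m1" and B: "dim_row B = m2" "dim_col B = m2"
  shows "sexp (m1 * m2) t L (kron A B) = kron (sexp m1 t L1 A) (sexp m2 t L2 B)"
proof (rule eq_mat_idxI[of _ m1 m2])
  fix a b r s assume l: "a < m1" "b < m1" "r < m2" "s < m2"
  let ?t = "complex_of_real t"
  let ?f = "\<lambda>n. ?t ^ n / fact n * ((L1 ^^ n) A) $$ (a,b)" and ?g = "\<lambda>n. ?t ^ n / fact n * ((L2 ^^ n) B) $$ (r,s)"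
  have "kron (sexp m1 t L1 A) (sexp m2 t L2 B) $$ (a * m2 + r, b * m2 + s) = (\<Sum>n. ?f n) * (\<Sum>n. ?g n)"
    using l by (simp add: kron_entry idx_less sexp_entry)
  also have "\<dots> = (\<Sum>n. \<Sum>k\<le>n. ?f k * ?g (n - k))"
    by (rule Cauchy_product[OF sexp_summable[OF L1 A l(1,2)] sexp_summable[OF L2 B l(3,4)]])
  also have "\<dots> = (\<Sum>n. ?t ^ n / fact n * ((L ^^ n) (kron A B)) $$ (a * m2 + r, b * m2 + s))"
  proof (rule suminf_cong)
    fix n
    show "(\<Sum>k\<le>n. ?f k * ?g (n - k)) = ?t ^ n / fact n * ((L ^^ n) (kron A B)) $$ (a * m2 + r, b * m2 + s)"
      unfolding L_power_kron[OF A B l] sum_distrib_left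
    proof (rule sum.cong[OF refl])
      fix k assume "k \<in> {..n}"
      hence k: "k \<le> n" by simp
      have "?t ^ k * ?t ^ (n - k) = ?t ^ n" using k by (simp flip: power_add)
      thus "?f k * ?g (n - k) = ?t ^ n / fact n * (of_nat (n choose k) * ((L1 ^^ k) A) $$ (a,b) * ((L2 ^^ (n - k)) B) $$ (r,s))"
        unfolding binomial_fact[OF k] by (simp flip: power_add)
    qed
  qed
  also have "\<dots> = sexp (m1 * m2) t L (kron A B) $$ (a * m2 + r, b * m2 + s)"
    using l by (simp add: sexp_entry idx_less)
  finally show "sexp (m1 * m2) t L (kron A B) $$ (a * m2 + r, b * m2 + s) = kron (sexp m1 t L1 A) (sexp m2 t L2 B) $$ (a * m2 + r, b * m2 + s)" ..
qed auto

text \<open>Agreement on elementary tensors extends to all matrices by linearity. Running the two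
  evolutions one after the other lets complete positivity and invariance be checked for each factor
  separately.\<close>

lemma sexp_factor:
  assumes X: "dim_row X = m1 * m2" "dim_col X = m1 * m2"
  shows "sexp (m1 * m2) t L X = ampl m1 m2 (sexp m2 t L2) (ampl_mid 1 m1 m2 (sexp m1 t L1) X)"
proof (rule superop_eq_kron[OF superop_sexp[OF L_superop] _ _ X])
  note s2 = ampl_superop[OF superop_sexp[OF L2, of t], of m1] and s1 = superop_ampl_mid_left[OF superop_sexp[OF L1, of t], of m2]
  show "superop (m1 * m2) (\<lambda>X. ampl m1 m2 (sexp m2 t L2) (ampl_mid 1 m1 m2 (sexp m1 t L1) X))"
    unfolding superop_def
    by (auto simp: superop_add[OF s1] superop_add[OF s2] superop_smult[OF s1] superop_smult[OF s2])
  show "sexp (m1 * m2) t L (kron A B) = ampl m1 m2 (sexp m2 t L2) (ampl_mid 1 m1 m2 (sexp m1 t L1) (kron A B))"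
    if "dim_row A = m1" "dim_col A = m1" "dim_row B = m2" "dim_col B = m2" for A B
    using that by (simp add: sexp_kron ampl_mid_left_kron[OF superop_sexp[OF L1]] ampl_kron[OF superop_sexp[OF L2]])
qed

text \<open>With ancilla dimension \<open>k\<close>, the first evolution is an amplification with
  ancilla \<open>k * m2\<close> between two exchanges of factors, the second one with ancilla
  \<open>k * m1\<close>. Every step preserves positivity.\<close>

lemma sexp_cp:
  assumes cp: "completely_positive m1 (sexp m1 t L1)" "completely_positive m2 (sexp m2 t L2)"
    and m: "m1 \<ge> 1" "m2 \<ge> 1"
  shows "completely_positive (m1 * m2) (sexp (m1 * m2) t L)"
  unfolding completely_positive_def
proof (intro allI impI ballI)
  fix k X assume k: "1 \<le> (k::nat)" and X: "X \<in> carrier_mat (k * (m1 * m2)) (k * (m1 * m2))" and psd: "psd X"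
  have dX: "dim_row X = k * m1 * m2" "dim_col X = k * m1 * m2" using X by (auto simp: mult.assoc)
  have kk: "k * m2 * m1 = k * m1 * m2" by simp
  let ?Y = "reindex (sw m1 m2) X"
  let ?V = "ampl (k * m2) m1 (sexp m1 t L1) ?Y"
  let ?W = "reindex (sw m2 m1) ?V"
  have "ampl k (m1 * m2) (sexp (m1 * m2) t L) X = ampl k (m1 * m2) (\<lambda>X. ampl m1 m2 (sexp m2 t L2) (ampl_mid 1 m1 m2 (sexp m1 t L1) X)) X"
    by (rule ampl_cong) (rule sexp_factor)
  also have "\<dots> = ampl k (m1 * m2) (ampl m1 m2 (sexp m2 t L2)) (ampl k (m1 * m2) (ampl_mid 1 m1 m2 (sexp m1 t L1)) X)"
    by (rule ampl_comp[OF superop_ampl_mid_left[OF superop_sexp[OF L1]]])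
  also have "\<dots> = ampl (k * m1) m2 (sexp m2 t L2) ?W"
    unfolding ampl_ampl ampl_ampl_mid[OF dX] ..
  finally have e: "ampl k (m1 * m2) (sexp (m1 * m2) t L) X = ampl (k * m1) m2 (sexp m2 t L2) ?W" .
  have 1: "psd ?Y" by (rule reindex_psd[OF sw_bij[OF dX(1)] psd refl])
  have 2: "psd ?V" by (rule completely_positiveD[OF cp(1) _ _ _ 1]) (use k m dX in \<open>simp_all add: one_le_mult\<close>)
  have 3: "psd ?W" by (rule reindex_psd[OF sw_bij[of _ k m2 m1] 2]) simp_all
  show "psd (ampl k (m1 * m2) (sexp (m1 * m2) t L) X)" unfolding e
    by (rule completely_positiveD[OF cp(2) _ _ _ 3]) (use k m in \<open>simp_all add: one_le_mult\<close>)
qed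

end

section \<open>Primitivity of tensor products\<close>

text \<open>The normalised vector state of \<open>f\<close>. It translates convergence of all states
  into convergence of quadratic forms.\<close>

lemma qf_scaled_state:
  fixes f :: "nat \<Rightarrow> complex"
  assumes N: "(\<Sum>i<m. (cmod (f i))\<^sup>2) = N" "N > 0"
  defines "\<rho> \<equiv> mat m m (\<lambda>(i,j). f i * cnj (f j) / complex_of_real N)"
  shows "density_state m \<rho>"
    and "dim_row Y = m \<Longrightarrow> dim_col Y = m \<Longrightarrow> mtrace (\<rho> * Y) = qf Y f / complex_of_real N"
proof -
  define C where "C = mat m 1 (\<lambda>(i,j). f i / complex_of_real (sqrt N))"
  have "\<rho> = C * adj C"
  proof (rule eq_matI)
    fix i j assume "i < dim_row (C * adj C)" "j < dim_col (C * adj C)"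
    hence ij: "i < m" "j < m" by (auto simp: C_def)
    have "complex_of_real (sqrt N) * complex_of_real (sqrt N) = complex_of_real N"
      using N(2) by (simp flip: of_real_mult)
    thus "\<rho> $$ (i,j) = (C * adj C) $$ (i,j)"
      using ij by (simp add: \<rho>_def C_def mult_entry lessThan_Suc One_nat_def del: index_mult_mat(1))
  qed (auto simp: C_def \<rho>_def)
  hence "psd \<rho>" using psd_mult_adj by simp
  moreover have "mtrace \<rho> = 1"
  proof -
    have "mtrace \<rho> = (\<Sum>i<m. complex_of_real ((cmod (f i))\<^sup>2)) / complex_of_real N"
      unfolding complex_norm_square sum_divide_distrib by (simp add: mtrace_def \<rho>_def)
    also have "(\<Sum>i<m. complex_of_real ((cmod (f i))\<^sup>2)) = complex_of_real N" unfolding N(1)[symmetric] by simp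
    finally show ?thesis using N(2) by simp
  qed
  moreover have "\<rho> \<in> carrier_mat m m" by (auto simp: \<rho>_def)
  ultimately show "density_state m \<rho>" by (simp add: density_state_def)
  show "mtrace (\<rho> * Y) = qf Y f / complex_of_real N" if "dim_row Y = m" "dim_col Y = m"
  proof -
    have "mtrace (\<rho> * Y) = (\<Sum>i<m. \<Sum>j<m. \<rho> $$ (i,j) * Y $$ (j,i))"
      using that by (intro mtrace_mult_sum) (auto simp: \<rho>_def)
    also have "\<dots> = (\<Sum>j<m. \<Sum>i<m. \<rho> $$ (i,j) * Y $$ (j,i))" by (rule sum.swap)
    also have "\<dots> = (\<Sum>j<m. \<Sum>i<m. cnj (f j) * Y $$ (j,i) * f i / complex_of_real N)"
      by (intro sum.cong refl) (simp add: \<rho>_def)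
    finally show ?thesis using that by (simp add: qf_def sum_divide_distrib)
  qed
qed

lemma qf_two_point:
  assumes "a < m" "b < m" "dim_row Y = m"
  shows "qf Y (\<lambda>i. (if i = a then u else 0) + (if i = b then w else 0)) =
    cnj u * Y $$ (a,a) * u + cnj u * Y $$ (a,b) * w + cnj w * Y $$ (b,a) * u + cnj w * Y $$ (b,b) * w"
proof -
  have "qf Y (\<lambda>i. (if i = a then u else 0) + (if i = b then w else 0)) =
    (\<Sum>i<m. \<Sum>j<m. (if j = a then (if i = a then cnj u * Y $$ (i,j) * u else 0) else 0)
      + (if j = b then (if i = a then cnj u * Y $$ (i,j) * w else 0) else 0)
      + (if j = a then (if i = b then cnj w * Y $$ (i,j) * u else 0) else 0)
      + (if j = b then (if i = b then cnj w * Y $$ (i,j) * w else 0) else 0))"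
    unfolding qf_def assms(3) by (intro sum.cong refl) (simp add: ring_distribs)
  thus ?thesis using assms by (simp add: sum.distrib)
qed

text \<open>In the Heisenberg picture the evolution of \<open>Y\<close> converges to
  \<open>mtrace (\<sigma> * Y)\<close> times the identity. Vector states supply the quadratic forms,
  and polarisation on two coordinates supplies the entries.\<close>

lemma primitive_entry_limit:
  assumes P: "primitive_QMS m L \<sigma>" and Y: "dim_row Y = m" "dim_col Y = m" and ab: "a < m" "b < m"
  shows "((\<lambda>t. sexp m t L Y $$ (a,b)) \<longlongrightarrow> (if a = b then mtrace (\<sigma> * Y) else 0)) at_top"
proof -
  let ?T = "mtrace (\<sigma> * Y)"
  have YC: "Y \<in> carrier_mat m m" using Y by (rule carrier_matI)
  have q: "((\<lambda>t. qf (sexp m t L Y) f) \<longlongrightarrow> complex_of_real N * ?T) at_top"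
    if N: "(\<Sum>i<m. (cmod (f i))\<^sup>2) = N" "N > 0" for f N
  proof -
    note s = qf_scaled_state[OF N]
    have "((\<lambda>t. mtrace (mat m m (\<lambda>(i,j). f i * cnj (f j) / complex_of_real N) * sexp m t L Y)) \<longlongrightarrow> ?T) at_top"
      using P s(1) YC unfolding primitive_QMS_def by blast
    hence "((\<lambda>t. qf (sexp m t L Y) f / complex_of_real N) \<longlongrightarrow> ?T) at_top"
      by (simp add: s(2))
    hence "((\<lambda>t. complex_of_real N * (qf (sexp m t L Y) f / complex_of_real N)) \<longlongrightarrow> complex_of_real N * ?T) at_top"
      by (rule tendsto_mult_left)
    thus ?thesis using N(2) by simp
  qed
  have diag: "((\<lambda>t. sexp m t L Y $$ (a,a)) \<longlongrightarrow> ?T) at_top" if a: "a < m" for a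
  proof -
    \<comment> \<open>The vanishing second summand gives the coordinate vector the shape of
      \<open>qf_two_point\<close> with \<open>w = 0\<close>.\<close>
    have "(\<Sum>i<m. (cmod ((if i = a then 1 else 0) + (if i = a then 0 else 0)))\<^sup>2) = (\<Sum>i<m. if i = a then 1 else 0)"
      by (intro sum.cong) auto
    hence "(\<Sum>i<m. (cmod ((if i = a then 1 else 0) + (if i = a then 0 else 0)))\<^sup>2) = 1" using a by simp
    from q[OF this] show ?thesis using qf_two_point[OF a a, where u=1 and w=0] by simp
  qed
  show ?thesis
  proof (cases "a = b")
    case True
    thus ?thesis using diag[OF ab(1)] by simp
  next
    case False
    have N: "(\<Sum>i<m. (cmod ((if i = a then 1 else 0) + (if i = b then w else 0)))\<^sup>2) = 2" if "cmod w = 1" for w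
    proof -
      have "(\<Sum>i<m. (cmod ((if i = a then 1 else 0) + (if i = b then w else 0)))\<^sup>2) = (\<Sum>i<m. (if i = a then 1 else 0) + (if i = b then 1 else 0))"
        using False that by (intro sum.cong) auto
      thus ?thesis using ab by (simp add: sum.distrib)
    qed
    have q1: "((\<lambda>t. qf (sexp m t L Y) (\<lambda>i. (if i = a then 1 else 0) + (if i = b then 1 else 0))) \<longlongrightarrow> complex_of_real 2 * ?T) at_top"
      by (rule q[OF N]) auto
    have q2: "((\<lambda>t. qf (sexp m t L Y) (\<lambda>i. (if i = a then 1 else 0) + (if i = b then \<i> else 0))) \<longlongrightarrow> complex_of_real 2 * ?T) at_top"
      by (rule q[OF N]) auto
    \<comment> \<open>Polarisation: the form at \<open>e_a + e_b\<close> minus \<open>\<i>\<close>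
      times the form at \<open>e_a + \<i> e_b\<close> equals twice the entry \<open>(a,b)\<close>
      plus \<open>1 - \<i>\<close> times the two diagonal entries.\<close>
    have "((\<lambda>t. (qf (sexp m t L Y) (\<lambda>i. (if i = a then 1 else 0) + (if i = b then 1 else 0))
        - \<i> * qf (sexp m t L Y) (\<lambda>i. (if i = a then 1 else 0) + (if i = b then \<i> else 0))
        - (1 - \<i>) * (sexp m t L Y $$ (a,a) + sexp m t L Y $$ (b,b))) / 2) \<longlongrightarrow>
        (complex_of_real 2 * ?T - \<i> * (complex_of_real 2 * ?T) - (1 - \<i>) * (?T + ?T)) / 2) at_top"
      by (intro tendsto_intros q1 q2 diag ab) simp
    moreover have "(qf (sexp m t L Y) (\<lambda>i. (if i = a then 1 else 0) + (if i = b then 1 else 0))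
        - \<i> * qf (sexp m t L Y) (\<lambda>i. (if i = a then 1 else 0) + (if i = b then \<i> else 0))
        - (1 - \<i>) * (sexp m t L Y $$ (a,a) + sexp m t L Y $$ (b,b))) / 2 = sexp m t L Y $$ (a,b)" for t
      unfolding qf_two_point[OF ab sexp_dim(1)] by (simp add: algebra_simps)
    moreover have "(complex_of_real 2 * ?T - \<i> * (complex_of_real 2 * ?T) - (1 - \<i>) * (?T + ?T)) / 2 = 0"
      by (simp add: algebra_simps)
    ultimately show ?thesis using False by simp
  qed
qed

lemma primitiveD:
  assumes "primitive_QMS m L \<sigma>"
  shows "m \<ge> 1" "superop m L" "dim_row \<sigma> = m" "dim_col \<sigma> = m" "pos_def \<sigma>" "mtrace \<sigma> = 1"
    "t \<ge> 0 \<Longrightarrow> completely_positive m (sexp m t L)" "t \<ge> 0 \<Longrightarrow> sexp m t L (1\<^sub>m m) = 1\<^sub>m m"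
    "t \<ge> 0 \<Longrightarrow> dim_row X = m \<Longrightarrow> dim_col X = m \<Longrightarrow> mtrace (\<sigma> * sexp m t L X) = mtrace (\<sigma> * X)"
  using assms
  by (auto simp: primitive_QMS_def is_QMS_def invariant_state_def density_state_def)

lemma mtrace_mult_munit:
  assumes "dim_row M = m" "dim_col M = m" "p < m" "q < m"
  shows "mtrace (M * munit m p q) = M $$ (q,p)"
proof -
  have "mtrace (M * munit m p q) = (\<Sum>u<m. \<Sum>v<m. M $$ (u,v) * munit m p q $$ (v,u))"
    using assms by (intro mtrace_mult_sum) auto
  also have "\<dots> = (\<Sum>u<m. \<Sum>v<m. if v = p then (if u = q then M $$ (u,v) else 0) else 0)"
    by (intro sum.cong refl) (simp add: munit_def)
  finally show ?thesis using assms by simp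
qed

context tensor_pair
begin

context
  fixes \<sigma>1 \<sigma>2 :: "complex mat"
  assumes P1: "primitive_QMS m1 L1 \<sigma>1" and P2: "primitive_QMS m2 L2 \<sigma>2"
begin

lemma tensor_invariant:
  assumes t: "t \<ge> 0" and X: "dim_row X = m1 * m2" "dim_col X = m1 * m2"
  shows "mtrace (kron \<sigma>1 \<sigma>2 * sexp (m1 * m2) t L X) = mtrace (kron \<sigma>1 \<sigma>2 * X)"
proof -
  note d = primitiveD(3,4)[OF P1] primitiveD(3,4)[OF P2]
  have bij: "bij_betw (sw m1 m2) {..<m1*m2} {..<m1*m2}" "bij_betw (sw m2 m1) {..<m1*m2} {..<m1*m2}"
    using sw_bij[of "m1*m2" 1 m1 m2] sw_bij[of "m1*m2" 1 m2 m1] by (auto simp: mult.commute)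
  let ?Y = "reindex (sw m1 m2) X"
  have "mtrace (kron \<sigma>1 \<sigma>2 * sexp (m1 * m2) t L X) = mtrace (kron \<sigma>1 \<sigma>2 * ampl m1 m2 (sexp m2 t L2) (ampl_mid 1 m1 m2 (sexp m1 t L1) X))"
    by (simp add: sexp_factor[OF X])
  also have "\<dots> = 1 * mtrace (kron \<sigma>1 \<sigma>2 * ampl_mid 1 m1 m2 (sexp m1 t L1) X)"
    by (rule mtrace_kron_ampl[OF superop_sexp[OF L2]]) (simp_all add: d primitiveD(9)[OF P2 t])
  also have "mtrace (kron \<sigma>1 \<sigma>2 * ampl_mid 1 m1 m2 (sexp m1 t L1) X) =
      mtrace (reindex (sw m2 m1) (kron \<sigma>2 \<sigma>1) * reindex (sw m2 m1) (ampl m2 m1 (sexp m1 t L1) ?Y))"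
    unfolding ampl_mid_left[OF X] by (simp add: reindex_swap_kron d)
  also have "reindex (sw m2 m1) (kron \<sigma>2 \<sigma>1) * reindex (sw m2 m1) (ampl m2 m1 (sexp m1 t L1) ?Y)
     = reindex (sw m2 m1) (kron \<sigma>2 \<sigma>1 * ampl m2 m1 (sexp m1 t L1) ?Y)"
    by (rule reindex_mult[OF bij(2), symmetric]) (simp_all add: d mult.commute)
  also have "mtrace \<dots> = mtrace (kron \<sigma>2 \<sigma>1 * ampl m2 m1 (sexp m1 t L1) ?Y)"
    by (rule reindex_mtrace[OF bij(2)]) (simp_all add: d mult.commute)
  also have "\<dots> = 1 * mtrace (kron \<sigma>2 \<sigma>1 * ?Y)"
    by (rule mtrace_kron_ampl[OF superop_sexp[OF L1]]) (simp_all add: d primitiveD(9)[OF P1 t] X mult.commute)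
  also have "mtrace (kron \<sigma>2 \<sigma>1 * ?Y) = mtrace (reindex (sw m1 m2) (kron \<sigma>1 \<sigma>2) * ?Y)"
    by (simp add: reindex_swap_kron d)
  also have "reindex (sw m1 m2) (kron \<sigma>1 \<sigma>2) * ?Y = reindex (sw m1 m2) (kron \<sigma>1 \<sigma>2 * X)"
    by (rule reindex_mult[OF bij(1), symmetric]) (simp_all add: d X)
  also have "mtrace \<dots> = mtrace (kron \<sigma>1 \<sigma>2 * X)"
    by (rule reindex_mtrace[OF bij(1)]) (simp_all add: d X)
  finally show ?thesis by simp
qed

text \<open>After expansion in matrix units each summand is a product of one entry from either
  semigroup, so the limits of the two factors multiply. No rate of convergence is involved since the
  sum is finite.\<close>

lemma tensor_entry_limit:
  assumes X: "dim_row X = m1 * m2" "dim_col X = m1 * m2" and ij: "i < m1 * m2" "j < m1 * m2"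
  shows "((\<lambda>t. sexp (m1 * m2) t L X $$ (i,j)) \<longlongrightarrow> (if i = j then mtrace (kron \<sigma>1 \<sigma>2 * X) else 0)) at_top"
proof -
  note d = primitiveD(3,4)[OF P1] primitiveD(3,4)[OF P2]
  let ?E1 = "\<lambda>k l. munit m1 (k div m2) (l div m2)" and ?E2 = "\<lambda>k l. munit m2 (k mod m2) (l mod m2)"
  let ?\<delta> = "if i = j then 1 else (0::complex)"
  have ijl: "i div m2 < m1" "j div m2 < m1" "i mod m2 < m2" "j mod m2 < m2"
    using ij by (auto simp: div_less_idx mod_less_idx)
  have ijd: "i = j \<longleftrightarrow> i div m2 = j div m2 \<and> i mod m2 = j mod m2" by (metis div_mult_mod_eq)
  have e: "sexp (m1 * m2) t L X $$ (i,j) = (\<Sum>k<m1*m2. \<Sum>l<m1*m2. X $$ (k,l) *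
     (sexp m1 t L1 (?E1 k l) $$ (i div m2, j div m2) * sexp m2 t L2 (?E2 k l) $$ (i mod m2, j mod m2)))" for t
    unfolding superop_entry[OF superop_sexp[OF L_superop] X ij]
    using ij by (intro sum.cong refl) (simp add: munit_kron sexp_kron kron_entry)
  have lim: "((\<lambda>t. sexp (m1 * m2) t L X $$ (i,j)) \<longlongrightarrow> (\<Sum>k<m1*m2. \<Sum>l<m1*m2. X $$ (k,l) *
     ((if i div m2 = j div m2 then mtrace (\<sigma>1 * ?E1 k l) else 0) * (if i mod m2 = j mod m2 then mtrace (\<sigma>2 * ?E2 k l) else 0)))) at_top"
    unfolding e using ijl
    by (intro tendsto_sum tendsto_mult tendsto_const primitive_entry_limit[OF P1] primitive_entry_limit[OF P2]) auto
  have "(\<Sum>k<m1*m2. \<Sum>l<m1*m2. X $$ (k,l) *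
     ((if i div m2 = j div m2 then mtrace (\<sigma>1 * ?E1 k l) else 0) * (if i mod m2 = j mod m2 then mtrace (\<sigma>2 * ?E2 k l) else 0)))
     = (\<Sum>k<m1*m2. \<Sum>l<m1*m2. ?\<delta> * (kron \<sigma>1 \<sigma>2 $$ (l,k) * X $$ (k,l)))"
  proof (intro sum.cong refl)
    fix k l assume "k \<in> {..<m1*m2}" "l \<in> {..<m1*m2}"
    hence kl: "k < m1 * m2" "l < m1 * m2" by auto
    show "X $$ (k,l) *
     ((if i div m2 = j div m2 then mtrace (\<sigma>1 * ?E1 k l) else 0) * (if i mod m2 = j mod m2 then mtrace (\<sigma>2 * ?E2 k l) else 0))
     = ?\<delta> * (kron \<sigma>1 \<sigma>2 $$ (l,k) * X $$ (k,l))"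
      using kl d ijd by (auto simp: mtrace_mult_munit div_less_idx mod_less_idx kron_entry)
  qed
  also have "\<dots> = ?\<delta> * mtrace (kron \<sigma>1 \<sigma>2 * X)"
    using d X by (subst mtrace_mult_sum[where n="m1*m2"], simp_all) (subst sum.swap, simp add: sum_distrib_left)
  finally show ?thesis using lim by (auto split: if_splits)
qed

text \<open>Convergence to \<open>kron \<sigma>1 \<sigma>2\<close> is established before uniqueness:
  an invariant state has constant expectations along the flow, so uniqueness of limits identifies it
  with the limit state.\<close>

lemma tensor_primitive: "primitive_QMS (m1 * m2) L (kron \<sigma>1 \<sigma>2)"
proof -
  note d = primitiveD(3,4)[OF P1] primitiveD(3,4)[OF P2]
  note m = primitiveD(1)[OF P1] primitiveD(1)[OF P2]
  let ?\<sigma> = "kron \<sigma>1 \<sigma>2" and ?n = "m1 * m2"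
  have pd: "pos_def ?\<sigma>" by (rule pos_def_kron) (use primitiveD(5)[OF P1] primitiveD(5)[OF P2] in auto)
  have tr: "mtrace ?\<sigma> = 1" using primitiveD(6)[OF P1] primitiveD(6)[OF P2] d by (simp add: mtrace_kron)
  have ds: "density_state ?n ?\<sigma>"
    unfolding density_state_def using d pd tr by (auto intro!: carrier_matI pos_def_psd)
  have inv: "invariant_state ?n L ?\<sigma>"
    unfolding invariant_state_def using ds tensor_invariant by auto
  have qms: "is_QMS ?n L"
    unfolding is_QMS_def
  proof (intro conjI allI impI)
    show "?n \<ge> 1" using m by (rule one_le_mult)
    show "superop ?n L" by (rule L_superop)
    fix t :: real assume t: "0 \<le> t"
    show "completely_positive ?n (sexp ?n t L)"
      by (rule sexp_cp) (use primitiveD(7)[OF P1 t] primitiveD(7)[OF P2 t] m in auto)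
    show "sexp ?n t L (1\<^sub>m ?n) = 1\<^sub>m ?n"
      using sexp_kron[of "1\<^sub>m m1" "1\<^sub>m m2" t] primitiveD(8)[OF P1 t] primitiveD(8)[OF P2 t] by (simp add: kron_one)
  qed
  have conv: "((\<lambda>t. mtrace (\<rho> * sexp ?n t L X)) \<longlongrightarrow> mtrace (?\<sigma> * X)) at_top"
    if r: "density_state ?n \<rho>" and X: "X \<in> carrier_mat ?n ?n" for \<rho> X
  proof -
    have dr: "dim_row \<rho> = ?n" "dim_col \<rho> = ?n" "mtrace \<rho> = 1" using r by (auto simp: density_state_def)
    have dX: "dim_row X = ?n" "dim_col X = ?n" using X by auto
    have "((\<lambda>t. \<Sum>i<?n. \<Sum>j<?n. \<rho> $$ (i,j) * sexp ?n t L X $$ (j,i)) \<longlongrightarrow>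
       (\<Sum>i<?n. \<Sum>j<?n. \<rho> $$ (i,j) * (if j = i then mtrace (?\<sigma> * X) else 0))) at_top"
      by (intro tendsto_sum tendsto_mult tendsto_const tensor_entry_limit[OF dX]) auto
    moreover have "(\<Sum>i<?n. \<Sum>j<?n. \<rho> $$ (i,j) * (if j = i then mtrace (?\<sigma> * X) else 0)) = mtrace \<rho> * mtrace (?\<sigma> * X)"
      by (simp add: mtrace_def dr(1) sum_distrib_right if_distrib[of "\<lambda>x. _ * x"] cong: if_cong)
    ultimately show ?thesis using dr by (simp add: mtrace_mult_sum[where n="?n"])
  qed
  have uniq: "\<rho> = ?\<sigma>" if r: "invariant_state ?n L \<rho>" for \<rho>
  proof -
    have ds': "density_state ?n \<rho>" using r by (simp add: invariant_state_def)
    hence dr: "dim_row \<rho> = ?n" "dim_col \<rho> = ?n" by (auto simp: density_state_def)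
    have eq: "mtrace (\<rho> * X) = mtrace (?\<sigma> * X)" if X: "X \<in> carrier_mat ?n ?n" for X
    proof -
      have "\<forall>\<^sub>F t in at_top. mtrace (\<rho> * sexp ?n t L X) = mtrace (\<rho> * X)"
        using eventually_ge_at_top[of "0::real"] by eventually_elim (use r X in \<open>auto simp: invariant_state_def\<close>)
      hence "((\<lambda>t. mtrace (\<rho> * sexp ?n t L X)) \<longlongrightarrow> mtrace (\<rho> * X)) at_top" by (rule tendsto_eventually)
      from tendsto_unique[OF _ this conv[OF ds' X]] show ?thesis by simp
    qed
    show ?thesis
    proof (rule eq_matI)
      fix i j assume "i < dim_row ?\<sigma>" "j < dim_col ?\<sigma>"
      hence ij: "i < ?n" "j < ?n" using d by auto
      \<comment> \<open>Testing against the transposed matrix unit reads off this entry.\<close>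
      show "\<rho> $$ (i,j) = ?\<sigma> $$ (i,j)" using eq[of "munit ?n j i"] dr d ij by (simp add: mtrace_mult_munit)
    qed (use dr d in auto)
  qed
  show ?thesis unfolding primitive_QMS_def using qms inv pd uniq conv by blast
qed

end

end

section \<open>Entropies and Dirichlet forms\<close>

lemma tau_dim [simp]: "dim_row (tau k \<sigma>) = k * dim_row \<sigma>" "dim_col (tau k \<sigma>) = k * dim_col \<sigma>"
  by (auto simp: tau_def)

lemma pos_def_tau: "k \<ge> 1 \<Longrightarrow> pos_def \<sigma> \<Longrightarrow> pos_def (tau k \<sigma>)"
  unfolding tau_def by (intro pos_def_kron pos_def_scalar) auto

lemma cpw_tau:
  assumes "k \<ge> 1" "pos_def \<sigma>"
  shows "cpw (tau k \<sigma>) z = exp (z * complex_of_real (ln (1 / real k))) \<cdot>\<^sub>m kron (1\<^sub>m k) (cpw \<sigma> z)"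
proof -
  have c: "1 / real k > 0" using assms by simp
  show ?thesis unfolding tau_def cpw_kron[OF pos_def_scalar[OF c] assms(2)] cpw_scalar[OF c] by (rule kron_smult_left)
qed

lemma mlog_tau:
  assumes "k \<ge> 1" "pos_def \<sigma>"
  shows "mlog (tau k \<sigma>) = complex_of_real (ln (1 / real k)) \<cdot>\<^sub>m 1\<^sub>m (k * dim_row \<sigma>) + kron (1\<^sub>m k) (mlog \<sigma>)"
proof -
  have c: "1 / real k > 0" using assms by simp
  show ?thesis unfolding tau_def mlog_kron[OF pos_def_scalar[OF c] assms(2)] mlog_scalar[OF c]
    by (simp add: kron_smult_left kron_one)
qed

lemma mlog_one: "mlog (1\<^sub>m n) = 0\<^sub>m n n"
proof -
  have "complex_of_real 1 \<cdot>\<^sub>m 1\<^sub>m n = 1\<^sub>m n" by (rule eq_matI) auto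
  moreover have "complex_of_real 0 \<cdot>\<^sub>m 1\<^sub>m n = 0\<^sub>m n n" by (rule eq_matI) auto
  ultimately show ?thesis using mlog_scalar[of 1 n] by simp
qed

lemma kron_zero: "kron A (0\<^sub>m n n) = 0\<^sub>m (dim_row A * n) (dim_col A * n)"
  by (rule eq_matI) (auto simp: kron_entry mod_less_idx)

lemma mlog_kron_one:
  assumes "pos_def A"
  shows "mlog (kron A (1\<^sub>m m)) = kron (mlog A) (1\<^sub>m m)"
  using mlog_kron[OF assms pos_def_one[of m]] mlog_dim[OF assms]
  by (simp add: mlog_one kron_zero) (rule eq_matI; simp)

text \<open>Viewing a scalar as a 1 x 1 tensor factor lets the logarithm rule for Kronecker products
  handle scalar multiples.\<close>

lemma smult_scalar_kron: "c \<cdot>\<^sub>m A = kron (c \<cdot>\<^sub>m 1\<^sub>m 1) A"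
  by (simp add: kron_smult_left kron_one_left)

lemma mlog_smult:
  assumes "c > 0" "pos_def A"
  shows "mlog (complex_of_real c \<cdot>\<^sub>m A) = complex_of_real (ln c) \<cdot>\<^sub>m 1\<^sub>m (dim_row A) + mlog A"
  unfolding smult_scalar_kron[of _ A] mlog_kron[OF pos_def_scalar[OF assms(1)] assms(2)] mlog_scalar[OF assms(1)]
  by (simp add: kron_smult_left kron_one_left)

section \<open>The weights \<Gamma>^s and the weighted norm\<close>

lemma Gam_cpw:
  assumes "pos_def \<tau>"
  shows "Gam \<tau> s X = cpw \<tau> (complex_of_real (s / 2)) * X * cpw \<tau> (complex_of_real (s / 2))"
  by (simp add: Gam_def mpow_cpw[OF assms])

lemma Gam_dim [simp]:
  assumes "pos_def \<tau>"
  shows "dim_row (Gam \<tau> s X) = dim_row \<tau>" "dim_col (Gam \<tau> s X) = dim_row \<tau>"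
  by (simp_all add: Gam_cpw[OF assms] cpw_dim[OF assms])

lemma Gam_Gam:
  assumes "pos_def \<tau>" "dim_row X = dim_row \<tau>" "dim_col X = dim_row \<tau>"
  shows "Gam \<tau> (- s) (Gam \<tau> s X) = X"
  using assms by (simp add: Gam_cpw mat_assoc cpw_mult cpw_mult_assoc cpw_0 mat_one_left mat_one_right)

lemma pos_def_Gam:
  assumes "pos_def \<tau>" "pos_def X" "dim_row X = dim_row \<tau>"
  shows "pos_def (Gam \<tau> s X)"
proof -
  let ?M = "cpw \<tau> (complex_of_real (s / 2))" and ?M' = "cpw \<tau> (complex_of_real (- s / 2))"
  have "pos_def (adj ?M * X * ?M)"
    using assms by (intro pos_def_conj[where M'="?M'"]) (simp_all add: cpw_mult cpw_0)
  thus ?thesis using assms by (simp add: Gam_cpw adj_cpw)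
qed

lemma Gam_add:
  assumes "pos_def \<tau>" "dim_row X = dim_row \<tau>" "dim_col X = dim_row \<tau>" "dim_row Y = dim_row \<tau>" "dim_col Y = dim_row \<tau>"
  shows "Gam \<tau> s (X + Y) = Gam \<tau> s X + Gam \<tau> s Y"
  using assms by (simp add: Gam_cpw mat_distrib_left mat_distrib_right)

lemma abs_pow_pos_def:
  assumes Z: "pos_def Z"
  shows "abs_pow Z r = cpw Z (complex_of_real r)"
proof -
  have "adj Z = Z" using Z by (simp add: pos_def_def hermitian_def)
  hence e: "adj Z * Z = cpw Z (complex_of_real 2)"
    using cpw_mult[OF Z, of 1 1] by (simp add: cpw_1[OF Z])
  show ?thesis unfolding abs_pow_def e mpow_cpw[OF pos_def_cpw[OF Z]] cpw_cpw[OF Z] by simp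
qed

lemma mtrace_cpw_nonneg:
  assumes Z: "pos_def Z"
  shows "Re (mtrace (cpw Z (complex_of_real r))) \<ge> 0"
  using mtrace_adj_mult_nonneg[of "cpw Z (complex_of_real (r/2))"]
  by (simp add: adj_cpw[OF Z] cpw_mult[OF Z])

text \<open>The root in the Schatten norm and the outer power cancel because the trace below the
  root is nonnegative.\<close>

lemma wnorm_powr:
  assumes "pos_def (Gam \<tau> (1/q) X)" "q \<ge> 1"
  shows "wnorm \<tau> q X powr q = Re (mtrace (cpw (Gam \<tau> (1/q) X) (complex_of_real q)))"
  unfolding wnorm_def schatten_def abs_pow_pos_def[OF assms(1)]
  using assms(2) mtrace_cpw_nonneg[OF assms(1), of q] by (simp add: powr_powr)

text \<open>\<open>q\<close> times the entropy of \<open>X\<close>, as a function of \<open>W = Z^q\<close>; the normalisation \<open>1/k\<close> of \<open>\<tau>_k\<close> cancels.\<close>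

definition ent :: "nat \<Rightarrow> nat \<Rightarrow> complex mat \<Rightarrow> complex mat \<Rightarrow> real" where
  "ent k m \<sigma> W = Re (mtrace (W * mlog W)) - Re (mtrace (W * kron (1\<^sub>m k) (mlog \<sigma>)))
     - Re (mtrace (ptrace k m W * mlog (ptrace k m W)))"

lemma blk_kron_mult:
  assumes "dim_row W = k * m" "dim_col W = k * m" "dim_row S = m" "dim_col S = m" "a < k" "b < k"
  shows "blk m (kron (1\<^sub>m k) S * W) a b = S * blk m W a b"
    and "blk m (W * kron (1\<^sub>m k) S) a b = blk m W a b * S"
proof -
  show "blk m (kron (1\<^sub>m k) S * W) a b = S * blk m W a b"
  proof (rule eq_matI)
    fix r s assume "r < dim_row (S * blk m W a b)" "s < dim_col (S * blk m W a b)"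
    hence rs: "r < m" "s < m" using assms by auto
    have l: "a * m + r < k * m" "b * m + s < k * m" using rs assms by (auto intro!: idx_less)
    have "(kron (1\<^sub>m k) S * W) $$ (a * m + r, b * m + s) = (\<Sum>c<k. \<Sum>u<m. kron (1\<^sub>m k) S $$ (a * m + r, c * m + u) * W $$ (c * m + u, b * m + s))"
      using l assms by (subst mult_entry) (auto simp: sum_idx)
    also have "\<dots> = (\<Sum>c<k. if c = a then \<Sum>u<m. S $$ (r,u) * W $$ (c * m + u, b * m + s) else 0)"
      using rs assms by (intro sum.cong refl) (auto simp: kron_entry idx_less intro!: sum.neutral sum.cong)
    also have "\<dots> = (S * blk m W a b) $$ (r,s)" using rs assms by (simp add: mult_entry del: index_mult_mat(1))
    finally show "blk m (kron (1\<^sub>m k) S * W) a b $$ (r,s) = (S * blk m W a b) $$ (r,s)" using rs by simp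
  qed (use assms in auto)
  show "blk m (W * kron (1\<^sub>m k) S) a b = blk m W a b * S"
  proof (rule eq_matI)
    fix r s assume "r < dim_row (blk m W a b * S)" "s < dim_col (blk m W a b * S)"
    hence rs: "r < m" "s < m" using assms by auto
    have l: "a * m + r < k * m" "b * m + s < k * m" using rs assms by (auto intro!: idx_less)
    have "(W * kron (1\<^sub>m k) S) $$ (a * m + r, b * m + s) = (\<Sum>c<k. \<Sum>u<m. W $$ (a * m + r, c * m + u) * kron (1\<^sub>m k) S $$ (c * m + u, b * m + s))"
      using l assms by (subst mult_entry) (auto simp: sum_idx)
    also have "\<dots> = (\<Sum>c<k. if c = b then \<Sum>u<m. W $$ (a * m + r, c * m + u) * S $$ (u,s) else 0)"
      using rs assms by (intro sum.cong refl) (auto simp: kron_entry idx_less intro!: sum.neutral sum.cong)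
    also have "\<dots> = (blk m W a b * S) $$ (r,s)" using rs assms by (simp add: mult_entry del: index_mult_mat(1))
    finally show "blk m (W * kron (1\<^sub>m k) S) a b $$ (r,s) = (blk m W a b * S) $$ (r,s)" using rs by simp
  qed (use assms in auto)
qed

text \<open>The powers \<open>-1/2\<close> of \<open>\<sigma>\<close> on both sides cancel the
  weight \<open>\<sigma>\<close> inside the conditional expectation by cyclicity, leaving a plain
  partial trace; the normalisation of \<open>tau\<close> contributes the factor
  \<open>k\<close>.\<close>

lemma cond_exp_eq:
  assumes k: "k \<ge> 1" and s: "pos_def \<sigma>" "dim_row \<sigma> = m" and W: "dim_row W = k * m" "dim_col W = k * m"
  shows "cond_exp k m \<sigma> (mpow (tau k \<sigma>) (-1/2) * W * mpow (tau k \<sigma>) (-1/2)) =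
    kron (complex_of_real (real k) \<cdot>\<^sub>m ptrace k m W) (1\<^sub>m m)"
proof -
  note ds = pos_def_dim[OF s(1), unfolded s(2)]
  \<comment> \<open>The number \<open>1/k\<close> to the power \<open>-1/2\<close>, that is, the
    square root of \<open>k\<close>.\<close>
  define e where "e = exp (-1/2 * complex_of_real (ln (1 / real k)))"
  let ?S = "cpw \<sigma> (-1/2)"
  have dS: "dim_row ?S = m" "dim_col ?S = m" using cpw_dim[OF s(1)] s by auto
  have tp: "mpow (tau k \<sigma>) (-1/2) = e \<cdot>\<^sub>m kron (1\<^sub>m k) ?S"
    using mpow_cpw[OF pos_def_tau[OF k s(1)], of "-1/2"] cpw_tau[OF k s(1), of "-1/2", folded e_def] by simp
  have ee: "e * e = complex_of_real (real k)"
  proof -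
    have "e * e = exp (complex_of_real (- ln (1 / real k)))" unfolding e_def by (simp flip: exp_add)
    also have "\<dots> = complex_of_real (exp (- ln (1 / real k)))" by (rule exp_of_real)
    also have "exp (- ln (1 / real k)) = real k" using k by (simp add: ln_div)
    finally show ?thesis .
  qed
  have M: "mpow (tau k \<sigma>) (-1/2) * W * mpow (tau k \<sigma>) (-1/2) = complex_of_real (real k) \<cdot>\<^sub>m (kron (1\<^sub>m k) ?S * W * kron (1\<^sub>m k) ?S)"
    unfolding tp using W dS by (simp add: mat_smult_left mat_smult_right smult_smult_mat ee)
  have "mtrace (\<sigma> * blk m (complex_of_real (real k) \<cdot>\<^sub>m (kron (1\<^sub>m k) ?S * W * kron (1\<^sub>m k) ?S)) a b) = complex_of_real (real k) * ptrace k m W $$ (a,b)"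
    if ab: "a < k" "b < k" for a b
  proof -
    have sm: "blk m (c \<cdot>\<^sub>m Y) a b = c \<cdot>\<^sub>m blk m Y a b" if "dim_row Y = k * m" "dim_col Y = k * m" for c Y
      using that ab by (intro eq_matI) (auto simp: idx_less)
    have "blk m (kron (1\<^sub>m k) ?S * W * kron (1\<^sub>m k) ?S) a b = ?S * blk m W a b * ?S"
      using W dS ab by (simp add: blk_kron_mult)
    hence "mtrace (\<sigma> * blk m (complex_of_real (real k) \<cdot>\<^sub>m (kron (1\<^sub>m k) ?S * W * kron (1\<^sub>m k) ?S)) a b) =
       complex_of_real (real k) * mtrace (\<sigma> * (?S * blk m W a b * ?S))"
      using W dS s ds by (simp add: sm mat_smult_right mtrace_smult)
    also have "mtrace (\<sigma> * (?S * blk m W a b * ?S)) = mtrace (cpw \<sigma> 1 * (?S * (blk m W a b * ?S)))"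
      using dS by (simp add: cpw_1[OF s(1)] mat_assoc)
    also have "\<dots> = mtrace (cpw \<sigma> (1/2) * (blk m W a b * ?S))"
      using dS s by (simp add: cpw_mult_assoc[OF s(1)])
    also have "\<dots> = mtrace ((blk m W a b * ?S) * cpw \<sigma> (1/2))"
      by (rule mtrace_cyc) (use dS cpw_dim[OF s(1)] s in auto)
    also have "\<dots> = mtrace (blk m W a b)"
      using dS cpw_dim[OF s(1)] s by (simp add: mat_assoc cpw_mult[OF s(1)] cpw_0[OF s(1)] mat_one_right)
    also have "\<dots> = ptrace k m W $$ (a,b)" using ab by (simp add: mtrace_def ptrace_def)
    finally show ?thesis .
  qed
  hence "mat k k (\<lambda>(a,b). mtrace (\<sigma> * blk m (complex_of_real (real k) \<cdot>\<^sub>m (kron (1\<^sub>m k) ?S * W * kron (1\<^sub>m k) ?S)) a b)) = complex_of_real (real k) \<cdot>\<^sub>m ptrace k m W"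
    by (intro eq_matI) auto
  thus ?thesis unfolding cond_exp_def M by simp
qed

text \<open>\<open>mlog (tau k \<sigma>)\<close> contributes the constant \<open>ln (1/k)\<close>
  and the conditional expectation the constant \<open>ln k\<close>. They cancel, and the remaining
  terms depend on \<open>\<sigma>\<close> and on partial traces only.\<close>

lemma entropy_eq:
  assumes k: "k \<ge> 1" and m: "m \<ge> 1" and s: "pos_def \<sigma>" "dim_row \<sigma> = m"
    and Z: "pos_def (Gam (tau k \<sigma>) (1/q) X)"
  shows "entropy k m \<sigma> q X = 1 / q * ent k m \<sigma> (cpw (Gam (tau k \<sigma>) (1/q) X) (complex_of_real q))"
proof -
  note pt = pos_def_tau[OF k s(1)]
  define W where "W = cpw (Gam (tau k \<sigma>) (1/q) X) (complex_of_real q)"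
  have pW: "pos_def W" unfolding W_def by (rule pos_def_cpw[OF Z])
  have dW: "dim_row W = k * m" "dim_col W = k * m" using pt s by (simp_all add: W_def cpw_dim[OF Z])
  have pA: "pos_def (ptrace k m W)" by (rule pos_def_ptrace[OF pW dW(1) m])
  have dl: "dim_row (mlog W) = k * m" "dim_col (mlog W) = k * m" "dim_row (mlog \<sigma>) = m" "dim_col (mlog \<sigma>) = m"
     "dim_row (mlog (ptrace k m W)) = k" "dim_col (mlog (ptrace k m W)) = k"
    using mlog_dim[OF pW] mlog_dim[OF s(1)] mlog_dim[OF pA] dW s by auto
  have lc: "mlog (kron (complex_of_real (real k) \<cdot>\<^sub>m ptrace k m W) (1\<^sub>m m)) =
     complex_of_real (ln (real k)) \<cdot>\<^sub>m 1\<^sub>m (k * m) + kron (mlog (ptrace k m W)) (1\<^sub>m m)"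
  proof -
    have "mlog (kron (complex_of_real (real k) \<cdot>\<^sub>m ptrace k m W) (1\<^sub>m m)) = mlog (complex_of_real (real k) \<cdot>\<^sub>m kron (ptrace k m W) (1\<^sub>m m))"
      by (simp add: kron_smult_left)
    also have "\<dots> = complex_of_real (ln (real k)) \<cdot>\<^sub>m 1\<^sub>m (k * m) + mlog (kron (ptrace k m W) (1\<^sub>m m))"
      using mlog_smult[of "real k" "kron (ptrace k m W) (1\<^sub>m m)"] k pos_def_kron[OF pA pos_def_one[of m]] by simp
    finally show ?thesis by (simp add: mlog_kron_one[OF pA])
  qed
  have t1: "mtrace (W * kron (mlog (ptrace k m W)) (1\<^sub>m m)) = mtrace (ptrace k m W * mlog (ptrace k m W))"
  proof -
    have "mtrace (W * kron (mlog (ptrace k m W)) (1\<^sub>m m)) = mtrace (kron (mlog (ptrace k m W)) (1\<^sub>m m) * W)"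
      by (rule mtrace_cyc) (use dW dl in auto)
    also have "\<dots> = mtrace (mlog (ptrace k m W) * ptrace k m W)" by (rule mtrace_kron_one_mult[OF dW dl(5,6)])
    also have "\<dots> = mtrace (ptrace k m W * mlog (ptrace k m W))" by (rule mtrace_cyc) (use dl in auto)
    finally show ?thesis .
  qed
  have msub: "W * (A - B) = W * A - W * B" if "dim_row A = k * m" "dim_col A = k * m" "dim_row B = k * m" "dim_col B = k * m" for A B
    by (rule mult_minus_distrib_mat[of W "k*m" "k*m"]) (use that dW in \<open>auto intro!: carrier_matI\<close>)
  have "mtrace (W * (mlog W - mlog (tau k \<sigma>) - mlog (kron (complex_of_real (real k) \<cdot>\<^sub>m ptrace k m W) (1\<^sub>m m)))) =
     mtrace (W * mlog W) - complex_of_real (ln (1 / real k)) * mtrace W - mtrace (W * kron (1\<^sub>m k) (mlog \<sigma>))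
     - complex_of_real (ln (real k)) * mtrace W - mtrace (ptrace k m W * mlog (ptrace k m W))"
    unfolding lc mlog_tau[OF k s(1)] using dW dl s
    by (simp add: msub mat_distrib_left mtrace_minus mtrace_add mat_smult_right mtrace_smult mat_one_right t1)
  moreover have "ln (1 / real k) = - ln (real k)" using k by (simp add: ln_div)
  ultimately have "mtrace (W * (mlog W - mlog (tau k \<sigma>) - mlog (kron (complex_of_real (real k) \<cdot>\<^sub>m ptrace k m W) (1\<^sub>m m)))) =
     mtrace (W * mlog W) - mtrace (W * kron (1\<^sub>m k) (mlog \<sigma>)) - mtrace (ptrace k m W * mlog (ptrace k m W))"
    by simp
  thus ?thesis
    unfolding entropy_def Let_def mpow_cpw[OF Z] W_def[symmetric] cond_exp_eq[OF k s dW] ent_def by simp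
qed

text \<open>The Dirichlet form of \<open>X\<close> as a function of \<open>Z = \<Gamma>^(1/q)(X)\<close> and \<open>V = \<Gamma>^(1/q)(L_k X)\<close>.\<close>

definition dirV :: "real \<Rightarrow> complex mat \<Rightarrow> complex mat \<Rightarrow> complex mat \<Rightarrow> real" where
  "dirV q \<tau> Z V = (if q = 1 then - 1 / 2 * Re (mtrace (V * (mlog Z - mlog \<tau>)))
     else - (q / (2 * (q - 1))) * Re (mtrace (cpw Z (complex_of_real (q - 1)) * V)))"

text \<open>For \<open>q > 1\<close> the powers of \<open>\<tau>\<close> from the inner product and
  from \<open>Iqp\<close> combine to \<open>1/(2q)\<close> on each side by conjugacy of the
  exponents, which is the weight of \<open>\<Gamma>^(1/q)\<close> applied to
  \<open>ampl k m L X\<close>.\<close>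

lemma dirichlet_eq:
  assumes t: "pos_def (tau k \<sigma>)" and Z: "pos_def (Gam (tau k \<sigma>) (1/q) X)" and q: "q \<ge> 1"
    and d: "dim_row (tau k \<sigma>) = k * m"
  shows "dirichlet k m L \<sigma> q X = dirV q (tau k \<sigma>) (Gam (tau k \<sigma>) (1/q) X) (Gam (tau k \<sigma>) (1/q) (ampl k m L X))"
proof (cases "q = 1")
  case True
  thus ?thesis by (simp add: dirichlet_def dirV_def Let_def)
next
  case False
  hence q1: "q > 1" using q by simp
  let ?t = "tau k \<sigma>"
  define Z' where "Z' = Gam ?t (1/q) X"
  have pZ: "pos_def Z'" using Z by (simp add: Z'_def)
  have dZ [simp]: "dim_row Z' = k * m" using t d by (simp add: Z'_def)
  note D [simp] = cpw_dim[OF t, unfolded d] cpw_dim[OF pZ, unfolded dZ]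
  define a where "a = complex_of_real (- 1 / (q / (q - 1)) / 2)"
  define b where "b = complex_of_real (1 / q / 2)"
  \<comment> \<open>\<open>a\<close> is \<open>-1/(2 q')\<close> for the conjugate exponent
    \<open>q' = q/(q-1)\<close>, and \<open>1/2 - 1/(2 q') = 1/(2 q)\<close>.\<close>
  have ab: "1/2 + a = b" "a + 1/2 = b"
  proof -
    have "1/2 + - 1 / (q / (q - 1)) / 2 = 1 / q / 2" using q1 by (simp add: field_simps)
    hence "complex_of_real (1/2 + - 1 / (q / (q - 1)) / 2) = complex_of_real (1 / q / 2)" by simp
    thus "1/2 + a = b" unfolding a_def b_def by (simp only: of_real_add of_real_divide of_real_1 of_real_numeral)
    thus "a + 1/2 = b" by (simp add: add.commute)
  qed
  have qq: "q / (q / (q - 1)) = q - 1" using q1 by simp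
  have I: "Iqp ?t (q / (q - 1)) q X = cpw ?t a * cpw Z' (complex_of_real (q - 1)) * cpw ?t a"
  proof -
    have "Iqp ?t (q / (q - 1)) q X = Gam ?t (- 1 / (q / (q - 1))) (cpw Z' (complex_of_real (q - 1)))"
      unfolding Iqp_def Z'_def[symmetric] abs_pow_pos_def[OF pZ] qq ..
    thus ?thesis unfolding Gam_cpw[OF t, of "- 1 / (q / (q - 1))"] a_def .
  qed
  have ca: "cnj a = a" by (simp add: a_def)
  have "winner ?t (Iqp ?t (q / (q - 1)) q X) (ampl k m L X) =
     mtrace (cpw ?t (1/2) * (cpw ?t a * (cpw Z' (complex_of_real (q - 1)) * (cpw ?t a * (cpw ?t (1/2) * ampl k m L X)))))"
    using mpow_cpw[OF t, of "1/2"]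
    by (simp add: winner_def I adj_mult adj_cpw[OF t] adj_cpw[OF pZ] mat_assoc ca)
  also have "\<dots> = mtrace (cpw ?t b * (cpw Z' (complex_of_real (q - 1)) * (cpw ?t b * ampl k m L X)))"
    by (simp add: cpw_mult_assoc[OF t, unfolded d] ab del: of_real_diff)
  also have "\<dots> = mtrace ((cpw Z' (complex_of_real (q - 1)) * (cpw ?t b * ampl k m L X)) * cpw ?t b)"
    by (rule mtrace_cyc) auto
  also have "\<dots> = mtrace (cpw Z' (complex_of_real (q - 1)) * Gam ?t (1/q) (ampl k m L X))"
    unfolding Gam_cpw[OF t] b_def[symmetric] by (simp add: mat_assoc)
  finally show ?thesis using False unfolding dirichlet_def dirV_def Let_def Z'_def[symmetric] by (simp del: of_real_diff)
qed

context
  fixes m :: nat and L :: "complex mat \<Rightarrow> complex mat" and \<sigma> :: "complex mat"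
  assumes P: "primitive_QMS m L \<sigma>"
begin

text \<open>Invariance holds for nonnegative times only, while the derivative at 0 is two-sided. A
  constant function has a one-sided maximum, so every
  \<open>Re (c * mtrace (\<sigma> * L Y))\<close> is at most 0; the phases 1, -1, \<i> and -\<i>
  then force the trace to vanish.\<close>

lemma generator_invariant:
  assumes Y: "dim_row Y = m" "dim_col Y = m"
  shows "mtrace (\<sigma> * L Y) = 0"
proof -
  note d = primitiveD(3,4)[OF P]
  note L = primitiveD(2)[OF P]
  have 0: "Re (c * mtrace (\<sigma> * L Y)) \<le> 0" for c
  proof -
    have "((\<lambda>t. Re (mtrace ((c \<cdot>\<^sub>m \<sigma>) * ampl 1 m (sexp m t L) Y))) has_real_derivative Re (mtrace ((c \<cdot>\<^sub>m \<sigma>) * ampl 1 m L Y))) (at 0)"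
      using d by (intro ampl_sexp_trace_deriv[OF L]) auto
    moreover have a: "ampl 1 m (sexp m t L) Y = sexp m t L Y" "ampl 1 m L Y = L Y" for t
      using Y superop_dim[OF L Y] by (auto intro!: ampl_one_dim)
    moreover have "mtrace ((c \<cdot>\<^sub>m \<sigma>) * sexp m t L Y) = c * mtrace (\<sigma> * Y)" if "t \<ge> 0" for t
      using d Y primitiveD(9)[OF P that Y] by (simp add: mat_smult_left mtrace_smult)
    ultimately have "Re (mtrace ((c \<cdot>\<^sub>m \<sigma>) * L Y)) \<le> 0"
      by (intro deriv_nonpos_at_max[of "\<lambda>t. Re (mtrace ((c \<cdot>\<^sub>m \<sigma>) * sexp m t L Y))" _ 0]) auto
    thus ?thesis using d superop_dim[OF L Y] by (simp add: mat_smult_left mtrace_smult)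
  qed
  show ?thesis using 0[of 1] 0[of "-1"] 0[of "\<i>"] 0[of "-\<i>"] by (simp add: complex_eq_iff)
qed

text \<open>Moving the weights around the trace writes the form as a negative multiple of
  \<open>Re (mtrace (B * ampl k m L X))\<close>. It remains to see that
  \<open>Re (mtrace (B * Pt t X))\<close> is largest at \<open>t = 0\<close>, which is what the
  interpolation estimates provide.\<close>

lemma dirichlet_nonneg:
  assumes k: "k \<ge> 1" and q: "q \<ge> 1" and X: "pos_def X" "dim_row X = k * m"
  shows "dirichlet k m L \<sigma> q X \<ge> 0"
proof -
  note d = primitiveD(3,4)[OF P] and L = primitiveD(2)[OF P] and ps = primitiveD(5)[OF P] and m = primitiveD(1)[OF P]
  let ?n = "k * m"
  define \<tau> where "\<tau> = tau k \<sigma>"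
  have pt: "pos_def \<tau>" unfolding \<tau>_def by (rule pos_def_tau[OF k ps])
  have dt: "dim_row \<tau> = ?n" by (simp add: \<tau>_def d)
  have dX: "dim_col X = ?n" using pos_def_dim[OF X(1)] X(2) by simp
  define Z where "Z = Gam \<tau> (1/q) X"
  have pZ: "pos_def Z" unfolding Z_def by (rule pos_def_Gam[OF pt X(1)]) (simp add: X dt)
  have dZ: "dim_row Z = ?n" using pt dt by (simp add: Z_def)
  have dZ': "dim_col Z = ?n" using pos_def_dim[OF pZ] dZ by simp
  note D [simp] = cpw_dim[OF pt, unfolded dt] cpw_dim[OF pZ, unfolded dZ] mlog_dim[OF pt, unfolded dt] mlog_dim[OF pZ, unfolded dZ] dZ dZ' X(2) dX dt pos_def_dim[OF pt, unfolded dt]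
  define Pt where "Pt t = ampl k m (sexp m t L)" for t
  have dP [simp]: "dim_row (Pt t Y) = ?n" "dim_col (Pt t Y) = ?n" for t Y by (auto simp: Pt_def)
  have Pso: "superop ?n (Pt t)" for t unfolding Pt_def by (rule ampl_superop[OF superop_sexp[OF L]])
  \<comment> \<open>Doubling the already amplified map is an amplification with ancilla
    \<open>2 * k\<close>, so complete positivity applies.\<close>
  have P2: "two_positive ?n (Pt t)" if "t \<ge> 0" for t
    unfolding two_positive_def Pt_def ampl_ampl
    using completely_positiveD[OF primitiveD(7)[OF P that], of "2 * k"] k by (auto simp: mult.assoc)
  have P1: "Pt t (1\<^sub>m ?n) = 1\<^sub>m ?n" if "t \<ge> 0" for t
    unfolding Pt_def kron_one[symmetric] using primitiveD(8)[OF P that] by (simp add: ampl_kron[OF superop_sexp[OF L]])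
  have Pinv: "mtrace (\<tau> * Pt t Y) = mtrace (\<tau> * Y)" if t: "t \<ge> 0" and Y: "dim_row Y = ?n" "dim_col Y = ?n" for t Y
    unfolding \<tau>_def tau_def Pt_def using primitiveD(9)[OF P t] d Y
    by (subst mtrace_kron_ampl[OF superop_sexp[OF L], where c=1]) auto
  have P0: "Pt 0 X = X"
    unfolding Pt_def by (rule eq_mat_idxI[of _ k m]) (auto simp: ampl_idx sexp_0)
  have neg: "Re (mtrace (B * ampl k m L X)) \<le> 0"
    if B: "dim_row B = ?n" "dim_col B = ?n" and le: "\<And>t. t \<ge> 0 \<Longrightarrow> Re (mtrace (B * Pt t X)) \<le> Re (mtrace (B * X))" for B
  proof (rule deriv_nonpos_at_max[of _ _ 0])
    show "((\<lambda>t. Re (mtrace (B * Pt t X))) has_real_derivative Re (mtrace (B * ampl k m L X))) (at 0)"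
      unfolding Pt_def by (rule ampl_sexp_trace_deriv[OF L B])
    show "Re (mtrace (B * Pt t X)) \<le> Re (mtrace (B * Pt 0 X))" if "0 < t" for t using le[of t] that P0 by simp
  qed
  have dir: "dirichlet k m L \<sigma> q X = dirV q \<tau> Z (Gam \<tau> (1/q) (ampl k m L X))"
    unfolding \<tau>_def Z_def by (rule dirichlet_eq) (use pt pZ q dt in \<open>auto simp: \<tau>_def Z_def\<close>)
  define b where "b = complex_of_real (1 / q / 2)"
  have G: "Gam \<tau> (1/q) Y = cpw \<tau> b * Y * cpw \<tau> b" for Y unfolding Gam_cpw[OF pt] b_def ..
  have XZ: "cpw \<tau> (- b) * (Z * cpw \<tau> (- b)) = X"
    unfolding Z_def G by (simp add: mat_assoc cpw_mult[OF pt] cpw_mult_assoc[OF pt] cpw_0[OF pt] mat_one_left mat_one_right)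
  show ?thesis
  proof (cases "q = 1")
    case True
    have b: "b = 1/2" by (simp add: b_def True)
    define M where "M = mlog Z - mlog \<tau>"
    have dM [simp]: "dim_row M = ?n" "dim_col M = ?n" by (auto simp: M_def)
    have tr: "mtrace (Gam \<tau> (1/q) Y * M) = mtrace (cpw \<tau> b * M * cpw \<tau> b * Y)" if "dim_row Y = ?n" "dim_col Y = ?n" for Y
    proof -
      have "mtrace (Gam \<tau> (1/q) Y * M) = mtrace ((cpw \<tau> b * Y) * (cpw \<tau> b * M))" unfolding G using that by (simp add: mat_assoc)
      also have "\<dots> = mtrace ((cpw \<tau> b * M) * (cpw \<tau> b * Y))" by (rule mtrace_cyc) (use that in auto)
      finally show ?thesis using that by (simp add: mat_assoc)
    qed
    have msub: "mtrace (Y * M) = mtrace (Y * mlog Z) - mtrace (Y * mlog \<tau>)" if "dim_row Y = ?n" "dim_col Y = ?n" for Y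
    proof -
      have "Y * M = Y * mlog Z - Y * mlog \<tau>" unfolding M_def
        by (rule mult_minus_distrib_mat[of Y ?n ?n]) (use that in \<open>auto intro!: carrier_matI\<close>)
      thus ?thesis by (simp add: mtrace_minus that)
    qed
    have "Re (mtrace (cpw \<tau> b * M * cpw \<tau> b * ampl k m L X)) \<le> 0"
    proof (rule neg)
      fix t :: real assume t: "t \<ge> 0"
      let ?Q = "cpw \<tau> (1/2) * (Pt t (cpw \<tau> (-1/2) * (Z * cpw \<tau> (-1/2))) * cpw \<tau> (1/2))"
      \<comment> \<open>For \<open>q = 1\<close> the estimate is applied with \<open>R = Z\<close>,
        and \<open>?Q\<close> is the weighted evolution of \<open>X\<close>.\<close>
      have "Re (mtrace (Z * mlog \<tau>)) - Re (mtrace (Z * mlog Z)) \<le> Re (mtrace (?Q * mlog \<tau>)) - Re (mtrace (?Q * mlog Z))"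
        by (rule interp_log[OF Pso P2[OF t] P1[OF t] pt pZ dt dZ Pinv[OF t]])
      moreover have "?Q = Gam \<tau> (1/q) (Pt t X)" using XZ by (simp add: G b mat_assoc)
      ultimately have "Re (mtrace (Gam \<tau> (1/q) (Pt t X) * M)) \<le> Re (mtrace (Gam \<tau> (1/q) X * M))"
        by (simp add: msub Z_def[symmetric] Gam_dim[OF pt])
      thus "Re (mtrace (cpw \<tau> b * M * cpw \<tau> b * Pt t X)) \<le> Re (mtrace (cpw \<tau> b * M * cpw \<tau> b * X))"
        by (simp add: tr)
    qed auto
    hence "Re (mtrace (Gam \<tau> (1/q) (ampl k m L X) * M)) \<le> 0" by (simp add: tr)
    thus ?thesis unfolding dir dirV_def M_def using True by simp
  next
    case False
    hence q1: "q > 1" using q by simp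
    let ?Zq = "cpw Z (complex_of_real (q - 1))"
    have tr: "mtrace (?Zq * Gam \<tau> (1/q) Y) = mtrace (cpw \<tau> b * ?Zq * cpw \<tau> b * Y)" if "dim_row Y = ?n" "dim_col Y = ?n" for Y
    proof -
      have "mtrace (?Zq * Gam \<tau> (1/q) Y) = mtrace ((?Zq * cpw \<tau> b * Y) * cpw \<tau> b)" unfolding G using that by (simp add: mat_assoc)
      also have "\<dots> = mtrace (cpw \<tau> b * (?Zq * cpw \<tau> b * Y))" by (rule mtrace_cyc) (use that in auto)
      finally show ?thesis using that by (simp add: mat_assoc)
    qed
    have "Re (mtrace (cpw \<tau> b * ?Zq * cpw \<tau> b * ampl k m L X)) \<le> 0"
    proof (rule neg)
      fix t :: real assume t: "t \<ge> 0"
      define R where "R = cpw Z (complex_of_real q)"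
      have pR: "pos_def R" unfolding R_def by (rule pos_def_cpw[OF pZ])
      have dR: "dim_row R = ?n" by (simp add: R_def)
      have Rc: "cpw R z = cpw Z (complex_of_real q * z)" for z unfolding R_def by (rule cpw_cpw[OF pZ])
      \<comment> \<open>At \<open>s = 1/q\<close> and \<open>R = Z^q\<close> the interpolating
        function is the quantity to be bounded, and \<open>mtrace R\<close> is its value at
        \<open>t = 0\<close>.\<close>
      define s where "s = complex_of_real (1 / q)"
      have ex: "complex_of_real (1/2) * s + complex_of_real 0 = b" "complex_of_real (-1/2) * s + complex_of_real 0 = - b"
        "complex_of_real q * (complex_of_real (-1) * s + complex_of_real 1) = complex_of_real (q - 1)"
        "complex_of_real q * (complex_of_real 1 * s + complex_of_real 0) = 1"
        using q1 by (auto simp: s_def b_def field_simps)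
      have "interp (Pt t) \<tau> R s = cpw \<tau> b * (?Zq * (cpw \<tau> b * Pt t X))"
        unfolding interp_def Rc ex cpw_1[OF pZ] XZ ..
      moreover have "cmod (mtrace (interp (Pt t) \<tau> R s)) \<le> Re (mtrace R)"
        by (rule interp_bound[OF Pso P2[OF t] P1[OF t] pt pR dt dR Pinv[OF t]]) (use q1 in \<open>auto simp: s_def\<close>)
      ultimately have "Re (mtrace (cpw \<tau> b * ?Zq * cpw \<tau> b * Pt t X)) \<le> Re (mtrace R)"
        using complex_Re_le_cmod[of "mtrace (cpw \<tau> b * (?Zq * (cpw \<tau> b * Pt t X)))"] by (simp add: mat_assoc)
      also have "R = ?Zq * Z"
        using cpw_mult[OF pZ, of "complex_of_real (q - 1)" 1] by (simp add: R_def cpw_1[OF pZ])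
      also have "mtrace (?Zq * Z) = mtrace (cpw \<tau> b * ?Zq * cpw \<tau> b * X)" by (subst tr[symmetric]) (simp_all add: Z_def[symmetric])
      finally show "Re (mtrace (cpw \<tau> b * ?Zq * cpw \<tau> b * Pt t X)) \<le> Re (mtrace (cpw \<tau> b * ?Zq * cpw \<tau> b * X))" .
    qed auto
    hence "Re (mtrace (?Zq * Gam \<tau> (1/q) (ampl k m L X))) \<le> 0" by (simp add: tr del: of_real_diff)
    hence "- (q / (2 * (q - 1))) * Re (mtrace (?Zq * Gam \<tau> (1/q) (ampl k m L X))) \<ge> 0"
      by (intro mult_nonpos_nonpos) (use q1 in auto)
    thus ?thesis unfolding dir dirV_def using False by simp
  qed
qed

end

section \<open>Two tensor factors\<close>

text \<open>The Dirichlet form of the second factor does not see the part \<open>\<gamma>\<close> of the reference \<open>\<gamma> \<otimes> \<sigma>\<close>,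
  because \<open>id \<otimes> L\<close> commutes with multiplication by \<open>B \<otimes> 1\<close>.\<close>

lemma lsi_change_reference:
  assumes P: "primitive_QMS m L \<sigma>" and lsi: "LSI_CB q c' d m L \<sigma>" and q: "q \<ge> 1" and c: "c' \<le> c"
    and k: "k \<ge> 1" and g: "pos_def \<gamma>" "dim_row \<gamma> = k" and Z: "pos_def Z" "dim_row Z = k * m"
  defines "\<tau> \<equiv> kron \<gamma> \<sigma>"
  shows "1 / q * ent k m \<sigma> (cpw Z (complex_of_real q)) \<le>
    c * dirV q \<tau> Z (Gam \<tau> (1/q) (ampl k m L (Gam \<tau> (- (1/q)) Z))) + 2 * d / q * Re (mtrace (cpw Z (complex_of_real q)))"
proof -
  note ds = primitiveD(3,4)[OF P] and L = primitiveD(2)[OF P] and ps = primitiveD(5)[OF P] and m = primitiveD(1)[OF P]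
  let ?n = "k * m"
  have pt: "pos_def \<tau>" unfolding \<tau>_def by (rule pos_def_kron[OF g(1) ps])
  have dt: "dim_row \<tau> = ?n" by (simp add: \<tau>_def g ds)
  define t2 where "t2 = tau k \<sigma>"
  have p2: "pos_def t2" unfolding t2_def by (rule pos_def_tau[OF k ps])
  have d2: "dim_row t2 = ?n" by (simp add: t2_def ds)
  have dZ: "dim_col Z = ?n" using pos_def_dim[OF Z(1)] Z(2) by simp
  \<comment> \<open>The matrix that has the same \<open>Z\<close> in the reference
    \<open>tau k \<sigma>\<close>. Entropy and norm depend on \<open>Z\<close> alone, so the
    hypothesis for \<open>X2\<close> already has the right terms apart from the Dirichlet
    form.\<close>
  define X2 where "X2 = Gam t2 (- (1/q)) Z"
  have pX: "pos_def X2" unfolding X2_def by (rule pos_def_Gam[OF p2 Z(1)]) (simp add: Z d2)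
  have dX: "dim_row X2 = ?n" "dim_col X2 = ?n" using p2 d2 by (simp_all add: X2_def)
  have ZX: "Gam t2 (1/q) X2 = Z" using Gam_Gam[OF p2, of Z "- (1/q)"] Z d2 dZ by (simp add: X2_def)
  have XC: "X2 \<in> carrier_mat ?n ?n" using dX by (rule carrier_matI)
  have dir2: "dirichlet k m L \<sigma> q X2 = dirV q t2 Z (Gam t2 (1/q) (ampl k m L X2))"
    using dirichlet_eq[of k \<sigma> q X2 m L] p2 ZX Z q d2 by (simp add: t2_def)
  have main: "1 / q * ent k m \<sigma> (cpw Z (complex_of_real q)) \<le>
     c' * dirV q t2 Z (Gam t2 (1/q) (ampl k m L X2)) + 2 * d / q * Re (mtrace (cpw Z (complex_of_real q)))"
  proof -
    have "entropy k m \<sigma> q X2 \<le> c' * dirichlet k m L \<sigma> q X2 + 2 * d / q * (wnorm (tau k \<sigma>) q X2) powr q"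
      using lsi k XC pX unfolding LSI_CB_def by blast
    moreover have "entropy k m \<sigma> q X2 = 1 / q * ent k m \<sigma> (cpw Z (complex_of_real q))"
      using entropy_eq[OF k m ps ds(1), of q X2] ZX Z(1) by (simp add: t2_def)
    moreover have "wnorm (tau k \<sigma>) q X2 powr q = Re (mtrace (cpw Z (complex_of_real q)))"
      using wnorm_powr[of "tau k \<sigma>" q X2] ZX Z(1) q by (simp add: t2_def)
    ultimately show ?thesis using dir2 by simp
  qed
  \<comment> \<open>This sign is what permits replacing \<open>c'\<close> by the larger
    \<open>c\<close>.\<close>
  have nonneg: "dirV q t2 Z (Gam t2 (1/q) (ampl k m L X2)) \<ge> 0"
    using dirichlet_nonneg[OF P k q pX dX(1)] dir2 by simp
  define r where "r = complex_of_real (ln (1 / real k))"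
  \<comment> \<open>The power \<open>z\<close> of \<open>\<gamma>\<close> divided by that of the
    scalar \<open>1/k\<close>; tensored with the identity it converts powers of \<open>t2\<close>
    into powers of \<open>\<tau>\<close>.\<close>
  define b where "b z = exp (- (z * r)) \<cdot>\<^sub>m cpw \<gamma> z" for z
  note D [simp] = cpw_dim[OF g(1), unfolded g(2)] cpw_dim[OF ps, unfolded ds(1)] cpw_dim[OF pt, unfolded dt] cpw_dim[OF p2, unfolded d2] dX
     mlog_dim[OF g(1), unfolded g(2)] mlog_dim[OF ps, unfolded ds(1)] mlog_dim[OF pt, unfolded dt] mlog_dim[OF p2, unfolded d2]
     mlog_dim[OF Z(1), unfolded Z(2)]
  have db [simp]: "dim_row (b z) = k" "dim_col (b z) = k" for z by (auto simp: b_def)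
  define C where "C z = kron (b z) (1\<^sub>m m)" for z
  have dC [simp]: "dim_row (C z) = ?n" "dim_col (C z) = ?n" for z by (auto simp: C_def)
  have ct: "cpw \<tau> z = kron (cpw \<gamma> z) (cpw \<sigma> z)" for z unfolding \<tau>_def by (rule cpw_kron[OF g(1) ps])
  have c2: "cpw t2 z = exp (z * r) \<cdot>\<^sub>m kron (1\<^sub>m k) (cpw \<sigma> z)" for z unfolding t2_def r_def by (rule cpw_tau[OF k ps])
  have one: "1 \<cdot>\<^sub>m M = M" for M :: "complex mat" by (rule eq_matI) auto
  have ee: "exp (z * r) * exp (- (z * r)) = 1" "exp (- (z * r)) * exp (z * r) = 1" for z by (simp_all flip: exp_add)
  have Ct: "C z * cpw t2 z = cpw \<tau> z" "cpw t2 z * C z = cpw \<tau> z" for z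
    unfolding C_def c2 ct b_def
    by (simp_all add: mat_smult_left mat_smult_right kron_smult_left kron_mult mat_one_left mat_one_right smult_smult_mat ee one)
  have CC: "C z * C (- z) = 1\<^sub>m ?n" "C (- z) * C z = 1\<^sub>m ?n" for z
    unfolding C_def b_def
    by (simp_all add: mat_smult_left mat_smult_right kron_smult_left kron_mult mat_one_left smult_smult_mat ee one
        cpw_mult[OF g(1)] cpw_0[OF g(1)] g(2) kron_one)
  define a where "a = complex_of_real (1/q/2)"
  have G: "Gam \<tau> (1/q) Y = cpw \<tau> a * Y * cpw \<tau> a" "Gam t2 (1/q) Y = cpw t2 a * Y * cpw t2 a"
    "Gam \<tau> (- (1/q)) Y = cpw \<tau> (- a) * Y * cpw \<tau> (- a)" "Gam t2 (- (1/q)) Y = cpw t2 (- a) * Y * cpw t2 (- a)" for Y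
    using Gam_cpw[OF pt, of "1/q"] Gam_cpw[OF p2, of "1/q"] Gam_cpw[OF pt, of "- (1/q)"] Gam_cpw[OF p2, of "- (1/q)"]
    by (simp_all add: a_def)
  have Xe: "Gam \<tau> (- (1/q)) Z = C (- a) * X2 * C (- a)"
  proof -
    have "Gam \<tau> (- (1/q)) Z = (C (- a) * cpw t2 (- a)) * Z * (cpw t2 (- a) * C (- a))" unfolding G Ct ..
    thus ?thesis unfolding X2_def G using Z dZ by (simp add: mat_assoc)
  qed
  have "ampl k m L (C (- a) * X2 * C (- a)) = C (- a) * ampl k m L X2 * C (- a)"
    unfolding C_def by (simp add: ampl_mult_right[OF L] ampl_mult_left[OF L])
  hence V: "Gam \<tau> (1/q) (ampl k m L (Gam \<tau> (- (1/q)) Z)) = Gam t2 (1/q) (ampl k m L X2)"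
  proof -
    assume e: "ampl k m L (C (- a) * X2 * C (- a)) = C (- a) * ampl k m L X2 * C (- a)"
    have "Gam \<tau> (1/q) (ampl k m L (Gam \<tau> (- (1/q)) Z)) = (cpw t2 a * C a) * (C (- a) * ampl k m L X2 * C (- a)) * (C a * cpw t2 a)"
      by (simp only: Xe e G(1) Ct)
    \<comment> \<open>Once the conversion factors have been pulled through
      \<open>id \<otimes> L\<close>, they cancel against those of the outer weight.\<close>
    also have "\<dots> = cpw t2 a * (C a * C (- a)) * ampl k m L X2 * (C (- a) * C a) * cpw t2 a" by (simp add: mat_assoc)
    finally show ?thesis unfolding CC G by (simp add: mat_one_right)
  qed
  define V where "V = Gam t2 (1/q) (ampl k m L X2)"
  have dV [simp]: "dim_row V = ?n" "dim_col V = ?n" using p2 d2 by (simp_all add: V_def)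
  have "dirV q \<tau> Z V = dirV q t2 Z V"
  proof (cases "q = 1")
    case False thus ?thesis by (simp add: dirV_def)
  next
    case True
    \<comment> \<open>For \<open>q = 1\<close> the reference also occurs inside a logarithm. The two
      logarithms differ by \<open>h \<otimes> 1\<close>, whose pairing with \<open>V\<close> becomes
      a trace of the generator against \<open>\<sigma>\<close> and vanishes.\<close>
    define h where "h = mlog \<gamma> - r \<cdot>\<^sub>m 1\<^sub>m k"
    have dh [simp]: "dim_row h = k" "dim_col h = k" by (auto simp: h_def)
    have l: "mlog \<tau> - mlog t2 = kron h (1\<^sub>m m)"
      unfolding \<tau>_def t2_def mlog_tau[OF k ps] mlog_kron[OF g(1) ps] ds g(2) r_def[symmetric] h_def kron_one[symmetric]
      by (rule eq_mat_idxI[of _ k m]) (auto simp: kron_entry idx_less)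
    have a2: "a = 1/2" by (simp add: a_def True)
    have "mtrace (V * kron h (1\<^sub>m m)) = mtrace (cpw t2 a * ampl k m L X2 * (cpw t2 a * kron h (1\<^sub>m m)))"
      unfolding V_def G by (simp add: mat_assoc)
    also have "\<dots> = mtrace ((cpw t2 a * kron h (1\<^sub>m m)) * (cpw t2 a * ampl k m L X2))"
      by (rule mtrace_cyc) auto
    also have "\<dots> = mtrace ((cpw t2 a * kron h (1\<^sub>m m) * cpw t2 a) * ampl k m L X2)" by (simp add: mat_assoc)
    also have "cpw t2 a * kron h (1\<^sub>m m) * cpw t2 a = kron (exp (a * r) * exp (a * r) \<cdot>\<^sub>m h) \<sigma>"
      unfolding c2 using cpw_mult[OF ps, of a a] ds
      by (simp add: mat_smult_left mat_smult_right kron_smult_left kron_mult mat_one_left mat_one_right smult_smult_mat a2 cpw_1[OF ps])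
    also have "mtrace (kron (exp (a * r) * exp (a * r) \<cdot>\<^sub>m h) \<sigma> * ampl k m L X2) = 0 * mtrace (kron (exp (a * r) * exp (a * r) \<cdot>\<^sub>m h) \<sigma> * X2)"
      by (rule mtrace_kron_ampl[OF L]) (simp_all add: generator_invariant[OF P] ds)
    finally have z: "mtrace (V * (mlog \<tau> - mlog t2)) = 0" by (simp add: l)
    have sub: "mtrace (V * (A - B)) = mtrace (V * A) - mtrace (V * B)"
      if "dim_row A = ?n" "dim_col A = ?n" "dim_row B = ?n" "dim_col B = ?n" for A B
    proof -
      have "V * (A - B) = V * A - V * B"
        by (rule mult_minus_distrib_mat[of V ?n ?n]) (use that in \<open>auto intro!: carrier_matI\<close>)
      thus ?thesis by (simp add: mtrace_minus that)
    qed
    show ?thesis using z True by (simp add: dirV_def sub)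
  qed
  hence "dirV q \<tau> Z (Gam \<tau> (1/q) (ampl k m L (Gam \<tau> (- (1/q)) Z))) = dirV q t2 Z (Gam t2 (1/q) (ampl k m L X2))"
    unfolding V V_def .
  moreover have "c' * dirV q t2 Z (Gam t2 (1/q) (ampl k m L X2)) \<le> c * dirV q t2 Z (Gam t2 (1/q) (ampl k m L X2))"
    using nonneg c by (rule mult_right_mono[rotated])
  ultimately show ?thesis using main by simp
qed

section \<open>Subadditivity of the entropy over two factors\<close>

lemma ptrace_reindex:
  assumes "dim_row W = k * m1 * m2" "dim_col W = k * m1 * m2"
  shows "ptrace k m2 (ptrace (k * m2) m1 (reindex (sw m1 m2) W)) = ptrace k m1 (ptrace (k * m1) m2 W)"
proof (rule eq_matI)
  fix a b assume "a < dim_row (ptrace k m1 (ptrace (k * m1) m2 W))" "b < dim_col (ptrace k m1 (ptrace (k * m1) m2 W))"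
  hence ab: "a < k" "b < k" by auto
  have l: "(x * m2 + c) * m1 + r < k * m1 * m2" if "x < k" "c < m2" "r < m1" for x c r
    using idx_less[OF idx_less[OF that(1,2)] that(3)] by (simp add: mult.commute mult.left_commute)
  have "ptrace k m2 (ptrace (k * m2) m1 (reindex (sw m1 m2) W)) $$ (a,b) =
     (\<Sum>c<m2. \<Sum>r<m1. reindex (sw m1 m2) W $$ ((a * m2 + c) * m1 + r, (b * m2 + c) * m1 + r))"
    using ab by (simp add: ptrace_def idx_less)
  also have "\<dots> = (\<Sum>c<m2. \<Sum>r<m1. W $$ ((a * m1 + r) * m2 + c, (b * m1 + r) * m2 + c))"
    using ab l assms by (intro sum.cong refl) (simp add: reindex_entry sw_idx)
  also have "\<dots> = (\<Sum>r<m1. \<Sum>c<m2. W $$ ((a * m1 + r) * m2 + c, (b * m1 + r) * m2 + c))" by (rule sum.swap)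
  also have "\<dots> = ptrace k m1 (ptrace (k * m1) m2 W) $$ (a,b)" using ab by (simp add: ptrace_def idx_less)
  finally show "ptrace k m2 (ptrace (k * m2) m1 (reindex (sw m1 m2) W)) $$ (a,b) = ptrace k m1 (ptrace (k * m1) m2 W) $$ (a,b)" .
qed auto

text \<open>The matrix \<open>Y\<close> lives on the ancilla and the second factor. After the
  exchange the identity sits in the middle, so tracing out the last factor reduces \<open>Y\<close>
  and keeps the identity.\<close>

lemma ptrace_swap_kron:
  assumes "dim_row Y = k * m2" "dim_col Y = k * m2"
  shows "ptrace (k * m1) m2 (reindex (sw m2 m1) (kron Y (1\<^sub>m m1))) = kron (ptrace k m2 Y) (1\<^sub>m m1)"
proof (rule eq_mat_idxI[of _ k m1])
  fix a b r s assume l: "a < k" "b < k" "r < m1" "s < m1"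
  have t: "(x * m1 + r) * m2 + c < k * m2 * m1" if "x < k" "c < m2" "r < m1" for x c r
    using idx_less[OF idx_less[OF that(1,3)] that(2)] by (simp add: mult.commute mult.left_commute)
  have "ptrace (k * m1) m2 (reindex (sw m2 m1) (kron Y (1\<^sub>m m1))) $$ (a * m1 + r, b * m1 + s) =
     (\<Sum>c<m2. reindex (sw m2 m1) (kron Y (1\<^sub>m m1)) $$ ((a * m1 + r) * m2 + c, (b * m1 + s) * m2 + c))"
    using l by (simp add: ptrace_def idx_less)
  also have "\<dots> = (\<Sum>c<m2. kron Y (1\<^sub>m m1) $$ ((a * m2 + c) * m1 + r, (b * m2 + c) * m1 + s))"
    using l t assms by (intro sum.cong refl) (simp add: reindex_entry sw_idx)
  also have "\<dots> = (\<Sum>c<m2. Y $$ (a * m2 + c, b * m2 + c) * (if r = s then 1 else 0))"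
    using l assms by (intro sum.cong refl) (simp add: kron_entry idx_less)
  also have "\<dots> = kron (ptrace k m2 Y) (1\<^sub>m m1) $$ (a * m1 + r, b * m1 + s)"
    using l by (simp add: kron_entry idx_less ptrace_def)
  finally show "ptrace (k * m1) m2 (reindex (sw m2 m1) (kron Y (1\<^sub>m m1))) $$ (a * m1 + r, b * m1 + s) =
     kron (ptrace k m2 Y) (1\<^sub>m m1) $$ (a * m1 + r, b * m1 + s)" .
qed auto

lemma reindex_mlog:
  assumes "bij_betw p {..<n} {..<n}" "pos_def A" "dim_row A = n"
  shows "mlog (reindex p A) = reindex p (mlog A)"
  unfolding mlog_cfun by (rule reindex_cfun(1)[OF assms])

lemma reindex_cpw:
  assumes "bij_betw p {..<n} {..<n}" "pos_def A" "dim_row A = n"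
  shows "cpw (reindex p A) z = reindex p (cpw A z)"
  unfolding cpw_def by (rule reindex_cfun(1)[OF assms])

text \<open>The logarithm of a matrix tensored with the identity is again of that form, so its
  expectation in \<open>W\<close> sees only the partial trace of \<open>W\<close>.\<close>

lemma mtrace_kron_one_log:
  assumes "dim_row W = k * m" "dim_col W = k * m" "pos_def (ptrace k m W)"
  shows "mtrace (W * mlog (kron (ptrace k m W) (1\<^sub>m m))) = mtrace (ptrace k m W * mlog (ptrace k m W))"
proof -
  note d = mlog_dim[OF assms(3)]
  have "mtrace (W * mlog (kron (ptrace k m W) (1\<^sub>m m))) = mtrace (kron (mlog (ptrace k m W)) (1\<^sub>m m) * W)"
    unfolding mlog_kron_one[OF assms(3)] by (rule mtrace_cyc) (use assms d in auto)
  also have "\<dots> = mtrace (mlog (ptrace k m W) * ptrace k m W)" by (rule mtrace_kron_one_mult) (use assms d in auto)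
  also have "\<dots> = mtrace (ptrace k m W * mlog (ptrace k m W))" by (rule mtrace_cyc) (use d in auto)
  finally show ?thesis .
qed

text \<open>The terms with \<open>mlog \<sigma>1\<close> and \<open>mlog \<sigma>2\<close> add up
  exactly. The difference of the two sides is
  \<open>Tr W ln W + Tr WA ln WA - Tr W1 ln W1 - Tr W2 ln W2\<close>, nonnegative by strong
  subadditivity; \<open>W1\<close> and \<open>W2\<close> arise because either entropy keeps the
  other factor in its ancilla.\<close>

theorem ent_subadditive:
  assumes W: "pos_def W" "dim_row W = k * m1 * m2" and m: "m1 \<ge> 1" "m2 \<ge> 1"
    and s1: "pos_def \<sigma>1" "dim_row \<sigma>1 = m1" and s2: "pos_def \<sigma>2" "dim_row \<sigma>2 = m2"
  shows "ent k (m1 * m2) (kron \<sigma>1 \<sigma>2) W \<le> ent (k * m2) m1 \<sigma>1 (reindex (sw m1 m2) W) + ent (k * m1) m2 \<sigma>2 W"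
proof -
  let ?n = "k * m1 * m2"
  have nn: "k * m2 * m1 = ?n" "k * (m1 * m2) = ?n" by simp_all
  have dW: "dim_col W = ?n" using pos_def_dim[OF W(1)] W(2) by simp
  note bij = sw_bij[of ?n k m1 m2, OF refl] sw_bij[of ?n k m2 m1, OF nn(1)[symmetric]]
  define S where "S = reindex (sw m1 m2) W"
  have dS: "dim_row S = k * m2 * m1" "dim_col S = k * m2 * m1" by (simp_all add: S_def W dW)
  have pS: "pos_def S" unfolding S_def by (rule reindex_cfun(2)[OF bij(1) W])
  have SW: "reindex (sw m2 m1) S = W" unfolding S_def by (rule reindex_reindex[OF W(2) dW])
  define W1 where "W1 = ptrace (k * m1) m2 W"
  define W2 where "W2 = ptrace (k * m2) m1 S"
  define WA where "WA = ptrace k m1 W1"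
  have p1: "pos_def W1" unfolding W1_def by (rule pos_def_ptrace[OF W m(2)])
  have p2: "pos_def W2" unfolding W2_def by (rule pos_def_ptrace[OF pS dS(1) m(1)])
  have d12 [simp]: "dim_row W1 = k * m1" "dim_col W1 = k * m1" "dim_row W2 = k * m2" "dim_col W2 = k * m2" "dim_row WA = k" "dim_col WA = k"
    by (auto simp: W1_def W2_def WA_def)
  have pA: "pos_def WA" unfolding WA_def by (rule pos_def_ptrace[OF p1 d12(1) m(1)])
  have WA2: "WA = ptrace k m2 W2" unfolding WA_def W1_def W2_def S_def by (rule ptrace_reindex[OF W(2) dW, symmetric])
  have WA3: "WA = ptrace k (m1 * m2) W" unfolding WA_def W1_def by (rule ptrace_ptrace)
  define R1 where "R1 = kron W1 (1\<^sub>m m2)"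
  define R2 where "R2 = reindex (sw m2 m1) (kron W2 (1\<^sub>m m1))"
  define RA where "RA = kron WA (1\<^sub>m (m1 * m2))"
  have dR [simp]: "dim_row R1 = ?n" "dim_col R1 = ?n" "dim_row R2 = ?n" "dim_col R2 = ?n" "dim_row RA = ?n" "dim_col RA = ?n"
    by (simp_all add: R1_def R2_def RA_def)
  have pR1: "pos_def R1" unfolding R1_def by (rule pos_def_kron[OF p1 pos_def_one])
  have pK2: "pos_def (kron W2 (1\<^sub>m m1))" by (rule pos_def_kron[OF p2 pos_def_one])
  have dK2: "dim_row (kron W2 (1\<^sub>m m1)) = ?n" by simp
  have pR2: "pos_def R2" unfolding R2_def by (rule reindex_cfun(2)[OF bij(2) pK2 dK2])
  have pRA: "pos_def RA" unfolding RA_def by (rule pos_def_kron[OF pA pos_def_one])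
  note DA [simp] = cpw_dim[OF pA, unfolded d12] cpw_dim[OF pRA, unfolded dR]
  have H: "mtrace (R1 * (cpw RA (Complex (-1/2) y) * (R2 * cpw RA (Complex (-1/2) (-y))))) = mtrace W" for y
  proof -
    let ?c = "\<lambda>z. cpw WA z"
    have cRA: "cpw RA z = kron (kron (?c z) (1\<^sub>m m1)) (1\<^sub>m m2)" for z
      unfolding RA_def cpw_kron[OF pA pos_def_one] cpw_one kron_assoc kron_one ..
    define z1 z2 where "z1 = Complex (-1/2) y" and "z2 = Complex (-1/2) (-y)"
    have dc [simp]: "dim_row (kron (?c z) (1\<^sub>m m1)) = k * m1" "dim_col (kron (?c z) (1\<^sub>m m1)) = k * m1" for z by auto
    have "mtrace (R1 * (cpw RA z1 * (R2 * cpw RA z2))) = mtrace (W1 * ptrace (k * m1) m2 (cpw RA z1 * (R2 * cpw RA z2)))"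
      unfolding R1_def by (rule mtrace_kron_one_mult) auto
    \<comment> \<open>Powers of \<open>RA\<close> act on the ancilla alone and pass through the
      partial trace, so \<open>R2\<close> is reduced to \<open>WA\<close>.\<close>
    also have "ptrace (k * m1) m2 (cpw RA z1 * (R2 * cpw RA z2)) =
       kron (?c z1) (1\<^sub>m m1) * (ptrace (k * m1) m2 R2 * kron (?c z2) (1\<^sub>m m1))"
      unfolding cRA by (subst ptrace_mult_left; (simp; fail)?) (subst ptrace_mult_right; simp)
    also have "ptrace (k * m1) m2 R2 = kron WA (1\<^sub>m m1)" unfolding R2_def WA2 by (rule ptrace_swap_kron) auto
    also have "kron (?c z1) (1\<^sub>m m1) * (kron WA (1\<^sub>m m1) * kron (?c z2) (1\<^sub>m m1)) = kron (?c z1 * (WA * ?c z2)) (1\<^sub>m m1)"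
      by (simp add: kron_mult mat_one_left)
    also have "mtrace (W1 * kron (?c z1 * (WA * ?c z2)) (1\<^sub>m m1)) = mtrace (kron (?c z1 * (WA * ?c z2)) (1\<^sub>m m1) * W1)"
      by (rule mtrace_cyc) auto
    also have "\<dots> = mtrace ((?c z1 * (WA * ?c z2)) * WA)" 
      using mtrace_kron_one_mult[of W1 k m1 "?c z1 * (WA * ?c z2)"] by (simp add: WA_def[symmetric])
    also have "\<dots> = mtrace (?c z1 * (?c 1 * (?c z2 * ?c 1)))" unfolding cpw_1[OF pA] by (simp add: mat_assoc)
    also have "\<dots> = mtrace (?c (z1 + (1 + (z2 + 1))))" by (simp add: cpw_mult[OF pA])
    \<comment> \<open>The imaginary parts cancel, and the two powers \<open>-1/2\<close> compensate
      one of the two copies of \<open>WA\<close>.\<close>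
    also have "z1 + (1 + (z2 + 1)) = 1" by (simp add: z1_def z2_def complex_eq_iff)
    also have "mtrace (?c 1) = mtrace W" 
      using mtrace_ptrace[of W k "m1 * m2"] W(2) by (simp add: cpw_1[OF pA] WA3[symmetric] mult.assoc)
    finally show ?thesis unfolding z1_def z2_def .
  qed
  have key: "Re (mtrace (W * mlog R1)) + Re (mtrace (W * mlog R2)) \<le> Re (mtrace (W * mlog W)) + Re (mtrace (W * mlog RA))"
    by (rule trace_log_inequality[OF W(1) pR1 pR2 pRA W(2) _ _ _ H]) simp_all
  have t1: "mtrace (W * mlog R1) = mtrace (W1 * mlog W1)"
    unfolding R1_def W1_def by (rule mtrace_kron_one_log) (use W dW p1 in \<open>simp_all add: W1_def\<close>)
  have t2: "mtrace (W * mlog R2) = mtrace (W2 * mlog W2)"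
  proof -
    have "mtrace (W * mlog R2) = mtrace (reindex (sw m2 m1) (S * mlog (kron W2 (1\<^sub>m m1))))"
      unfolding R2_def reindex_mlog[OF bij(2) pK2 dK2] using dS mlog_dim[OF pK2] SW
      by (subst reindex_mult[OF bij(2)]) simp_all
    also have "\<dots> = mtrace (S * mlog (kron W2 (1\<^sub>m m1)))"
      by (rule reindex_mtrace[OF bij(2)]) (use dS mlog_dim[OF pK2] in simp_all)
    also have "\<dots> = mtrace (W2 * mlog W2)"
      unfolding W2_def by (rule mtrace_kron_one_log) (use dS p2 in \<open>simp_all add: W2_def\<close>)
    finally show ?thesis .
  qed
  have tA: "mtrace (W * mlog RA) = mtrace (WA * mlog WA)"
    unfolding RA_def WA3 by (rule mtrace_kron_one_log) (use W dW pA in \<open>simp_all add: WA3 mult.assoc\<close>)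
  have tS: "mtrace (S * mlog S) = mtrace (W * mlog W)"
  proof -
    have "mtrace (S * mlog S) = mtrace (reindex (sw m1 m2) (W * mlog W))"
      unfolding S_def reindex_mlog[OF bij(1) W] using W dW mlog_dim[OF W(1)] by (subst reindex_mult[OF bij(1)]) simp_all
    thus ?thesis using reindex_mtrace[OF bij(1), of "W * mlog W"] W mlog_dim[OF W(1)] by simp
  qed
  note ms = mlog_dim[OF s1(1), unfolded s1(2)] mlog_dim[OF s2(1), unfolded s2(2)]
  have ts: "mtrace (W * kron (1\<^sub>m k) (mlog (kron \<sigma>1 \<sigma>2))) =
     mtrace (S * kron (1\<^sub>m (k * m2)) (mlog \<sigma>1)) + mtrace (W * kron (1\<^sub>m (k * m1)) (mlog \<sigma>2))"
  proof -
    have kadd: "kron A (B + D) = kron A B + kron A D" if "dim_row B = dim_row D" "dim_col B = dim_col D" for A B D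
      using that by (intro eq_matI) (auto simp: kron_entry mod_less_idx ring_distribs)
    have "kron (1\<^sub>m k) (mlog (kron \<sigma>1 \<sigma>2)) = kron (kron (1\<^sub>m k) (mlog \<sigma>1)) (1\<^sub>m m2) + kron (1\<^sub>m (k * m1)) (mlog \<sigma>2)"
      unfolding mlog_kron[OF s1(1) s2(1)] s1 s2 using ms by (simp add: kadd kron_assoc[symmetric] kron_one)
    hence "mtrace (W * kron (1\<^sub>m k) (mlog (kron \<sigma>1 \<sigma>2))) =
      mtrace (W * kron (kron (1\<^sub>m k) (mlog \<sigma>1)) (1\<^sub>m m2)) + mtrace (W * kron (1\<^sub>m (k * m1)) (mlog \<sigma>2))"
      using ms W dW by (simp add: mat_distrib_left mtrace_add)
    also have "mtrace (W * kron (kron (1\<^sub>m k) (mlog \<sigma>1)) (1\<^sub>m m2)) = mtrace (reindex (sw m1 m2) (W * kron (kron (1\<^sub>m k) (mlog \<sigma>1)) (1\<^sub>m m2)))"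
      by (rule reindex_mtrace[OF bij(1), symmetric]) (use ms W dW in simp_all)
    also have "reindex (sw m1 m2) (W * kron (kron (1\<^sub>m k) (mlog \<sigma>1)) (1\<^sub>m m2)) = S * kron (1\<^sub>m (k * m2)) (mlog \<sigma>1)"
      unfolding S_def using ms W dW
      by (subst reindex_mult[OF bij(1)]) (simp_all add: reindex_kron[where k=k] kron_one)
    finally show ?thesis .
  qed
  show ?thesis unfolding ent_def S_def[symmetric] W1_def[symmetric] W2_def[symmetric] WA3[symmetric]
    using key t1 t2 tA tS ts by simp
qed

section \<open>Combining the inequalities of two factors\<close>

lemma dirV_add:
  assumes "dim_row V1 = n" "dim_col V1 = n" "dim_row V2 = n" "dim_col V2 = n" "pos_def Z" "dim_row Z = n" "pos_def \<tau>" "dim_row \<tau> = n"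
  shows "dirV q \<tau> Z (V1 + V2) = dirV q \<tau> Z V1 + dirV q \<tau> Z V2"
  using assms mlog_dim[OF assms(5)] mlog_dim[OF assms(7)] cpw_dim[OF assms(5)]
  by (simp add: dirV_def mat_distrib_left mat_distrib_right mtrace_add ring_distribs del: of_real_diff)

lemma dirV_reindex:
  assumes b: "bij_betw p {..<n} {..<n}" and V: "dim_row V = n" "dim_col V = n"
    and Z: "pos_def Z" "dim_row Z = n" and t: "pos_def \<tau>" "dim_row \<tau> = n"
  shows "dirV q (reindex p \<tau>) (reindex p Z) (reindex p V) = dirV q \<tau> Z V"
proof -
  have sub: "reindex p A - reindex p B = reindex p (A - B)" if "dim_row A = n" "dim_col A = n" "dim_row B = n" "dim_col B = n" for A B
    using that reindex_lt[OF b] by (intro eq_matI) (auto simp: reindex_entry)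
  show ?thesis unfolding dirV_def reindex_mlog[OF b Z] reindex_mlog[OF b t] reindex_cpw[OF b Z]
    using V Z t mlog_dim[OF Z(1)] mlog_dim[OF t(1)] cpw_dim[OF Z(1)]
    by (simp add: sub reindex_mult[OF b, symmetric] reindex_mtrace[OF b] del: of_real_diff)
qed

lemma reindex_Gam:
  assumes b: "bij_betw p {..<n} {..<n}" and t: "pos_def \<tau>" "dim_row \<tau> = n" and X: "dim_row X = n" "dim_col X = n"
  shows "reindex p (Gam \<tau> s X) = Gam (reindex p \<tau>) s (reindex p X)"
  unfolding Gam_cpw[OF t(1)] Gam_cpw[OF reindex_cfun(2)[OF b t]] reindex_cpw[OF b t]
  using X t cpw_dim[OF t(1)] by (simp add: reindex_mult[OF b])

context tensor_pair
begin

text \<open>Both hypotheses are applied to the same \<open>Z\<close>, once as it stands and once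
  with the factors exchanged, so \<open>W\<close> and its trace are common to all terms. The two
  norm terms therefore add, which produces \<open>d1 + d2\<close>, whereas the two Dirichlet forms
  sum to one form and only the larger constant is needed.\<close>

lemma tensor_lsi:
  assumes P1: "primitive_QMS m1 L1 \<sigma>1" and P2: "primitive_QMS m2 L2 \<sigma>2" and q: "q \<ge> 1"
    and lsi1: "LSI_CB q c1 d1 m1 L1 \<sigma>1" and lsi2: "LSI_CB q c2 d2 m2 L2 \<sigma>2"
  shows "LSI_CB q (max c1 c2) (d1 + d2) (m1 * m2) L (kron \<sigma>1 \<sigma>2)"
  unfolding LSI_CB_def
proof (intro allI impI ballI)
  fix k X assume k: "1 \<le> (k::nat)" and XC: "X \<in> carrier_mat (k * (m1 * m2)) (k * (m1 * m2))" and pX: "pos_def X"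
  note ds1 = primitiveD(3,4)[OF P1] and ds2 = primitiveD(3,4)[OF P2] and m = primitiveD(1)[OF P1] primitiveD(1)[OF P2]
    and ps1 = primitiveD(5)[OF P1] and ps2 = primitiveD(5)[OF P2]
  let ?n = "k * m1 * m2" and ?c = "max c1 c2" and ?\<sigma> = "kron \<sigma>1 \<sigma>2"
  have nn: "k * m2 * m1 = ?n" "k * (m1 * m2) = ?n" by simp_all
  have dX: "dim_row X = ?n" "dim_col X = ?n" using XC by (auto simp: mult.assoc)
  note bij = sw_bij[of ?n k m1 m2, OF refl] sw_bij[of ?n k m2 m1, OF nn(1)[symmetric]]
  have ps: "pos_def ?\<sigma>" by (rule pos_def_kron[OF ps1 ps2])
  define \<tau> where "\<tau> = tau k ?\<sigma>"
  have pt: "pos_def \<tau>" unfolding \<tau>_def by (rule pos_def_tau[OF k ps])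
  have dt: "dim_row \<tau> = ?n" by (simp add: \<tau>_def ds1 ds2)
  have dt': "dim_col \<tau> = ?n" using pos_def_dim[OF pt] dt by simp
  \<comment> \<open>The second factor sees an ancilla of dimension \<open>k * m1\<close> weighted by
    \<open>tau k \<sigma>1\<close>, hence the need for a reference other than a normalised
    identity.\<close>
  have tk: "\<tau> = kron (tau k \<sigma>1) \<sigma>2" unfolding \<tau>_def tau_def by (rule kron_assoc[symmetric])
  define Z where "Z = Gam \<tau> (1/q) X"
  have pZ: "pos_def Z" unfolding Z_def by (rule pos_def_Gam[OF pt pX]) (simp add: dX dt)
  have dZ: "dim_row Z = ?n" using pt dt by (simp add: Z_def)
  have dZ': "dim_col Z = ?n" using pos_def_dim[OF pZ] dZ by simp
  have ZX: "Gam \<tau> (- (1/q)) Z = X" unfolding Z_def by (rule Gam_Gam[OF pt]) (simp_all add: dX dt)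
  define W where "W = cpw Z (complex_of_real q)"
  have pW: "pos_def W" unfolding W_def by (rule pos_def_cpw[OF pZ])
  have dW: "dim_row W = ?n" using cpw_dim[OF pZ] dZ by (simp add: W_def)
  have dW': "dim_col W = ?n" using pos_def_dim[OF pW] dW by simp
  define sZ where "sZ = reindex (sw m1 m2) Z"
  have psZ: "pos_def sZ" unfolding sZ_def by (rule reindex_cfun(2)[OF bij(1) pZ dZ])
  have dsZ: "dim_row sZ = k * m2 * m1" by (simp add: sZ_def dZ)
  have sW: "cpw sZ (complex_of_real q) = reindex (sw m1 m2) W" unfolding sZ_def W_def by (rule reindex_cpw[OF bij(1) pZ dZ])
  \<comment> \<open>After the exchange \<open>\<sigma>1\<close> stands last and
    \<open>tau k \<sigma>2\<close> is the weight of the ancilla.\<close>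
  have st: "reindex (sw m1 m2) \<tau> = kron (tau k \<sigma>2) \<sigma>1"
    unfolding tk tau_def by (rule reindex_kron) (simp_all add: ds1 ds2)
  define sX where "sX = reindex (sw m1 m2) X"
  have sGX: "Gam (kron (tau k \<sigma>2) \<sigma>1) (- (1/q)) sZ = sX"
    unfolding sX_def sZ_def st[symmetric] ZX[symmetric] by (rule reindex_Gam[OF bij(1) pt dt dZ dZ', symmetric])
  define A1 where "A1 = reindex (sw m2 m1) (ampl (k * m2) m1 L1 sX)"
  define A2 where "A2 = ampl (k * m1) m2 L2 X"
  have dA [simp]: "dim_row A1 = ?n" "dim_col A1 = ?n" "dim_row A2 = ?n" "dim_col A2 = ?n" by (auto simp: A1_def A2_def)
  have sA1: "reindex (sw m1 m2) A1 = ampl (k * m2) m1 L1 sX"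
    unfolding A1_def by (rule reindex_reindex[of _ k]) auto
  have AL: "ampl k (m1 * m2) L X = A1 + A2"
  proof -
    have "ampl k (m1 * m2) L X = ampl k (m1 * m2) (\<lambda>Y. ampl_mid 1 m1 m2 L1 Y + ampl m1 m2 L2 Y) X"
      by (rule ampl_cong) (simp add: L_eq ampl_mid_right)
    also have "\<dots> = ampl k (m1 * m2) (ampl_mid 1 m1 m2 L1) X + ampl k (m1 * m2) (ampl m1 m2 L2) X"
      by (rule eq_mat_idxI[of _ k "m1 * m2"]) (simp_all add: ampl_idx idx_less)
    finally show ?thesis unfolding ampl_ampl ampl_ampl_mid[OF dX] A1_def A2_def sX_def .
  qed
  define V1 V2 where "V1 = Gam \<tau> (1/q) A1" and "V2 = Gam \<tau> (1/q) A2"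
  have dV: "dim_row V1 = ?n" "dim_col V1 = ?n" "dim_row V2 = ?n" "dim_col V2 = ?n"
    using Gam_dim[OF pt] dt by (auto simp: V1_def V2_def)
  have dir: "dirichlet k (m1 * m2) L ?\<sigma> q X = dirV q \<tau> Z V1 + dirV q \<tau> Z V2"
  proof -
    have "dirichlet k (m1 * m2) L ?\<sigma> q X = dirV q \<tau> Z (Gam \<tau> (1/q) (ampl k (m1 * m2) L X))"
      unfolding \<tau>_def Z_def by (rule dirichlet_eq) (use pt pZ q in \<open>simp_all add: \<tau>_def Z_def ds1 ds2\<close>)
    also have "Gam \<tau> (1/q) (ampl k (m1 * m2) L X) = V1 + V2" unfolding AL V1_def V2_def by (rule Gam_add[OF pt]) (simp_all add: dt)
    finally show ?thesis using dirV_add[OF dV pZ dZ pt dt] by simp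
  qed
  have trW: "mtrace (reindex (sw m1 m2) W) = mtrace W" by (rule reindex_mtrace[OF bij(1) dW dW'])
  have h2: "1 / q * ent (k * m1) m2 \<sigma>2 W \<le> ?c * dirV q \<tau> Z V2 + 2 * d2 / q * Re (mtrace W)"
    using lsi_change_reference[OF P2 lsi2 q, of ?c "k * m1" "tau k \<sigma>1" Z] pos_def_tau[OF k ps1] pZ dZ one_le_mult[OF k m(1)] ds1
    unfolding tk[symmetric] ZX A2_def[symmetric] V2_def[symmetric] W_def[symmetric] by simp
  have h1: "1 / q * ent (k * m2) m1 \<sigma>1 (reindex (sw m1 m2) W) \<le> ?c * dirV q \<tau> Z V1 + 2 * d1 / q * Re (mtrace W)"
  proof -
    have "1 / q * ent (k * m2) m1 \<sigma>1 (cpw sZ (complex_of_real q)) \<le>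
      ?c * dirV q (kron (tau k \<sigma>2) \<sigma>1) sZ (Gam (kron (tau k \<sigma>2) \<sigma>1) (1/q) (ampl (k * m2) m1 L1 (Gam (kron (tau k \<sigma>2) \<sigma>1) (- (1/q)) sZ)))
      + 2 * d1 / q * Re (mtrace (cpw sZ (complex_of_real q)))"
      by (rule lsi_change_reference[OF P1 lsi1 q]) (use pos_def_tau[OF k ps2] psZ dsZ one_le_mult[OF k m(2)] ds2 in auto)
    also have "Gam (kron (tau k \<sigma>2) \<sigma>1) (1/q) (ampl (k * m2) m1 L1 (Gam (kron (tau k \<sigma>2) \<sigma>1) (- (1/q)) sZ)) = reindex (sw m1 m2) V1"
      using reindex_Gam[OF bij(1) pt dt, of A1 "1/q"] by (simp add: sGX sA1 V1_def st)
    also have "dirV q (kron (tau k \<sigma>2) \<sigma>1) sZ (reindex (sw m1 m2) V1) = dirV q \<tau> Z V1"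
      unfolding st[symmetric] sZ_def by (rule dirV_reindex[OF bij(1) dV(1,2) pZ dZ pt dt])
    finally show ?thesis unfolding sW trW .
  qed
  have "entropy k (m1 * m2) ?\<sigma> q X = 1 / q * ent k (m1 * m2) ?\<sigma> W"
    using entropy_eq[OF k one_le_mult[OF m] ps, of q X] pZ ds1 ds2 by (simp add: W_def Z_def \<tau>_def)
  also have "\<dots> \<le> 1 / q * (ent (k * m2) m1 \<sigma>1 (reindex (sw m1 m2) W) + ent (k * m1) m2 \<sigma>2 W)"
    using q ent_subadditive[OF pW dW m ps1 ds1(1) ps2 ds2(1)] by (intro mult_left_mono) auto
  also have "\<dots> \<le> ?c * dirV q \<tau> Z V1 + 2 * d1 / q * Re (mtrace W) + (?c * dirV q \<tau> Z V2 + 2 * d2 / q * Re (mtrace W))"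
    using add_mono[OF h1 h2] by (simp only: ring_distribs)
  also have "\<dots> = ?c * dirichlet k (m1 * m2) L ?\<sigma> q X + 2 * (d1 + d2) / q * (wnorm (tau k ?\<sigma>) q X) powr q"
    using wnorm_powr[of \<tau> q X] pZ q unfolding dir by (simp add: Z_def W_def \<tau>_def ring_distribs add_divide_distrib)
  finally show "entropy k (m1 * m2) ?\<sigma> q X \<le> ?c * dirichlet k (m1 * m2) L ?\<sigma> q X + 2 * (d1 + d2) / q * (wnorm (tau k ?\<sigma>) q X) powr q" .
qed

end

section \<open>Finitely many factors\<close>

lemma foldr_matrix_dim:
  assumes "\<And>i. i \<in> set xs \<Longrightarrow> dim_row (F i) = N \<and> dim_col (F i) = N"
  shows "dim_row (foldr (\<lambda>i Y. F i + Y) xs (0\<^sub>m N N)) = N \<and> dim_col (foldr (\<lambda>i Y. F i + Y) xs (0\<^sub>m N N)) = N"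
  using assms by (induction xs) auto

lemma foldr_matrix_entry:
  assumes "\<And>i. i \<in> set xs \<Longrightarrow> dim_row (F i) = N \<and> dim_col (F i) = N" "a < N" "b < N"
  shows "foldr (\<lambda>i Y. F i + Y) xs (0\<^sub>m N N) $$ (a,b) = (\<Sum>i\<leftarrow>xs. F i $$ (a,b))"
  using assms(1)
proof (induction xs)
  case (Cons x xs)
  thus ?case using foldr_matrix_dim[of xs F N] assms(2,3) by simp
qed (use assms in simp)

lemma prod_split_at:
  fixes dms :: "nat \<Rightarrow> nat"
  assumes "i < n"
  shows "(\<Prod>k<i. dms k) * dms i * (\<Prod>k\<in>{Suc i..<n}. dms k) = (\<Prod>k<n. dms k)"
proof -
  have "(\<Prod>k<n. dms k) = (\<Prod>k\<in>{0..<Suc i}. dms k) * (\<Prod>k\<in>{Suc i..<n}. dms k)"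
    using assms by (subst prod.atLeastLessThan_concat) (auto simp: lessThan_atLeast0)
  thus ?thesis by (simp add: lessThan_atLeast0)
qed

lemma tensor_generator_dim [simp]:
  "dim_row (tensor_generator n dms Ls X) = (\<Prod>k<n. dms k)" "dim_col (tensor_generator n dms Ls X) = (\<Prod>k<n. dms k)"
  unfolding tensor_generator_def
  using foldr_matrix_dim[of "[0..<n]" "\<lambda>i. ampl_mid (\<Prod>k<i. dms k) (dms i) (\<Prod>k\<in>{Suc i..<n}. dms k) (Ls i) X" "\<Prod>k<n. dms k"]
  by (simp_all add: prod_split_at)

lemma tensor_generator_entry:
  assumes "a < (\<Prod>k<n. dms k)" "b < (\<Prod>k<n. dms k)"
  shows "tensor_generator n dms Ls X $$ (a,b) =
    (\<Sum>i<n. ampl_mid (\<Prod>k<i. dms k) (dms i) (\<Prod>k\<in>{Suc i..<n}. dms k) (Ls i) X $$ (a,b))"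
proof -
  have "tensor_generator n dms Ls X $$ (a,b) =
    (\<Sum>i\<leftarrow>[0..<n]. ampl_mid (\<Prod>k<i. dms k) (dms i) (\<Prod>k\<in>{Suc i..<n}. dms k) (Ls i) X $$ (a,b))"
    unfolding tensor_generator_def using assms by (intro foldr_matrix_entry) (simp_all add: prod_split_at)
  thus ?thesis by (simp add: interv_sum_list_conv_sum_set_nat lessThan_atLeast0)
qed

text \<open>Fixing the last-factor components \<open>i mod e\<close> and \<open>j mod e\<close>
  gives a slice of \<open>X\<close> on the first three factors. Acting on slices is the same as
  acting on \<open>X\<close> with the last factor merged into the identity on the right.\<close>

lemma ampl_mid_nested:
  assumes "i < A * m * b * e" "j < A * m * b * e" and X: "dim_row X = A * m * b * e" "dim_col X = A * m * b * e"
  shows "ampl_mid A m b \<Phi> (mat (A * m * b) (A * m * b) (\<lambda>(r,s). X $$ (r * e + i mod e, s * e + j mod e))) $$ (i div e, j div e)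
    = ampl_mid A m (b * e) \<Phi> X $$ (i,j)"
proof -
  have l: "i div e < A * m * b" "j div e < A * m * b" using assms(1,2) by (auto intro: div_less_idx)
  have dm: "x div (b * e) = x div e div b" "x mod (b * e) = (x div e mod b) * e + x mod e" for x
    by (simp_all add: div_mult2_eq mod_mult2_eq mult.commute[of b e])
  have idx: "(y div b div m * m + r) * b + y mod b < A * m * b" if "y < A * m * b" "r < m" for y r
    using that div_less_idx[of y "A * m" b] div_less_idx[of "y div b" A m] mod_less_idx[of y "A * m" b]
    by (intro idx_less) auto
  have e: "(u * b + v) * e + w = u * (b * e) + (v * e + w)" for u v w :: nat by (simp add: ring_distribs)
  have "mat m m (\<lambda>(r,s). mat (A * m * b) (A * m * b) (\<lambda>(r,s). X $$ (r * e + i mod e, s * e + j mod e)) $$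
       ((i div e div b div m * m + r) * b + i div e mod b, (j div e div b div m * m + s) * b + j div e mod b))
    = mat m m (\<lambda>(r,s). X $$ ((i div (b * e) div m * m + r) * (b * e) + i mod (b * e), (j div (b * e) div m * m + s) * (b * e) + j mod (b * e)))"
    using l by (intro eq_matI) (simp_all add: idx dm e)
  thus ?thesis using l assms(1,2) by (simp add: ampl_mid_def dm(1) mult.assoc)
qed

text \<open>Each earlier summand merely gains one more identity on the right, so all of them
  together are the generator for \<open>n\<close> factors tensored with the identity.\<close>

lemma tensor_generator_Suc:
  assumes X: "dim_row X = (\<Prod>k<n. dms k) * dms n" "dim_col X = (\<Prod>k<n. dms k) * dms n"
  shows "tensor_generator (Suc n) dms Ls X =
    ampl_mid 1 (\<Prod>k<n. dms k) (dms n) (tensor_generator n dms Ls) X + ampl_mid (\<Prod>k<n. dms k) (dms n) 1 (Ls n) X"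
proof (rule eq_matI)
  let ?M = "\<Prod>k<n. dms k" and ?e = "dms n"
  fix i j assume "i < dim_row (ampl_mid 1 ?M ?e (tensor_generator n dms Ls) X + ampl_mid ?M ?e 1 (Ls n) X)"
    "j < dim_col (ampl_mid 1 ?M ?e (tensor_generator n dms Ls) X + ampl_mid ?M ?e 1 (Ls n) X)"
  hence ij: "i < ?M * ?e" "j < ?M * ?e" by auto
  note l = div_less_idx[OF ij(1)] div_less_idx[OF ij(2)]
  let ?Y = "mat ?M ?M (\<lambda>(r,s). X $$ (r * ?e + i mod ?e, s * ?e + j mod ?e))"
  have "ampl_mid 1 ?M ?e (tensor_generator n dms Ls) X $$ (i,j) = tensor_generator n dms Ls ?Y $$ (i div ?e, j div ?e)"
    using ij l by (simp add: ampl_mid_def)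
  also have "\<dots> = (\<Sum>p<n. ampl_mid (\<Prod>k<p. dms k) (dms p) (\<Prod>k\<in>{Suc p..<n}. dms k) (Ls p) ?Y $$ (i div ?e, j div ?e))"
    using l by (rule tensor_generator_entry)
  also have "\<dots> = (\<Sum>p<n. ampl_mid (\<Prod>k<p. dms k) (dms p) (\<Prod>k\<in>{Suc p..<Suc n}. dms k) (Ls p) X $$ (i,j))"
  proof (rule sum.cong[OF refl])
    fix p assume "p \<in> {..<n}"
    hence p: "p < n" by simp
    note split = prod_split_at[OF p, of dms]
    have "(\<Prod>k\<in>{Suc p..<Suc n}. dms k) = (\<Prod>k\<in>{Suc p..<n}. dms k) * ?e" using p by simp
    thus "ampl_mid (\<Prod>k<p. dms k) (dms p) (\<Prod>k\<in>{Suc p..<n}. dms k) (Ls p) ?Y $$ (i div ?e, j div ?e)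
      = ampl_mid (\<Prod>k<p. dms k) (dms p) (\<Prod>k\<in>{Suc p..<Suc n}. dms k) (Ls p) X $$ (i,j)"
      using ampl_mid_nested[of i "\<Prod>k<p. dms k" "dms p" "\<Prod>k\<in>{Suc p..<n}. dms k" ?e j X "Ls p"] ij X
      unfolding split by simp
  qed
  finally have "ampl_mid 1 ?M ?e (tensor_generator n dms Ls) X $$ (i,j) =
     (\<Sum>p<n. ampl_mid (\<Prod>k<p. dms k) (dms p) (\<Prod>k\<in>{Suc p..<Suc n}. dms k) (Ls p) X $$ (i,j))" .
  moreover have "tensor_generator (Suc n) dms Ls X $$ (i,j) =
     (\<Sum>p<Suc n. ampl_mid (\<Prod>k<p. dms k) (dms p) (\<Prod>k\<in>{Suc p..<Suc n}. dms k) (Ls p) X $$ (i,j))"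
    using ij by (intro tensor_generator_entry) simp_all
  ultimately show "tensor_generator (Suc n) dms Ls X $$ (i,j) =
     (ampl_mid 1 ?M ?e (tensor_generator n dms Ls) X + ampl_mid ?M ?e 1 (Ls n) X) $$ (i,j)"
    using ij by simp
qed auto

text \<open>Equality of generators is available on square matrices of the right size only. These
  congruence rules carry the semigroup, primitivity and the inequality across such an
  equality.\<close>

lemma sexp_cong:
  assumes L: "superop m L" and eq: "\<And>X. X \<in> carrier_mat m m \<Longrightarrow> L' X = L X" and X: "X \<in> carrier_mat m m"
  shows "sexp m t L' X = sexp m t L X"
proof -
  have "(L' ^^ n) X = (L ^^ n) X \<and> (L ^^ n) X \<in> carrier_mat m m" for n
  proof (induction n)
    case (Suc n)
    thus ?case using eq L by (auto simp: superop_def)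
  qed (use X in auto)
  thus ?thesis by (simp add: sexp_def)
qed

lemma primitive_QMS_cong:
  assumes P: "primitive_QMS m L \<sigma>" and eq: "\<And>X. X \<in> carrier_mat m m \<Longrightarrow> L' X = L X"
  shows "primitive_QMS m L' \<sigma>"
proof -
  note L = primitiveD(2)[OF P]
  note s = sexp_cong[OF L eq]
  have a: "ampl k m (sexp m t L') X = ampl k m (sexp m t L) X" for k t X
    by (rule ampl_cong) (rule s, auto intro: carrier_matI)
  have "superop m L'" using L unfolding superop_def by (simp add: eq)
  hence "is_QMS m L'"
    using P by (simp add: primitive_QMS_def is_QMS_def completely_positive_def a s)
  moreover have "invariant_state m L' \<rho> \<longleftrightarrow> invariant_state m L \<rho>" for \<rho>
    by (simp add: invariant_state_def s)
  ultimately show ?thesis using P by (simp add: primitive_QMS_def s)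
qed

lemma LSI_CB_cong:
  assumes "LSI_CB q c d m L \<sigma>" and eq: "\<And>X. X \<in> carrier_mat m m \<Longrightarrow> L' X = L X"
  shows "LSI_CB q c d m L' \<sigma>"
proof -
  have "ampl k m L' = ampl k m L" for k
    by (rule ext, rule ampl_cong) (rule eq, auto intro: carrier_matI)
  thus ?thesis using assms(1) by (simp add: LSI_CB_def dirichlet_def)
qed

lemma kron_list_Suc: "kron_list (map \<sigma> [0..<Suc n]) = kron (kron_list (map \<sigma> [0..<n])) (\<sigma> n)"
  by (simp add: kron_list_def)

text \<open>Induction on the number of factors, adding the last one in each step. Primitivity of the
  product belongs to the induction hypothesis, since it provides the invariance and the nonnegative
  Dirichlet form used for the accumulated factor.\<close>

theorem theorem8p5:
  fixes n :: nat and dms :: "nat \<Rightarrow> nat"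
    and Ls :: "nat \<Rightarrow> complex mat \<Rightarrow> complex mat"
    and \<sigma> :: "nat \<Rightarrow> complex mat"
    and c d :: "nat \<Rightarrow> real" and q :: real
  assumes "n \<ge> 1" and "q \<ge> 1"
    and "\<And>i. i < n \<Longrightarrow> primitive_QMS (dms i) (Ls i) (\<sigma> i)"
    and "\<And>i. i < n \<Longrightarrow> LSI_CB q (c i) (d i) (dms i) (Ls i) (\<sigma> i)"
  shows "primitive_QMS (\<Prod>i<n. dms i) (tensor_generator n dms Ls) (kron_list (map \<sigma> [0..<n]))
       \<and> LSI_CB q (Max (c ` {..<n})) (\<Sum>i<n. d i) (\<Prod>i<n. dms i)
            (tensor_generator n dms Ls) (kron_list (map \<sigma> [0..<n]))"
  using assms
proof (induction n rule: dec_induct)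
  case base
  let ?m = "dms 0"
  have P: "primitive_QMS ?m (Ls 0) (\<sigma> 0)" and lsi: "LSI_CB q (c 0) (d 0) ?m (Ls 0) (\<sigma> 0)" using base by auto
  note L = primitiveD(2)[OF P]
  have k: "kron_list (map \<sigma> [0..<1]) = \<sigma> 0" by (simp add: kron_list_def One_nat_def kron_one_left[unfolded One_nat_def])
  have e: "tensor_generator 1 dms Ls X = Ls 0 X" if "dim_row X = ?m" "dim_col X = ?m" for X
  proof (rule eq_matI)
    fix i j assume "i < dim_row (Ls 0 X)" "j < dim_col (Ls 0 X)"
    hence ij: "i < ?m" "j < ?m" using superop_dim[OF L that] by auto
    have "tensor_generator 1 dms Ls X $$ (i,j) = (\<Sum>p<1. ampl_mid (\<Prod>k<p. dms k) (dms p) (\<Prod>k\<in>{Suc p..<1}. dms k) (Ls p) X $$ (i,j))"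
      using ij by (intro tensor_generator_entry) (simp_all add: lessThan_Suc One_nat_def)
    also have "\<dots> = ampl_mid 1 ?m 1 (Ls 0) X $$ (i,j)" by (simp add: lessThan_Suc One_nat_def)
    also have "\<dots> = ampl 1 ?m (Ls 0) X $$ (i,j)" using ampl_mid_right[of X 1 ?m "Ls 0"] that by simp
    finally show "tensor_generator 1 dms Ls X $$ (i,j) = Ls 0 X $$ (i,j)" using ampl_one_dim[of X ?m "Ls 0", OF that superop_dim[OF L that]] by simp
  qed (use superop_dim[OF L that] in \<open>simp_all add: lessThan_Suc One_nat_def\<close>)
  have pm: "(\<Prod>i<1. dms i) = ?m" and pc: "Max (c ` {..<1}) = c 0" and pd: "(\<Sum>i<1. d i) = d 0"
    by (simp_all add: lessThan_Suc One_nat_def)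
  show ?case unfolding k pm pc pd
    using primitive_QMS_cong[OF P, of "tensor_generator 1 dms Ls"] LSI_CB_cong[OF lsi, of "tensor_generator 1 dms Ls"] e by auto
next
  case (step n)
  let ?M = "\<Prod>i<n. dms i" and ?L = "tensor_generator n dms Ls" and ?\<sigma> = "kron_list (map \<sigma> [0..<n])"
  have IH: "primitive_QMS ?M ?L ?\<sigma>" "LSI_CB q (Max (c ` {..<n})) (\<Sum>i<n. d i) ?M ?L ?\<sigma>"
    using step.IH step.prems by auto
  have P: "primitive_QMS (dms n) (Ls n) (\<sigma> n)" "LSI_CB q (c n) (d n) (dms n) (Ls n) (\<sigma> n)" using step.prems by auto
  \<comment> \<open>The first \<open>n\<close> factors form one system with dimension
    \<open>?M\<close>, and the factor with index \<open>n\<close> is the other.\<close>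
  interpret tensor_pair ?M "dms n" ?L "Ls n" "tensor_generator (Suc n) dms Ls"
    by unfold_locales (rule primitiveD(2)[OF IH(1)], rule primitiveD(2)[OF P(1)], rule tensor_generator_Suc)
  have "{..<n} \<noteq> {}" using step.hyps by (simp add: lessThan_empty_iff)
  hence "Max (c ` {..<Suc n}) = max (Max (c ` {..<n})) (c n)"
    by (simp add: lessThan_Suc max.commute)
  thus ?case
    using tensor_primitive[OF IH(1) P(1)] tensor_lsi[OF IH(1) P(1) step.prems(1) IH(2) P(2)]
    unfolding kron_list_Suc by simp
qed

end
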